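(* Let $(M,g)$ be a $d$-dimensional geodesically complete Riemannian manifold with Laplace--Beltrami operator $\Delta_M$, let $\pi_{O(M)}:O(M)\to M$ be its orthonormal frame bundle, and let $\Delta_{\mathcal{H}}=\sum_{i=1}^d H_i^2$ be the horizontal Laplacian of $O(M)$, where $H_1,\dots,H_d$ are the canonical horizontal vector fields. Then $$\Delta_{\mathcal{H}}\left(f\circ\pi_{O(M)}\right)=(\Delta_M f)\circ\pi_{O(M)}\qquad\text{for all } f\in C^\infty(M).$$
   Context: An orthonormal frame $u$ at $p\in M$ is an ordered orthonormal basis $\{ue_i\}_{1\le i\le d}$ of $T_pM$, where $\{e_i\}$ is the canonical basis of $\mathbb{R}^d$ (so $u$ is regarded as a linear isometry $\mathbb{R}^d\to T_pM$). $O(M)$ is the disjoint union over $p\in M$ of the sets $O_p$ of orthonormal frames at $p$, and $\pi_{O(M)}$ sends $u\in O_p$ to $p$. A smooth curve $u:I\to O(M)$ is horizontal if for every $e\in\mathbb{R}^d$ the vector field $u(t)e$ is parallel along $\pi_{O(M)}\circ u$ with respect to the Levi-Civita connection of $M$. The tangent vectors of horizontal curves at $u$ form the horizontal subspace $\mathcal{H}_uO(M)$, on which $d\pi_{O(M),u}$ is an isomorphism onto $T_{\pi_{O(M)}(u)}M$. The canonical horizontal vector field $H_i$ is defined by letting $H_i(u)$ be the unique vector in $\mathcal{H}_uO(M)$ with $d\pi_{O(M),u}(H_i(u))=ue_i$, $i=1,\dots,d$. $H_i^2$ means applying $H_i$ twice as a derivation. *)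

theory Defs
  imports "HOL-Analysis.Analysis"
begin

section \<open>Smooth maps between Euclidean spaces\<close>

fun Ck_on :: "nat \<Rightarrow> 'a::euclidean_space set \<Rightarrow> ('a \<Rightarrow> 'b::real_normed_vector) \<Rightarrow> bool" where
  "Ck_on 0 S f \<longleftrightarrow> continuous_on S f"
| "Ck_on (Suc k) S f \<longleftrightarrow> (\<forall>x\<in>S. f differentiable (at x)) \<and>
     (\<forall>v. Ck_on k S (\<lambda>x. frechet_derivative f (at x) v))"

text \<open>Only used for open \<open>S\<close>.\<close>

definition smooth_on :: "'a::euclidean_space set \<Rightarrow> ('a \<Rightarrow> 'b::real_normed_vector) \<Rightarrow> bool" where
  "smooth_on S f \<longleftrightarrow> (\<forall>k. Ck_on k S f)"


section \<open>Charts, smooth functions, smooth curves, tangent vectors\<close>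

text \<open>
  A chart is its domain together with a coordinate map (irrelevant outside the domain).

  The notions of this section are relative to a family of charts \<open>B\<close> and a subset \<open>S\<close> of the
  points covered by \<open>B\<close>. For a manifold \<open>S\<close> is everything; for an embedded submanifold \<open>S\<close> of the
  manifold with charts \<open>B\<close> they give the submanifold structure: smooth functions on \<open>S\<close> are those
  that extend locally to smooth functions, smooth curves in \<open>S\<close> are the smooth curves of the
  ambient manifold that stay in \<open>S\<close>.
\<close>

type_synonym ('p, 'e) chart = "'p set \<times> ('p \<Rightarrow> 'e)"

definition smooth_atlas :: "('m::topological_space, 'e::euclidean_space) chart set \<Rightarrow> bool" where
  "smooth_atlas A \<longleftrightarrow>
     (\<Union>(U, \<phi>)\<in>A. U) = UNIV \<and>
     (\<forall>(U, \<phi>)\<in>A. open U \<and> open (\<phi> ` U) \<and> homeomorphism U (\<phi> ` U) \<phi> (inv_into U \<phi>)) \<and>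
     (\<forall>(U, \<phi>)\<in>A. \<forall>(V, \<psi>)\<in>A. smooth_on (\<phi> ` (U \<inter> V)) (\<psi> \<circ> inv_into U \<phi>))"

text \<open>\<open>f\<close> is smooth near \<open>p\<close>; nothing is required of \<open>f\<close> away from \<open>p\<close> or outside \<open>S\<close>.\<close>

definition smooth_fun_at ::
  "('p, 'e::euclidean_space) chart set \<Rightarrow> 'p set \<Rightarrow> ('p \<Rightarrow> real) \<Rightarrow> 'p \<Rightarrow> bool" where
  "smooth_fun_at B S f p \<longleftrightarrow>
     (\<forall>(U, \<phi>)\<in>B. p \<in> U \<longrightarrow>
        (\<exists>W h. open W \<and> \<phi> p \<in> W \<and> smooth_on W h \<and>
           (\<forall>q\<in>U \<inter> S. \<phi> q \<in> W \<longrightarrow> f q = h (\<phi> q))))"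

definition smooth_curve ::
  "('p, 'e::euclidean_space) chart set \<Rightarrow> 'p set \<Rightarrow> real set \<Rightarrow> (real \<Rightarrow> 'p) \<Rightarrow> bool" where
  "smooth_curve B S I c \<longleftrightarrow>
     open I \<and> is_interval I \<and> c ` I \<subseteq> S \<and>
     (\<forall>t\<in>I. \<exists>(U, \<phi>)\<in>B. \<exists>J. open J \<and> t \<in> J \<and> J \<subseteq> I \<and> c ` J \<subseteq> U \<and> smooth_on J (\<phi> \<circ> c))"

text \<open>
  A tangent vector at \<open>p\<close> is the class of smooth curves through \<open>p\<close> with the same velocity,
  represented by the derivation it induces on functions smooth near \<open>p\<close>. To make the
  representation unique, a tangent vector is \<open>0\<close> on all other functions.
  Tangent vectors are added and scaled pointwise.
\<close>

type_synonym 'p tvec = "('p \<Rightarrow> real) \<Rightarrow> real"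

definition velocity ::
  "('p, 'e::euclidean_space) chart set \<Rightarrow> 'p set \<Rightarrow> (real \<Rightarrow> 'p) \<Rightarrow> real \<Rightarrow> 'p tvec" where
  "velocity B S c t =
     (\<lambda>f. if smooth_fun_at B S f (c t) then deriv (\<lambda>s. f (c s)) t else 0)"

definition tangent_space ::
  "('p, 'e::euclidean_space) chart set \<Rightarrow> 'p set \<Rightarrow> 'p \<Rightarrow> 'p tvec set" where
  "tangent_space B S p =
     {velocity B S c t | c I t. smooth_curve B S I c \<and> t \<in> I \<and> c t = p}"

text \<open>The differential at \<open>q\<close> of a map \<open>\<pi>\<close> into the manifold with atlas \<open>A\<close>.\<close>

definition differential ::
  "('m, 'e::euclidean_space) chart set \<Rightarrow> ('p \<Rightarrow> 'm) \<Rightarrow> 'p \<Rightarrow> 'p tvec \<Rightarrow> 'm tvec" where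
  "differential A \<pi> q X =
     (\<lambda>f. if smooth_fun_at A UNIV f (\<pi> q) then X (f \<circ> \<pi>) else 0)"

text \<open>
  From here on a manifold is a whole type \<open>'m\<close> with an atlas \<open>A\<close> of charts with values in
  \<open>real ^ 'd\<close>, so that its dimension is \<open>CARD('d)\<close>.
\<close>

abbreviation tangent :: "('m, real ^ 'd) chart set \<Rightarrow> 'm \<Rightarrow> 'm tvec set" where
  "tangent A p \<equiv> tangent_space A UNIV p"

definition C_inf_on :: "('m, real ^ 'd) chart set \<Rightarrow> 'm set \<Rightarrow> ('m \<Rightarrow> real) \<Rightarrow> bool" where
  "C_inf_on A U f \<longleftrightarrow> (\<forall>p\<in>U. smooth_fun_at A UNIV f p)"

text \<open>The field \<open>\<Sum>\<^sub>i v\<^sub>i \<partial>\<^sub>i\<close> of a chart, and the components \<open>X x\<^sup>i\<close> of a tangent vector \<open>X\<close>.\<close>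

definition coord_field ::
  "('m, real ^ 'd) chart set \<Rightarrow> ('m, real ^ 'd) chart \<Rightarrow> real ^ 'd \<Rightarrow> 'm \<Rightarrow> 'm tvec" where
  "coord_field A \<kappa> v p =
     (case \<kappa> of (U, \<phi>) \<Rightarrow> velocity A UNIV (\<lambda>s. inv_into U \<phi> (\<phi> p + s *\<^sub>R v)) 0)"

definition components :: "('m, real ^ 'd) chart \<Rightarrow> 'm tvec \<Rightarrow> real ^ 'd" where
  "components \<kappa> X = (case \<kappa> of (U, \<phi>) \<Rightarrow> (\<chi> i. X (\<lambda>q. \<phi> q $ i)))"

text \<open>Total functions \<open>X\<close> serve as vector fields on open sets \<open>U\<close>; values outside \<open>U\<close> are junk.\<close>

definition smooth_vector_field ::
  "('m::topological_space, real ^ 'd) chart set \<Rightarrow> 'm set \<Rightarrow> ('m \<Rightarrow> 'm tvec) \<Rightarrow> bool" where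
  "smooth_vector_field A U X \<longleftrightarrow>
     (\<forall>p\<in>U. X p \<in> tangent A p) \<and>
     (\<forall>V f. open V \<longrightarrow> V \<subseteq> U \<longrightarrow> C_inf_on A V f \<longrightarrow> C_inf_on A V (\<lambda>p. X p f))"

definition lie_bracket ::
  "('m, real ^ 'd) chart set \<Rightarrow> ('m \<Rightarrow> 'm tvec) \<Rightarrow> ('m \<Rightarrow> 'm tvec) \<Rightarrow> 'm \<Rightarrow> 'm tvec" where
  "lie_bracket A X Y p =
     (\<lambda>f. if smooth_fun_at A UNIV f p then X p (\<lambda>q. Y q f) - Y p (\<lambda>q. X q f) else 0)"


section \<open>Riemannian metrics and the Levi-Civita connection\<close>

type_synonym 'm metric = "'m \<Rightarrow> 'm tvec \<Rightarrow> 'm tvec \<Rightarrow> real"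

definition riemannian_metric :: "('m, real ^ 'd) chart set \<Rightarrow> 'm metric \<Rightarrow> bool" where
  "riemannian_metric A g \<longleftrightarrow>
     (\<forall>p. \<forall>X\<in>tangent A p. \<forall>Y\<in>tangent A p. \<forall>Z\<in>tangent A p. \<forall>a.
        g p X Y = g p Y X \<and>
        g p (\<lambda>f. X f + Y f) Z = g p X Z + g p Y Z \<and>
        g p (\<lambda>f. a * X f) Y = a * g p X Y \<and>
        (X \<noteq> (\<lambda>f. 0) \<longrightarrow> g p X X > 0)) \<and>
     (\<forall>\<kappa>\<in>A. \<forall>v w. C_inf_on A (fst \<kappa>) (\<lambda>p. g p (coord_field A \<kappa> v p) (coord_field A \<kappa> w p)))"

text \<open>
  An affine connection is a local operator, so it acts on vector fields over arbitrary open sets,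
  compatibly with restriction. Accordingly \<open>nabla X Y\<close> (that is, \<open>\<nabla>\<^sub>X Y\<close>) is only meaningful on
  open sets on which both \<open>X\<close> and \<open>Y\<close> are smooth.
\<close>

type_synonym 'm connection = "('m \<Rightarrow> 'm tvec) \<Rightarrow> ('m \<Rightarrow> 'm tvec) \<Rightarrow> 'm \<Rightarrow> 'm tvec"

definition affine_connection ::
  "('m::topological_space, real ^ 'd) chart set \<Rightarrow> 'm connection \<Rightarrow> bool" where
  "affine_connection A nabla \<longleftrightarrow>
     (\<forall>U X Y. open U \<and> smooth_vector_field A U X \<and> smooth_vector_field A U Y \<longrightarrow>
        smooth_vector_field A U (nabla X Y) \<and>
        (\<forall>X' Y'. (\<forall>p\<in>U. X' p = X p \<and> Y' p = Y p) \<longrightarrow> (\<forall>p\<in>U. nabla X' Y' p = nabla X Y p)) \<and>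
        (\<forall>Z. smooth_vector_field A U Z \<longrightarrow>
           (\<forall>p\<in>U. nabla (\<lambda>q \<psi>. X q \<psi> + Z q \<psi>) Y p = (\<lambda>\<psi>. nabla X Y p \<psi> + nabla Z Y p \<psi>) \<and>
                  nabla X (\<lambda>q \<psi>. Y q \<psi> + Z q \<psi>) p = (\<lambda>\<psi>. nabla X Y p \<psi> + nabla X Z p \<psi>))) \<and>
        (\<forall>f. C_inf_on A U f \<longrightarrow>
           (\<forall>p\<in>U. nabla (\<lambda>q \<psi>. f q * X q \<psi>) Y p = (\<lambda>\<psi>. f p * nabla X Y p \<psi>) \<and>
                  nabla X (\<lambda>q \<psi>. f q * Y q \<psi>) p = (\<lambda>\<psi>. X p f * Y p \<psi> + f p * nabla X Y p \<psi>))))"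

definition levi_civita_connection ::
  "('m::topological_space, real ^ 'd) chart set \<Rightarrow> 'm metric \<Rightarrow> 'm connection \<Rightarrow> bool" where
  "levi_civita_connection A g nabla \<longleftrightarrow>
     affine_connection A nabla \<and>
     (\<forall>U X Y. open U \<and> smooth_vector_field A U X \<and> smooth_vector_field A U Y \<longrightarrow>
        (\<forall>p\<in>U. (\<lambda>f. nabla X Y p f - nabla Y X p f) = lie_bracket A X Y p)) \<and>
     (\<forall>U X Y Z. open U \<and> smooth_vector_field A U X \<and> smooth_vector_field A U Y \<and>
          smooth_vector_field A U Z \<longrightarrow>
        (\<forall>p\<in>U. X p (\<lambda>q. g q (Y q) (Z q)) = g p (nabla X Y p) (Z p) + g p (Y p) (nabla X Z p)))"

text \<open>
  \<open>\<nabla>\<^sub>v Y\<close> for a single tangent vector \<open>v\<close> at \<open>p\<close>, well-defined because \<open>\<nabla>\<^sub>X Y\<close> is tensorial in \<open>X\<close>.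
\<close>

definition nabla_at ::
  "('m::topological_space, real ^ 'd) chart set \<Rightarrow> 'm connection \<Rightarrow> 'm \<Rightarrow> 'm tvec \<Rightarrow>
     ('m \<Rightarrow> 'm tvec) \<Rightarrow> 'm tvec" where
  "nabla_at A nabla p v Y =
     (THE w. \<forall>U X. open U \<and> p \<in> U \<and> smooth_vector_field A U X \<and> X p = v \<longrightarrow> w = nabla X Y p)"


section \<open>Parallel fields along curves, geodesics, completeness\<close>

definition tangent_bundle_atlas ::
  "('m, real ^ 'd) chart set \<Rightarrow> ('m \<times> 'm tvec, (real ^ 'd) \<times> (real ^ 'd)) chart set" where
  "tangent_bundle_atlas A =
     (\<lambda>\<kappa>. ({(p, X). p \<in> fst \<kappa> \<and> X \<in> tangent A p}, \<lambda>(p, X). (snd \<kappa> p, components \<kappa> X))) ` A"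

definition tangent_bundle :: "('m, real ^ 'd) chart set \<Rightarrow> ('m \<times> 'm tvec) set" where
  "tangent_bundle A = {(p, X). X \<in> tangent A p}"

text \<open>
  The covariant derivative of the field \<open>V = \<Sum>\<^sub>j V\<^sup>j \<partial>\<^sub>j\<close> along the curve \<open>\<gamma>\<close>, computed in a chart
  \<open>\<kappa>\<close> around \<open>\<gamma> t\<close>, as \<open>\<Sum>\<^sub>j (V\<^sup>j)' \<partial>\<^sub>j + V\<^sup>j \<nabla>\<^sub>\<gamma>\<^sub>' \<partial>\<^sub>j\<close>.
\<close>

definition covariant_derivative ::
  "('m::topological_space, real ^ 'd) chart set \<Rightarrow> 'm connection \<Rightarrow> ('m, real ^ 'd) chart \<Rightarrow>
     (real \<Rightarrow> 'm) \<Rightarrow> (real \<Rightarrow> 'm tvec) \<Rightarrow> real \<Rightarrow> 'm tvec" where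
  "covariant_derivative A nabla \<kappa> \<gamma> V t =
     (\<lambda>f. \<Sum>j\<in>UNIV.
        deriv (\<lambda>s. components \<kappa> (V s) $ j) t * coord_field A \<kappa> (axis j 1) (\<gamma> t) f +
        components \<kappa> (V t) $ j *
          nabla_at A nabla (\<gamma> t) (velocity A UNIV \<gamma> t) (coord_field A \<kappa> (axis j 1)) f)"

definition parallel_along ::
  "('m::topological_space, real ^ 'd) chart set \<Rightarrow> 'm connection \<Rightarrow> real set \<Rightarrow>
     (real \<Rightarrow> 'm) \<Rightarrow> (real \<Rightarrow> 'm tvec) \<Rightarrow> bool" where
  "parallel_along A nabla I \<gamma> V \<longleftrightarrow>
     smooth_curve (tangent_bundle_atlas A) (tangent_bundle A) I (\<lambda>t. (\<gamma> t, V t)) \<and>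
     (\<forall>t\<in>I. \<forall>\<kappa>\<in>A. \<gamma> t \<in> fst \<kappa> \<longrightarrow> covariant_derivative A nabla \<kappa> \<gamma> V t = (\<lambda>f. 0))"

definition geodesic ::
  "('m::topological_space, real ^ 'd) chart set \<Rightarrow> 'm connection \<Rightarrow> real set \<Rightarrow>
     (real \<Rightarrow> 'm) \<Rightarrow> bool" where
  "geodesic A nabla I \<gamma> \<longleftrightarrow>
     smooth_curve A UNIV I \<gamma> \<and> parallel_along A nabla I \<gamma> (velocity A UNIV \<gamma>)"

definition geodesically_complete ::
  "('m::topological_space, real ^ 'd) chart set \<Rightarrow> 'm connection \<Rightarrow> bool" where
  "geodesically_complete A nabla \<longleftrightarrow>
     (\<forall>p. \<forall>v\<in>tangent A p. \<exists>\<gamma>. geodesic A nabla UNIV \<gamma> \<and> \<gamma> 0 = p \<and> velocity A UNIV \<gamma> 0 = v)"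


section \<open>Frames and the Laplace--Beltrami operator\<close>

definition linear_frame ::
  "('m, real ^ 'd) chart set \<Rightarrow> 'm \<Rightarrow> (real ^ 'd \<Rightarrow> 'm tvec) \<Rightarrow> bool" where
  "linear_frame A p b \<longleftrightarrow>
     bij_betw b UNIV (tangent A p) \<and>
     (\<forall>x y. b (x + y) = (\<lambda>f. b x f + b y f)) \<and>
     (\<forall>a x. b (a *\<^sub>R x) = (\<lambda>f. a * b x f))"

definition gradient ::
  "('m, real ^ 'd) chart set \<Rightarrow> 'm metric \<Rightarrow> ('m \<Rightarrow> real) \<Rightarrow> 'm \<Rightarrow> 'm tvec" where
  "gradient A g f p = (THE X. X \<in> tangent A p \<and> (\<forall>Y\<in>tangent A p. g p X Y = Y f))"

text \<open>
  The trace of an endomorphism of the tangent space at \<open>p\<close>: the trace of its matrix in a basis,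
  which does not depend on the basis.
\<close>

definition tangent_trace ::
  "('m, real ^ 'd) chart set \<Rightarrow> 'm \<Rightarrow> ('m tvec \<Rightarrow> 'm tvec) \<Rightarrow> real" where
  "tangent_trace A p L =
     (let b = (SOME b. linear_frame A p b) in trace (matrix (inv_into UNIV b \<circ> L \<circ> b)))"

definition divergence ::
  "('m::topological_space, real ^ 'd) chart set \<Rightarrow> 'm connection \<Rightarrow> ('m \<Rightarrow> 'm tvec) \<Rightarrow>
     'm \<Rightarrow> real" where
  "divergence A nabla X p = tangent_trace A p (\<lambda>v. nabla_at A nabla p v X)"

definition laplace_beltrami ::
  "('m::topological_space, real ^ 'd) chart set \<Rightarrow> 'm metric \<Rightarrow> 'm connection \<Rightarrow>
     ('m \<Rightarrow> real) \<Rightarrow> 'm \<Rightarrow> real" where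
  "laplace_beltrami A g nabla f = divergence A nabla (gradient A g f)"


section \<open>The orthonormal frame bundle and its horizontal Laplacian\<close>

text \<open>
  The charts of the bundle of all linear frames: base point and matrix of the frame in the
  coordinate basis. \<open>O(M)\<close> carries its structure of embedded submanifold of that bundle.
\<close>

definition frame_atlas ::
  "('m, real ^ 'd) chart set \<Rightarrow>
     ('m \<times> (real ^ 'd \<Rightarrow> 'm tvec), (real ^ 'd) \<times> (real ^ 'd ^ 'd)) chart set" where
  "frame_atlas A =
     (\<lambda>\<kappa>. ({(p, u). p \<in> fst \<kappa> \<and> linear_frame A p u},
           \<lambda>(p, u). (snd \<kappa> p, matrix (\<lambda>x. components \<kappa> (u x))))) ` A"

definition orthonormal_frames ::
  "('m, real ^ 'd) chart set \<Rightarrow> 'm metric \<Rightarrow> ('m \<times> (real ^ 'd \<Rightarrow> 'm tvec)) set" where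
  "orthonormal_frames A g =
     {(p, u). linear_frame A p u \<and> (\<forall>x y. g p (u x) (u y) = x \<bullet> y)}"

definition frame_proj :: "'m \<times> (real ^ 'd \<Rightarrow> 'm tvec) \<Rightarrow> 'm" where
  "frame_proj = fst"

definition horizontal_curve ::
  "('m::topological_space, real ^ 'd) chart set \<Rightarrow> 'm metric \<Rightarrow> 'm connection \<Rightarrow> real set \<Rightarrow>
     (real \<Rightarrow> 'm \<times> (real ^ 'd \<Rightarrow> 'm tvec)) \<Rightarrow> bool" where
  "horizontal_curve A g nabla I c \<longleftrightarrow>
     smooth_curve (frame_atlas A) (orthonormal_frames A g) I c \<and>
     (\<forall>e. parallel_along A nabla I (frame_proj \<circ> c) (\<lambda>t. snd (c t) e))"

definition horizontal_space ::
  "('m::topological_space, real ^ 'd) chart set \<Rightarrow> 'm metric \<Rightarrow> 'm connection \<Rightarrow>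
     'm \<times> (real ^ 'd \<Rightarrow> 'm tvec) \<Rightarrow> ('m \<times> (real ^ 'd \<Rightarrow> 'm tvec)) tvec set" where
  "horizontal_space A g nabla w =
     {velocity (frame_atlas A) (orthonormal_frames A g) c t | c I t.
        horizontal_curve A g nabla I c \<and> t \<in> I \<and> c t = w}"

definition canonical_horizontal ::
  "('m::topological_space, real ^ 'd) chart set \<Rightarrow> 'm metric \<Rightarrow> 'm connection \<Rightarrow> 'd \<Rightarrow>
     'm \<times> (real ^ 'd \<Rightarrow> 'm tvec) \<Rightarrow> ('m \<times> (real ^ 'd \<Rightarrow> 'm tvec)) tvec" where
  "canonical_horizontal A g nabla i w =
     (THE X. X \<in> horizontal_space A g nabla w \<and>
             differential A frame_proj w X = snd w (axis i 1))"

definition horizontal_laplacian ::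
  "('m::topological_space, real ^ 'd) chart set \<Rightarrow> 'm metric \<Rightarrow> 'm connection \<Rightarrow>
     ('m \<times> (real ^ 'd \<Rightarrow> 'm tvec) \<Rightarrow> real) \<Rightarrow> 'm \<times> (real ^ 'd \<Rightarrow> 'm tvec) \<Rightarrow> real" where
  "horizontal_laplacian A g nabla F w =
     (\<Sum>i\<in>UNIV. canonical_horizontal A g nabla i w (\<lambda>w'. canonical_horizontal A g nabla i w' F))"

end

theory Submission
  imports Defs
begin

text \<open>
  A horizontal vector at a frame is determined by its projection, because the equation of parallel
  transport expresses the derivative of the frame matrix through the velocity of the base curve; it
  exists because this equation is a linear ODE along a coordinate line, whose solutions stay
  orthonormal. Hence \<open>H\<^sub>i (f \<circ> \<pi>)\<close> is the function \<open>u \<mapsto> (u e\<^sub>i) f\<close>. Differentiating it once more along a horizontal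
  curve gives \<open>V (V f) - (\<nabla>\<^sub>V V) f\<close>, where \<open>V\<close> is the coordinate field of constant coefficients with
  \<open>V = u e\<^sub>i\<close> at the base point; by metric compatibility this is \<open>g (\<nabla>\<^sub>V grad f) V\<close>, and the sum over
  an orthonormal frame is the trace defining \<open>\<Delta> f\<close>.
\<close>

section \<open>Smooth maps\<close>

text \<open>\<open>O(M)\<close> enters only as a subset of the linear frame bundle: its smooth
  functions are those that extend locally, its tangent vectors are velocities of curves that stay
  inside. So the argument runs on curves and local extensions, never on charts of
  \<open>O(M)\<close>. Two features of the encoding shape it. A tangent vector takes the value 0 on
  functions that are not smooth near its point, so every intermediate function has to be shown
  smooth before it is differentiated, above all the function \<open>(u e_i) f\<close> of the frame
  \<open>u\<close>. And a parallel field must satisfy its equation in every chart, while a lift is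
  built in a single one, so the covariant derivative must be independent of the chart. One formula
  serves both halves: the derivative of \<open>(u(s) e) \<psi>\<close> along a horizontal curve
  depends only on the current frame and the velocity of the base curve. With coordinate functions
  for \<open>\<psi>\<close> it makes horizontal vectors unique; with \<open>f\<close> it is the
  second derivative.\<close>

lemma Ck_on_cong:
  fixes f g :: "'a::euclidean_space \<Rightarrow> 'b::real_normed_vector"
  assumes "open S" "\<And>x. x \<in> S \<Longrightarrow> f x = g x"
  shows "Ck_on k S f \<longleftrightarrow> Ck_on k S g"
  using assms(2)
proof (induction k arbitrary: f g)
  case 0
  then show ?case by (auto intro: continuous_on_cong)
next
  case (Suc k)
  have "h differentiable (at x)"
    if k: "k differentiable (at x)" and x: "x \<in> S" and eq: "\<And>x. x \<in> S \<Longrightarrow> h x = k x"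
    for h k :: "'a \<Rightarrow> 'b" and x
  proof -
    obtain k' where "(k has_derivative k') (at x)" using k unfolding differentiable_def by blast
    then have "(h has_derivative k') (at x)"
      by (rule has_derivative_transform_within_open[OF _ assms(1) x]) (simp add: eq)
    then show ?thesis unfolding differentiable_def by blast
  qed
  then have "f differentiable (at x) \<longleftrightarrow> g differentiable (at x)" if "x \<in> S" for x
    using Suc.prems that by metis
  moreover have "frechet_derivative f (at x) = frechet_derivative g (at x)" 
    if "x \<in> S" "f differentiable (at x)" for x
    using Suc.prems that assms(1)
    by (intro frechet_derivative_transform_within_open[of _ _ S]) auto
  ultimately show ?case
    using Suc.IH[of "\<lambda>x. frechet_derivative f (at x) v" "\<lambda>x. frechet_derivative g (at x) v" for v]
    by (auto cong: conj_cong)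
qed

lemma Ck_on_transform:
  "Ck_on k S f \<Longrightarrow> open S \<Longrightarrow> (\<And>x. x \<in> S \<Longrightarrow> g x = f x) \<Longrightarrow> Ck_on k S g"
  using Ck_on_cong[of S g f k] by blast

lemma Ck_on_subset: "Ck_on k S f \<Longrightarrow> T \<subseteq> S \<Longrightarrow> Ck_on k T f"
  by (induction k arbitrary: f) (auto intro: continuous_on_subset)

text \<open>Lets an explicit formula \<open>f'\<close> stand in for
  \<open>frechet_derivative\<close>, so that the sum, product and chain rules can be fed directly
  into inductions on the order.\<close>

lemma Ck_on_Suc_iff:
  assumes "open S" "\<And>x. x \<in> S \<Longrightarrow> (f has_derivative f' x) (at x)"
  shows "Ck_on (Suc k) S f \<longleftrightarrow> (\<forall>v. Ck_on k S (\<lambda>x. f' x v))"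
proof -
  have "frechet_derivative f (at x) = f' x" if "x \<in> S" for x
    using assms(2)[OF that] frechet_derivative_at by metis
  then have "Ck_on k S (\<lambda>x. frechet_derivative f (at x) v) \<longleftrightarrow> Ck_on k S (\<lambda>x. f' x v)" for v
    by (intro Ck_on_cong assms(1)) auto
  then show ?thesis
    using assms(2) by (auto simp: differentiable_def)
qed

lemma Ck_on_SucD: "Ck_on (Suc k) S f \<Longrightarrow> Ck_on k S f"
proof (induction k arbitrary: f)
  case 0
  then show ?case
    by (auto intro!: continuous_at_imp_continuous_on differentiable_imp_continuous_within)
next
  case (Suc k)
  have "\<forall>x\<in>S. f differentiable (at x)" using Suc.prems by simp
  moreover have "Ck_on k S (\<lambda>x. frechet_derivative f (at x) v)" for v
    using Suc.prems by (intro Suc.IH) (simp only: Ck_on.simps(2)[of "Suc k"])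
  ultimately show ?case by simp
qed

lemma Ck_on_Suc_has_derivative:
  assumes "Ck_on (Suc k) S f" "x \<in> S"
  shows "(f has_derivative frechet_derivative f (at x)) (at x)"
  using assms frechet_derivative_works by auto

lemma Ck_on_local:
  assumes "\<And>x. x \<in> S \<Longrightarrow> \<exists>T. x \<in> T \<and> open T \<and> Ck_on k T f"
  shows "Ck_on k S f"
  using assms
proof (induction k arbitrary: f)
  case 0
  then show ?case
    by (metis Ck_on.simps(1) continuous_at_imp_continuous_on continuous_on_eq_continuous_at)
next
  case (Suc k)
  show ?case
  proof (simp, intro conjI ballI allI)
    fix x assume "x \<in> S"
    then show "f differentiable (at x)" using Suc.prems by force
  next
    fix v
    show "Ck_on k S (\<lambda>x. frechet_derivative f (at x) v)"
    proof (rule Suc.IH)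
      fix x assume "x \<in> S"
      then show "\<exists>T. x \<in> T \<and> open T \<and> Ck_on k T (\<lambda>x. frechet_derivative f (at x) v)"
        using Suc.prems[of x] by auto
    qed
  qed
qed

section \<open>Closure properties of C^k maps\<close>

lemma Ck_on_const: "Ck_on k S (\<lambda>x. c)"
  by (induction k arbitrary: c) auto

lemma Ck_on_bounded_linear:
  assumes "open S" "bounded_linear L" "Ck_on k S f"
  shows "Ck_on k S (\<lambda>x. L (f x))"
  using assms(3)
proof (induction k arbitrary: f)
  case 0
  then show ?case using assms(2) by (auto intro: bounded_linear.continuous_on)
next
  case (Suc k)
  have "Ck_on (Suc k) S (\<lambda>x. L (f x)) \<longleftrightarrow> (\<forall>v. Ck_on k S (\<lambda>x. L (frechet_derivative f (at x) v)))"
    by (intro Ck_on_Suc_iff assms(1) bounded_linear.has_derivative[OF assms(2)]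
        Ck_on_Suc_has_derivative[OF Suc.prems])
  then show ?case using Suc by auto
qed

lemma Ck_on_add:
  assumes "open S" "Ck_on k S f" "Ck_on k S g"
  shows "Ck_on k S (\<lambda>x. f x + g x)"
  using assms(2,3)
proof (induction k arbitrary: f g)
  case 0
  then show ?case by (auto intro: continuous_intros)
next
  case (Suc k)
  have "Ck_on (Suc k) S (\<lambda>x. f x + g x) \<longleftrightarrow> 
      (\<forall>v. Ck_on k S (\<lambda>x. frechet_derivative f (at x) v + frechet_derivative g (at x) v))"
    by (intro Ck_on_Suc_iff assms(1) has_derivative_add Ck_on_Suc_has_derivative[OF Suc.prems(1)]
        Ck_on_Suc_has_derivative[OF Suc.prems(2)])
  then show ?case using Suc by auto
qed

lemma Ck_on_sum:
  assumes "open S" "\<And>i. i \<in> I \<Longrightarrow> Ck_on k S (f i)"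
  shows "Ck_on k S (\<lambda>x. \<Sum>i\<in>I. f i x)"
  using assms(2) by (induction I rule: infinite_finite_induct)
    (auto intro: Ck_on_const Ck_on_add[OF assms(1)])

text \<open>By the Leibniz rule a derivative is a sum of two products of the same kind, each with
  one undifferentiated factor; that factor is lowered by one order so that the induction hypothesis
  applies.\<close>

lemma Ck_on_bounded_bilinear:
  assumes "open S" "bounded_bilinear B" "Ck_on k S f" "Ck_on k S g"
  shows "Ck_on k S (\<lambda>x. B (f x) (g x))"
  using assms(3,4)
proof (induction k arbitrary: f g)
  case 0
  then show ?case using assms(2) by (auto intro: bounded_bilinear.continuous_on)
next
  case (Suc k)
  have "Ck_on (Suc k) S (\<lambda>x. B (f x) (g x)) \<longleftrightarrow> 
      (\<forall>v. Ck_on k S (\<lambda>x. B (f x) (frechet_derivative g (at x) v) + B (frechet_derivative f (at x) v) (g x)))"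
    by (intro Ck_on_Suc_iff assms(1) bounded_bilinear.FDERIV[OF assms(2)]
        Ck_on_Suc_has_derivative[OF Suc.prems(1)] Ck_on_Suc_has_derivative[OF Suc.prems(2)])
  moreover have "Ck_on k S f" "Ck_on k S g"
    using Suc.prems Ck_on_SucD by blast+
  ultimately show ?case using Suc by (auto intro!: Ck_on_add assms(1))
qed

text \<open>\<open>Ck_on\<close> controls derivatives only in fixed directions. Expanding in
  \<open>Basis\<close> reduces a direction that varies with the point to finitely many fixed ones
  with varying scalar coefficients.\<close>

lemma has_derivative_expand_Basis:
  fixes f :: "'a::euclidean_space \<Rightarrow> 'b::real_normed_vector"
  assumes "(f has_derivative f') F"
  shows "f' v = (\<Sum>b\<in>Basis. (v \<bullet> b) *\<^sub>R f' b)"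
proof -
  have "linear f'" using assms has_derivative_linear by blast
  have "f' v = f' (\<Sum>b\<in>Basis. (v \<bullet> b) *\<^sub>R b)" by (simp add: euclidean_representation)
  also have "\<dots> = (\<Sum>b\<in>Basis. (v \<bullet> b) *\<^sub>R f' b)"
    by (simp add: linear_sum[OF \<open>linear f'\<close>] linear_cmul[OF \<open>linear f'\<close>])
  finally show ?thesis .
qed

text \<open>In the chain rule the direction in which \<open>f\<close> is differentiated moves with
  \<open>x\<close>. The basis expansion turns this derivative into a sum of products, and the
  induction hypothesis is applied to the derivatives of \<open>f\<close> in the basis
  directions.\<close>

lemma Ck_on_compose:
  fixes g :: "'a::euclidean_space \<Rightarrow> 'b::euclidean_space"
  assumes "open S" "Ck_on k T f" "Ck_on k S g" "g ` S \<subseteq> T"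
  shows "Ck_on k S (\<lambda>x. f (g x))"
  using assms(2,3)
proof (induction k arbitrary: f)
  case 0
  then show ?case using continuous_on_compose2[of T f S g] assms(4) by simp
next
  case (Suc k)
  let ?f' = "\<lambda>y. frechet_derivative f (at y)" and ?g' = "\<lambda>x. frechet_derivative g (at x)"
  have "((\<lambda>x. f (g x)) has_derivative (\<lambda>v. ?f' (g x) (?g' x v))) (at x)" if "x \<in> S" for x
    using Ck_on_Suc_has_derivative[OF Suc.prems(1), of "g x"]
      Ck_on_Suc_has_derivative[OF Suc.prems(2) that] assms(4) that
    by (auto intro: has_derivative_compose)
  then have "Ck_on (Suc k) S (\<lambda>x. f (g x)) \<longleftrightarrow> (\<forall>v. Ck_on k S (\<lambda>x. ?f' (g x) (?g' x v)))"
    by (intro Ck_on_Suc_iff assms(1))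
  moreover have "Ck_on k S (\<lambda>x. ?f' (g x) (?g' x v))" for v
  proof -
    have "Ck_on k S (\<lambda>x. \<Sum>b\<in>Basis. (?g' x v \<bullet> b) *\<^sub>R ?f' (g x) b)"
      using Suc Ck_on_SucD[OF Suc.prems(2)]
      by (auto intro!: Ck_on_sum assms(1) Ck_on_bounded_bilinear[OF _ bounded_bilinear_scaleR]
          Ck_on_bounded_linear[OF _ bounded_linear_inner_left])
    moreover have "?f' (g x) (?g' x v) = (\<Sum>b\<in>Basis. (?g' x v \<bullet> b) *\<^sub>R ?f' (g x) b)" if "x \<in> S" for x
      using Ck_on_Suc_has_derivative[OF Suc.prems(1), of "g x"] assms(4) that
      by (intro has_derivative_expand_Basis) auto
    ultimately show ?thesis by (rule Ck_on_transform[OF _ assms(1)])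
  qed
  ultimately show ?case by blast
qed

section \<open>Closure properties of smooth maps\<close>

lemma smooth_on_transform:
  "smooth_on S f \<Longrightarrow> open S \<Longrightarrow> (\<And>x. x \<in> S \<Longrightarrow> g x = f x) \<Longrightarrow> smooth_on S g"
  unfolding smooth_on_def using Ck_on_transform by blast

lemma smooth_on_subset: "smooth_on S f \<Longrightarrow> T \<subseteq> S \<Longrightarrow> smooth_on T f"
  unfolding smooth_on_def using Ck_on_subset by blast

lemma smooth_on_local:
  "(\<And>x. x \<in> S \<Longrightarrow> \<exists>T. x \<in> T \<and> open T \<and> smooth_on T f) \<Longrightarrow> smooth_on S f"
  unfolding smooth_on_def by (metis Ck_on_local)

lemma smooth_on_const: "smooth_on S (\<lambda>x. c)"
  by (simp add: smooth_on_def Ck_on_const)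

lemma smooth_on_bounded_linear:
  "open S \<Longrightarrow> bounded_linear L \<Longrightarrow> smooth_on S f \<Longrightarrow> smooth_on S (\<lambda>x. L (f x))"
  by (simp add: smooth_on_def Ck_on_bounded_linear)

lemma smooth_on_ident: "open S \<Longrightarrow> smooth_on S (\<lambda>x. x)"
proof -
  assume "open S"
  have "Ck_on k S (\<lambda>x. x)" for k
    by (cases k) (auto simp: Ck_on_const)
  then show ?thesis by (simp add: smooth_on_def)
qed

lemma smooth_on_add:
  "open S \<Longrightarrow> smooth_on S f \<Longrightarrow> smooth_on S g \<Longrightarrow> smooth_on S (\<lambda>x. f x + g x)"
  by (simp add: smooth_on_def Ck_on_add)

lemma smooth_on_sum:
  "open S \<Longrightarrow> (\<And>i. i \<in> I \<Longrightarrow> smooth_on S (f i)) \<Longrightarrow> smooth_on S (\<lambda>x. \<Sum>i\<in>I. f i x)"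
  by (simp add: smooth_on_def Ck_on_sum)

lemma smooth_on_bounded_bilinear:
  "open S \<Longrightarrow> bounded_bilinear B \<Longrightarrow> smooth_on S f \<Longrightarrow> smooth_on S g
    \<Longrightarrow> smooth_on S (\<lambda>x. B (f x) (g x))"
  by (simp add: smooth_on_def Ck_on_bounded_bilinear)

lemmas smooth_on_mult = smooth_on_bounded_bilinear[OF _ bounded_bilinear_mult]
lemmas smooth_on_scaleR = smooth_on_bounded_bilinear[OF _ bounded_bilinear_scaleR]

lemma smooth_on_prod:
  fixes f :: "'i \<Rightarrow> 'a::euclidean_space \<Rightarrow> real"
  shows "open S \<Longrightarrow> (\<And>i. i \<in> I \<Longrightarrow> smooth_on S (f i)) \<Longrightarrow> smooth_on S (\<lambda>x. \<Prod>i\<in>I. f i x)"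
  by (induction I rule: infinite_finite_induct) (auto intro: smooth_on_const smooth_on_mult)

lemma smooth_on_compose:
  fixes g :: "'a::euclidean_space \<Rightarrow> 'b::euclidean_space"
  shows "open S \<Longrightarrow> smooth_on T f \<Longrightarrow> smooth_on S g \<Longrightarrow> g ` S \<subseteq> T \<Longrightarrow> smooth_on S (\<lambda>x. f (g x))"
  unfolding smooth_on_def by (blast intro: Ck_on_compose)

lemma smooth_on_has_derivative:
  "smooth_on S f \<Longrightarrow> x \<in> S \<Longrightarrow> (f has_derivative frechet_derivative f (at x)) (at x)"
  unfolding smooth_on_def using Ck_on_Suc_has_derivative by blast

lemma smooth_on_frechet_derivative:
  "smooth_on S f \<Longrightarrow> smooth_on S (\<lambda>x. frechet_derivative f (at x) v)"
  unfolding smooth_on_def by (metis Ck_on.simps(2))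

lemma smooth_on_imp_continuous_on: "smooth_on S f \<Longrightarrow> continuous_on S f"
  unfolding smooth_on_def by (metis Ck_on.simps(1))

text \<open>Base point and direction may both vary. In a chart, \<open>X f\<close> for a vector
  field \<open>X\<close> and \<open>(u e) f\<close> for a frame \<open>u\<close> both have this
  form; the components of \<open>X\<close>, or the frame matrix applied to \<open>e\<close>, supply
  the direction.\<close>

lemma smooth_on_frechet_derivative_pair:
  fixes f :: "'a::euclidean_space \<Rightarrow> 'b::real_normed_vector"
  assumes "open S" "open T" "smooth_on S f" "smooth_on T a" "smooth_on T b" "a ` T \<subseteq> S"
  shows "smooth_on T (\<lambda>z. frechet_derivative f (at (a z)) (b z))"
proof -
  have "smooth_on T (\<lambda>z. \<Sum>e\<in>Basis. (b z \<bullet> e) *\<^sub>R frechet_derivative f (at (a z)) e)"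
    using assms
    by (intro smooth_on_sum smooth_on_scaleR smooth_on_bounded_linear[OF _ bounded_linear_inner_left]
        smooth_on_compose[OF _ smooth_on_frechet_derivative[of S]]) auto
  moreover have "frechet_derivative f (at (a z)) (b z) =
      (\<Sum>e\<in>Basis. (b z \<bullet> e) *\<^sub>R frechet_derivative f (at (a z)) e)" if "z \<in> T" for z
    using assms that
    by (intro has_derivative_expand_Basis[OF smooth_on_has_derivative]) auto
  ultimately show ?thesis by (rule smooth_on_transform[OF _ assms(2)])
qed

lemma smooth_on_componentwise:
  fixes f :: "'a::euclidean_space \<Rightarrow> 'b::euclidean_space"
  assumes "open S" "\<And>b. b \<in> Basis \<Longrightarrow> smooth_on S (\<lambda>x. f x \<bullet> b)"
  shows "smooth_on S f"
proof -
  have "smooth_on S (\<lambda>x. \<Sum>b\<in>Basis. (f x \<bullet> b) *\<^sub>R b)"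
    using assms by (intro smooth_on_sum smooth_on_scaleR smooth_on_const) auto
  then show ?thesis by (simp add: euclidean_representation)
qed

text \<open>The derivative of \<open>1/f\<close> is \<open>-(1/f) f' (1/f)\<close>, which involves
  nothing but \<open>1/f\<close> and \<open>f'\<close>; so order k of \<open>1/f\<close> yields
  order k + 1 of the same function.\<close>

lemma smooth_on_inverse:
  fixes f :: "'a::euclidean_space \<Rightarrow> real"
  assumes "open S" "smooth_on S f" "\<And>x. x \<in> S \<Longrightarrow> f x \<noteq> 0"
  shows "smooth_on S (\<lambda>x. inverse (f x))"
proof -
  have "Ck_on k S (\<lambda>x. inverse (f x))" for k
  proof (induction k)
    case 0
    then show ?case 
      using assms smooth_on_imp_continuous_on by (auto intro: continuous_on_inverse)
  next
    case (Suc k)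
    let ?f' = "\<lambda>x. frechet_derivative f (at x)"
    have "Ck_on (Suc k) S (\<lambda>x. inverse (f x)) \<longleftrightarrow>
        (\<forall>v. Ck_on k S (\<lambda>x. - (inverse (f x) * ?f' x v * inverse (f x))))"
      using assms smooth_on_has_derivative[OF assms(2)]
      by (intro Ck_on_Suc_iff assms(1) Deriv.has_derivative_inverse) auto
    moreover have "Ck_on k S (\<lambda>x. ?f' x v)" for v
      using smooth_on_frechet_derivative[OF assms(2)] smooth_on_def by blast
    ultimately show ?case
      using Suc by (auto intro!: Ck_on_bounded_linear[OF _ bounded_linear_minus[OF bounded_linear_ident]]
        assms(1) Ck_on_bounded_bilinear[OF _ bounded_bilinear_mult])
  qed
  then show ?thesis by (simp add: smooth_on_def)
qed

lemma smooth_on_det: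
  fixes M :: "'a::euclidean_space \<Rightarrow> real ^ 'd ^ 'd"
  assumes "open S" "\<And>i j. smooth_on S (\<lambda>x. M x $ i $ j)"
  shows "smooth_on S (\<lambda>x. det (M x))"
  unfolding det_def
  by (intro smooth_on_sum smooth_on_mult smooth_on_const smooth_on_prod assms)

text \<open>Cramer's rule writes each coordinate of the solution as a quotient of determinants with
  smooth entries. This is how the gradient will be seen to be smooth.\<close>

lemma smooth_on_linear_system:
  fixes M :: "'a::euclidean_space \<Rightarrow> real ^ 'd ^ 'd" and y b :: "'a \<Rightarrow> real ^ 'd"
  assumes "open S" "\<And>i j. smooth_on S (\<lambda>x. M x $ i $ j)" "\<And>i. smooth_on S (\<lambda>x. b x $ i)"
    and "\<And>x. x \<in> S \<Longrightarrow> det (M x) \<noteq> 0" "\<And>x. x \<in> S \<Longrightarrow> M x *v y x = b x"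
  shows "smooth_on S (\<lambda>x. y x $ k)"
proof -
  have "smooth_on S (\<lambda>x. (if j = k then b x $ i else M x $ i $ j))" for i j
    by (cases "j = k") (auto simp: assms)
  then have "smooth_on S (\<lambda>x. det (\<chi> i j. if j = k then b x $ i else M x $ i $ j) * inverse (det (M x)))"
    by (intro smooth_on_mult smooth_on_inverse smooth_on_det) (auto simp: assms)
  moreover have "y x $ k = det (\<chi> i j. if j = k then b x $ i else M x $ i $ j) * inverse (det (M x))"
    if "x \<in> S" for x
    using cramer[of "M x" "y x" "b x"] assms(4,5)[OF that] by (auto simp: divide_inverse)
  ultimately show ?thesis by (rule smooth_on_transform[OF _ assms(1)])
qed

lemma smooth_on_Pair:
  fixes f :: "'a::euclidean_space \<Rightarrow> 'b::real_normed_vector" and h :: "'a \<Rightarrow> 'c::real_normed_vector"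
  assumes "open S" "smooth_on S f" "smooth_on S h"
  shows "smooth_on S (\<lambda>x. (f x, h x))"
proof -
  have "smooth_on S (\<lambda>x. (f x, 0) + (0, h x))"
    by (intro smooth_on_add smooth_on_bounded_linear[OF assms(1) _ assms(2)] 
        smooth_on_bounded_linear[OF assms(1) _ assms(3)] bounded_linear_Pair bounded_linear_ident
        bounded_linear_zero assms(1))
  then show ?thesis by simp
qed

section \<open>Matrix-valued maps and derivatives of curves\<close>

lemma Basis_matrix: "(b :: real ^ 'd ^ 'e) \<in> Basis \<Longrightarrow> \<exists>k i. b = axis k (axis i 1)"
  by (auto simp: Basis_vec_def)

lemma inner_Basis_matrix: "(M :: real ^ 'd ^ 'e) \<bullet> axis k (axis i 1) = M $ k $ i"
  by (simp add: inner_axis)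

lemma smooth_on_matrix_entries:
  fixes M :: "'a::euclidean_space \<Rightarrow> real ^ 'd ^ 'e"
  assumes "open S" "\<And>k i. smooth_on S (\<lambda>x. M x $ k $ i)"
  shows "smooth_on S M"
proof (rule smooth_on_componentwise[OF assms(1)])
  fix b :: "real ^ 'd ^ 'e" assume "b \<in> Basis"
  then obtain k i where "b = axis k (axis i 1)" using Basis_matrix by blast
  then show "smooth_on S (\<lambda>x. M x \<bullet> b)" using assms(2) by (simp add: inner_Basis_matrix)
qed

lemma has_vector_derivative_matrix_entries:
  fixes M :: "real \<Rightarrow> real ^ 'd ^ 'e"
  assumes "\<And>k i. ((\<lambda>s. M s $ k $ i) has_real_derivative D $ k $ i) (at t)"
  shows "(M has_vector_derivative D) (at t)"
  unfolding has_vector_derivative_def has_derivative_componentwise_within[of M]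
proof
  fix b :: "real ^ 'd ^ 'e" assume "b \<in> Basis"
  then obtain k i where "b = axis k (axis i 1)" using Basis_matrix by blast
  then show "((\<lambda>s. M s \<bullet> b) has_derivative (\<lambda>h. h *\<^sub>R D \<bullet> b)) (at t)"
    using assms[of k i] by (simp add: inner_Basis_matrix has_field_derivative_def mult_commute_abs)
qed

lemma has_vector_derivative_nth:
  "(f has_vector_derivative D) F \<Longrightarrow> ((\<lambda>s. f s $ i) has_vector_derivative D $ i) F"
  using bounded_linear.has_vector_derivative[OF bounded_linear_vec_nth] .

lemma has_real_derivative_nth:
  fixes f :: "real \<Rightarrow> real ^ 'd"
  shows "(f has_vector_derivative D) (at t) \<Longrightarrow> ((\<lambda>s. f s $ i) has_real_derivative D $ i) (at t)"
  unfolding has_real_derivative_iff_has_vector_derivative by (rule has_vector_derivative_nth)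

lemma bounded_linear_matrix_vector_left:
  "bounded_linear (\<lambda>B :: real ^ 'd ^ 'e. B *v e)"
proof -
  have "linear (\<lambda>B :: real ^ 'd ^ 'e. B *v e)"
    by (rule linearI) (simp_all add: matrix_vector_mult_def vec_eq_iff sum.distrib sum_distrib_left algebra_simps)
  then show ?thesis by (simp add: linear_conv_bounded_linear)
qed

lemma has_vector_derivative_line:
  "((\<lambda>s. a + (t + s) *\<^sub>R v) has_vector_derivative v) (at s)"
  by (auto intro!: derivative_eq_intros simp: has_vector_derivative_def)

lemma smooth_on_has_vector_derivative:
  fixes c :: "real \<Rightarrow> 'b::real_normed_vector"
  assumes "smooth_on J c" "t \<in> J"
  shows "(c has_vector_derivative frechet_derivative c (at t) 1) (at t)"
proof -
  have D: "(c has_derivative frechet_derivative c (at t)) (at t)"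
    using assms smooth_on_has_derivative by blast
  moreover have "frechet_derivative c (at t) = (\<lambda>x. x *\<^sub>R frechet_derivative c (at t) 1)"
  proof
    fix x
    show "frechet_derivative c (at t) x = x *\<^sub>R frechet_derivative c (at t) 1"
      using linear_cmul[OF has_derivative_linear[OF D], of x 1] by simp
  qed
  ultimately show ?thesis unfolding has_vector_derivative_def by metis
qed

lemma open_preimage_smooth_on:
  assumes "open J" "smooth_on J c" "open W"
  shows "open {s \<in> J. c s \<in> W}"
proof -
  have "open (c -` W \<inter> J)"
    using smooth_on_imp_continuous_on[OF assms(2)] assms by (simp add: continuous_on_open_vimage)
  moreover have "c -` W \<inter> J = {s \<in> J. c s \<in> W}" by auto
  ultimately show ?thesis by simp
qed

section \<open>Linear ordinary differential equations\<close>

text \<open>Picard's theorem: the integral operator \<open>T\<close> is a contraction of the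
  complete space of bounded continuous functions. The interval extends to both sides of 0 because a
  smooth curve must be defined on an open interval around the time of its velocity.\<close>

lemma linear_ode_exists:
  fixes prod :: "'c::real_normed_vector \<Rightarrow> 'a::banach \<Rightarrow> 'a" and N :: "real \<Rightarrow> 'c"
  assumes "bounded_bilinear prod" "a > 0" "continuous_on {-a..a} N"
  obtains \<delta> y where "0 < \<delta>" "\<delta> \<le> a" "y 0 = y0"
    "\<And>t. t \<in> {-\<delta><..<\<delta>} \<Longrightarrow> (y has_vector_derivative prod (N t) (y t)) (at t)"
proof -
  interpret bounded_bilinear prod by (rule assms(1))
  obtain K0 where K0: "K0 > 0" "\<And>u v. norm (prod u v) \<le> norm u * norm v * K0"
    using pos_bounded by blast
  have "bounded (N ` {-a..a})" using assms(3) compact_continuous_image compact_imp_bounded by blast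
  then obtain C where C: "C > 0" "\<And>t. t \<in> {-a..a} \<Longrightarrow> norm (N t) \<le> C" 
    unfolding bounded_pos by blast
  define K where "K = C * K0"
  have K: "norm (prod (N t) v) \<le> K * norm v" if "t \<in> {-a..a}" for t v
  proof -
    have "norm (prod (N t) v) \<le> norm (N t) * norm v * K0" by (rule K0)
    also have "\<dots> \<le> C * norm v * K0" using C(2)[OF that] K0 by (intro mult_right_mono) auto
    finally show ?thesis by (simp add: K_def mult_ac)
  qed
  have "K > 0" using C K0 by (simp add: K_def)
  \<comment> \<open>\<open>K\<close> bounds the operator norm of \<open>prod (N t)\<close>. An
    integral over length at most \<open>2 * \<delta>\<close> is then Lipschitz in \<open>x\<close>
    with constant \<open>2 * \<delta> * K\<close>, at most 1/4; \<open>T\<close> contains a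
    difference of two such integrals, so it contracts by 1/2.\<close>
  define \<delta> where "\<delta> = min a (1 / (8 * K))"
  have \<delta>: "0 < \<delta>" "\<delta> \<le> a" "8 * (\<delta> * K) \<le> 1"
    using assms \<open>K > 0\<close> by (auto simp: \<delta>_def min_def field_simps)
  \<comment> \<open>The elements of \<open>bcontfun\<close> live on the whole line. Clamping time to
    \<open>[-\<delta>, \<delta>]\<close> keeps the integral bounded and continuous there and changes
    nothing on the interval itself.\<close>
  define c where "c t = max (-\<delta>) (min \<delta> t)" for t
  have c: "c t \<in> {-\<delta>..\<delta>}" for t using \<delta> by (auto simp: c_def)
  have c_cont: "continuous_on UNIV c" unfolding c_def by (intro continuous_intros)
  \<comment> \<open>Integration starts at the left end, so that differentiability at interior times
    holds alike on both sides of 0; subtracting \<open>I x 0\<close> in \<open>T\<close> restores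
    the initial value.\<close>
  define I where "I x t = integral {-\<delta>..t} (\<lambda>s. prod (N s) (apply_bcontfun x s))" for x t
  have cont: "continuous_on {-\<delta>..t} (\<lambda>s. prod (N s) (apply_bcontfun x s))" if "t \<le> \<delta>" for x t
    using that \<delta> by (intro continuous_on continuous_on_subset[OF assms(3)] continuous_on_apply_bcontfun) auto
  have I_cont: "continuous_on {-\<delta>..\<delta>} (I x)" for x
    unfolding I_def by (intro indefinite_integral_continuous_1 integrable_continuous_real cont) simp
  define T where "T x = Bcontfun (\<lambda>t. y0 + (I x (c t) - I x 0))" for x
  have T: "apply_bcontfun (T x) t = y0 + (I x (c t) - I x 0)" for x t
  proof -
    have "bounded (I x ` {-\<delta>..\<delta>})" using I_cont compact_continuous_image compact_imp_bounded by blast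
    then obtain B where B: "\<And>t. t \<in> {-\<delta>..\<delta>} \<Longrightarrow> norm (I x t) \<le> B" unfolding bounded_iff by blast
    have "norm (y0 + (I x (c t) - I x 0)) \<le> norm y0 + (B + B)" for t
      using B[OF c[of t]] B[of 0] \<delta> norm_triangle_ineq4[of "I x (c t)" "I x 0"]
        norm_triangle_ineq[of y0 "I x (c t) - I x 0"] by simp
    moreover have "continuous_on UNIV (\<lambda>t. I x (c t))"
      using c by (intro continuous_on_compose2[OF I_cont c_cont]) auto
    ultimately have "(\<lambda>t. y0 + (I x (c t) - I x 0)) \<in> bcontfun"
      by (intro bcontfun_normI continuous_intros) auto
    then show ?thesis unfolding T_def by (simp add: Bcontfun_inverse)
  qed
  have I_diff: "norm (I x t - I y t) \<le> 1/4 * dist x y" if t: "t \<in> {-\<delta>..\<delta>}" for x y t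
  proof -
    have "norm (I x t - I y t) = 
        norm (integral {-\<delta>..t} (\<lambda>s. prod (N s) (apply_bcontfun x s - apply_bcontfun y s)))"
      using t unfolding I_def diff_right
      by (intro arg_cong[where f = norm] integral_diff[symmetric] integrable_continuous_real cont) auto
    also have "norm (integral {-\<delta>..t} (\<lambda>s. prod (N s) (apply_bcontfun x s - apply_bcontfun y s)))
        \<le> K * dist x y * (t - - \<delta>)"
    proof (rule integral_bound)
      fix s assume s: "s \<in> {-\<delta>..t}"
      have "norm (prod (N s) (apply_bcontfun x s - apply_bcontfun y s)) \<le> 
          K * norm (apply_bcontfun x s - apply_bcontfun y s)"
        using s t \<delta> by (intro K) auto
      also have "\<dots> \<le> K * dist x y" 
        using \<open>K > 0\<close> dist_bounded[of x s y] by (simp add: dist_norm)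
      finally show "norm (prod (N s) (apply_bcontfun x s - apply_bcontfun y s)) \<le> K * dist x y" .
    qed (use t cont[of t x] cont[of t y] in \<open>auto simp: diff_right intro!: continuous_on_diff\<close>)
    also have "K * dist x y * (t - - \<delta>) \<le> K * dist x y * (2 * \<delta>)"
      using t \<open>K > 0\<close> by (intro mult_left_mono) auto
    also have "K * dist x y * (2 * \<delta>) \<le> 1/4 * dist x y"
      using mult_right_mono[OF \<delta>(3), of "dist x y"] by (simp add: algebra_simps)
    finally show ?thesis .
  qed
  have "dist (T x) (T y) \<le> 1/2 * dist x y" for x y
  proof (rule dist_bound)
    fix t
    have "dist (apply_bcontfun (T x) t) (apply_bcontfun (T y) t) = 
        norm ((I x (c t) - I y (c t)) - (I x 0 - I y 0))"
      by (simp add: T dist_norm algebra_simps)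
    also have "\<dots> \<le> 1/4 * dist x y + 1/4 * dist x y"
      using I_diff[OF c, of x t y] I_diff[of 0 x y] \<delta> norm_triangle_ineq4[of "I x (c t) - I y (c t)" "I x 0 - I y 0"]
      by simp
    finally show "dist (apply_bcontfun (T x) t) (apply_bcontfun (T y) t) \<le> 1/2 * dist x y" by simp
  qed
  then obtain x where x: "T x = x" using banach_fix_type[of "1/2" T] by auto
  have xt: "apply_bcontfun x t = y0 + (I x t - I x 0)" if "t \<in> {-\<delta>..\<delta>}" for t
    using T[of x t] that unfolding x by (simp add: c_def)
  have D: "(apply_bcontfun x has_vector_derivative prod (N t) (apply_bcontfun x t)) (at t)" 
    if t: "t \<in> {-\<delta><..<\<delta>}" for t
  proof -
    have "(I x has_vector_derivative prod (N t) (apply_bcontfun x t)) (at t within {-\<delta>..\<delta>})"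
      unfolding I_def using t by (intro integral_has_vector_derivative cont) auto
    then have "(I x has_vector_derivative prod (N t) (apply_bcontfun x t)) (at t)"
      using t by (simp add: at_within_Icc_at)
    then have "((\<lambda>t. y0 + (I x t - I x 0)) has_vector_derivative prod (N t) (apply_bcontfun x t)) (at t)"
      by (auto intro!: derivative_eq_intros)
    then show ?thesis
      by (rule has_vector_derivative_transform_within_open[of _ _ _ "{-\<delta><..<\<delta>}"]) (use t xt in auto)
  qed
  show ?thesis
    by (rule that[OF \<delta>(1,2) _ D]) (use xt[of 0] \<delta> in auto)
qed

text \<open>Bootstrapping: if \<open>y\<close> has order k, so has the right-hand side, which is the
  derivative of \<open>y\<close>; hence \<open>y\<close> has order k + 1.\<close>

lemma linear_ode_smooth:
  fixes prod :: "'c::euclidean_space \<Rightarrow> 'a::euclidean_space \<Rightarrow> 'a" and N :: "real \<Rightarrow> 'c"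
  assumes "bounded_bilinear prod" "open J" "smooth_on J N"
    and "\<And>t. t \<in> J \<Longrightarrow> (y has_vector_derivative prod (N t) (y t)) (at t)"
  shows "smooth_on J y"
proof -
  have "Ck_on k J y" for k
  proof (induction k)
    case 0
    show ?case 
      using has_vector_derivative_continuous[OF assms(4)]
      by (auto intro!: continuous_at_imp_continuous_on)
  next
    case (Suc k)
    have "Ck_on k J (\<lambda>t. v *\<^sub>R prod (N t) (y t))" for v
      using assms(3) Suc unfolding smooth_on_def
      by (intro Ck_on_bounded_linear[OF assms(2) bounded_linear_scaleR_right] 
          Ck_on_bounded_bilinear[OF assms(2,1)]) auto
    then show ?case
      using Ck_on_Suc_iff[OF assms(2), of y "\<lambda>t h. h *\<^sub>R prod (N t) (y t)" k] assms(4)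
      unfolding has_vector_derivative_def by blast
  qed
  then show ?thesis by (simp add: smooth_on_def)
qed

lemma bounded_bilinear_matrix_mult: 
  "bounded_bilinear ((**) :: real ^ 'd ^ 'd \<Rightarrow> real ^ 'd ^ 'd \<Rightarrow> real ^ 'd ^ 'd)"
  unfolding bilinear_conv_bounded_bilinear[symmetric] bilinear_def
  by (auto intro!: linearI simp: matrix_matrix_mult_def vec_eq_iff sum.distrib sum_distrib_left algebra_simps)

section \<open>Charts and tangent vectors\<close>

lemma smooth_curveE:
  assumes "smooth_curve B S I c" "t \<in> I"
  obtains U \<phi> J where "(U, \<phi>) \<in> B" "open J" "t \<in> J" "J \<subseteq> I" "c ` J \<subseteq> U" "smooth_on J (\<lambda>s. \<phi> (c s))"
  using assms unfolding smooth_curve_def o_def by fast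

lemma smooth_curveI:
  assumes "open I" "is_interval I" "c ` I \<subseteq> S"
    and "\<And>t. t \<in> I \<Longrightarrow> \<exists>U \<phi> J. (U, \<phi>) \<in> B \<and> open J \<and> t \<in> J \<and> J \<subseteq> I \<and> c ` J \<subseteq> U \<and> 
      smooth_on J (\<lambda>s. \<phi> (c s))"
  shows "smooth_curve B S I c"
  unfolding smooth_curve_def o_def
proof (intro conjI ballI assms(1-3))
  fix t assume "t \<in> I"
  then obtain U \<phi> J where "(U, \<phi>) \<in> B" "open J \<and> t \<in> J \<and> J \<subseteq> I \<and> c ` J \<subseteq> U \<and> smooth_on J (\<lambda>s. \<phi> (c s))"
    using assms(4) by blast
  then show "\<exists>(U, \<phi>)\<in>B. \<exists>J. open J \<and> t \<in> J \<and> J \<subseteq> I \<and> c ` J \<subseteq> U \<and> smooth_on J (\<lambda>s. \<phi> (c s))"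
    by (intro bexI[of _ "(U, \<phi>)"]) auto
qed

lemma smooth_fun_at_extensionE:
  assumes "smooth_fun_at B S f p" "(U, \<phi>) \<in> B" "p \<in> U"
  obtains W h where "open W" "\<phi> p \<in> W" "smooth_on W h" "\<forall>q\<in>U \<inter> S. \<phi> q \<in> W \<longrightarrow> f q = h (\<phi> q)"
  using assms unfolding smooth_fun_at_def by fast

text \<open>Only on \<open>S\<close> is \<open>f\<close> a smooth function \<open>h\<close> of the
  coordinates, but the curve stays in \<open>S\<close>. So \<open>f\<close> may be replaced by
  \<open>h\<close> along it, on the times when the coordinates lie in the domain of
  \<open>h\<close>.\<close>

lemma smooth_curve_compose:
  assumes "smooth_curve B S I c" "t \<in> I" "smooth_fun_at B S f (c t)"
  obtains J where "open J" "t \<in> J" "J \<subseteq> I" "smooth_on J (\<lambda>s. f (c s))"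
proof -
  obtain U \<phi> J where U: "(U, \<phi>) \<in> B" "open J" "t \<in> J" "J \<subseteq> I" "c ` J \<subseteq> U" "smooth_on J (\<lambda>s. \<phi> (c s))"
    by (rule smooth_curveE[OF assms(1,2)])
  have S: "c ` I \<subseteq> S" using assms(1) unfolding smooth_curve_def by blast
  have ct: "c t \<in> U" using U(3,5) by blast
  obtain W h where W: "open W" "\<phi> (c t) \<in> W" "smooth_on W h" 
      "\<forall>q\<in>U \<inter> S. \<phi> q \<in> W \<longrightarrow> f q = h (\<phi> q)"
    by (rule smooth_fun_at_extensionE[OF assms(3) U(1) ct])
  let ?J = "{s \<in> J. \<phi> (c s) \<in> W}"
  have oJ: "open ?J" by (rule open_preimage_smooth_on[OF U(2,6) W(1)])
  have "smooth_on ?J (\<lambda>s. h (\<phi> (c s)))"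
    by (rule smooth_on_compose[OF oJ W(3) smooth_on_subset[OF U(6)]]) auto
  then have "smooth_on ?J (\<lambda>s. f (c s))"
  proof (rule smooth_on_transform[OF _ oJ])
    fix s assume s: "s \<in> ?J"
    then have "c s \<in> U" "c s \<in> S" using S U(4,5) by blast+
    then show "f (c s) = h (\<phi> (c s))" using W(4) s by blast
  qed
  then show ?thesis using oJ U(3,4) W(2) by (intro that[of ?J]) auto
qed

section \<open>Charts of a manifold\<close>

locale smooth_manifold =
  fixes A :: "('m::topological_space, real ^ 'd) chart set"
  assumes atlas: "smooth_atlas A"
begin

lemma chart_exists: obtains U \<phi> where "(U, \<phi>) \<in> A" "p \<in> U"
proof -
  have "p \<in> (\<Union>(U, \<phi>)\<in>A. U)"
    using atlas unfolding smooth_atlas_def by (metis UNIV_I)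
  then show ?thesis using that by auto
qed

lemma
  assumes "(U, \<phi>) \<in> A"
  shows open_chart_domain: "open U"
    and open_chart_image: "open (\<phi> ` U)"
    and homeomorphism_chart: "homeomorphism U (\<phi> ` U) \<phi> (inv_into U \<phi>)"
  using atlas assms unfolding smooth_atlas_def by fast+

lemma smooth_on_transition:
  assumes "(U, \<phi>) \<in> A" "(V, \<psi>) \<in> A"
  shows "smooth_on (\<phi> ` (U \<inter> V)) (\<lambda>x. \<psi> (inv_into U \<phi> x))"
  using atlas assms unfolding smooth_atlas_def o_def by fast

lemma
  assumes "(U, \<phi>) \<in> A"
  shows inv_chart [simp]: "p \<in> U \<Longrightarrow> inv_into U \<phi> (\<phi> p) = p"
    and chart_inv [simp]: "x \<in> \<phi> ` U \<Longrightarrow> \<phi> (inv_into U \<phi> x) = x"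
    and inv_chart_in [simp]: "x \<in> \<phi> ` U \<Longrightarrow> inv_into U \<phi> x \<in> U"
  using homeomorphism_chart[OF assms] unfolding homeomorphism_def by (auto simp: f_inv_into_f)

lemma chart_inj: "(U, \<phi>) \<in> A \<Longrightarrow> p \<in> U \<Longrightarrow> q \<in> U \<Longrightarrow> \<phi> p = \<phi> q \<Longrightarrow> p = q"
  using inv_chart by metis

lemma chart_mem_image: "(U, \<phi>) \<in> A \<Longrightarrow> V \<subseteq> U \<Longrightarrow> p \<in> U \<Longrightarrow> \<phi> p \<in> \<phi> ` V \<longleftrightarrow> p \<in> V"
  using chart_inj by blast

lemma open_chart_image_subset:
  assumes "(U, \<phi>) \<in> A" "open V" "V \<subseteq> U"
  shows "open (\<phi> ` V)"
proof -
  have "openin (top_of_set (\<phi> ` U)) (\<phi> ` V)"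
    using homeomorphism_imp_open_map[OF homeomorphism_chart[OF assms(1)]] assms
    by (simp add: openin_open_eq open_chart_domain)
  then show ?thesis
    using open_chart_image[OF assms(1)] openin_open_eq by blast
qed

lemma open_chart_preimage:
  assumes "(U, \<phi>) \<in> A" "open W"
  shows "open {q \<in> U. \<phi> q \<in> W}"
proof -
  have "continuous_on U \<phi>" using homeomorphism_chart[OF assms(1)] homeomorphism_def by blast
  then have "open (\<phi> -` W \<inter> U)"
    using open_chart_domain[OF assms(1)] assms(2) by (simp add: continuous_on_open_vimage)
  moreover have "\<phi> -` W \<inter> U = {q \<in> U. \<phi> q \<in> W}" by auto
  ultimately show ?thesis by simp
qed


subsection \<open>Smooth functions\<close>

text \<open>The definition asks for an extension in every chart around \<open>p\<close>; one chart
  suffices because the transition maps are smooth.\<close>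

lemma smooth_fun_at_chart_iff:
  assumes "(U, \<phi>) \<in> A" "p \<in> U"
  shows "smooth_fun_at A UNIV f p \<longleftrightarrow>
    (\<exists>W. open W \<and> p \<in> W \<and> W \<subseteq> U \<and> smooth_on (\<phi> ` W) (\<lambda>x. f (inv_into U \<phi> x)))"
    (is "?L \<longleftrightarrow> ?R")
proof
  assume ?L
  then obtain W h where W: "open W" "\<phi> p \<in> W" "smooth_on W h" "\<forall>q\<in>U. \<phi> q \<in> W \<longrightarrow> f q = h (\<phi> q)"
    using assms unfolding smooth_fun_at_def by fast
  let ?W = "{q \<in> U. \<phi> q \<in> W}"
  have "open ?W" "p \<in> ?W" "?W \<subseteq> U" using open_chart_preimage assms W by auto
  moreover have "smooth_on (\<phi> ` ?W) (\<lambda>x. f (inv_into U \<phi> x))"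
  proof (rule smooth_on_transform[of _ h])
    show "smooth_on (\<phi> ` ?W) h" using W(3) by (rule smooth_on_subset) auto
    show "open (\<phi> ` ?W)" using open_chart_image_subset[OF assms(1) \<open>open ?W\<close>] by auto
  qed (use W assms in auto)
  ultimately show ?R by blast
next
  assume ?R
  then obtain W where W: "open W" "p \<in> W" "W \<subseteq> U" "smooth_on (\<phi> ` W) (\<lambda>x. f (inv_into U \<phi> x))"
    by blast
  show ?L
    unfolding smooth_fun_at_def
  proof (safe)
    fix V \<psi> assume V: "(V, \<psi>) \<in> A" "p \<in> V"
    let ?W = "\<psi> ` (V \<inter> W)"
    have op: "open ?W" using open_chart_image_subset[OF V(1)] W(1) open_chart_domain[OF V(1)] by auto
    have "smooth_on ?W (\<lambda>x. (\<lambda>y. f (inv_into U \<phi> y)) (\<phi> (inv_into V \<psi> x)))"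
      using V(1) W(3)
      by (intro smooth_on_compose[OF op W(4)] smooth_on_subset[OF smooth_on_transition[OF V(1) assms(1)]]) auto
    then have "smooth_on ?W (\<lambda>x. f (inv_into V \<psi> x))"
      by (rule smooth_on_transform) (use op V W assms in auto)
    moreover have "\<psi> p \<in> ?W" using V W by auto
    moreover have "\<forall>q\<in>V \<inter> UNIV. \<psi> q \<in> ?W \<longrightarrow> f q = f (inv_into V \<psi> (\<psi> q))"
      using V by simp
    ultimately show "\<exists>W h. open W \<and> \<psi> p \<in> W \<and> smooth_on W h \<and> 
        (\<forall>q\<in>V \<inter> UNIV. \<psi> q \<in> W \<longrightarrow> f q = h (\<psi> q))"
      using op by (intro exI[of _ ?W] exI[of _ "\<lambda>x. f (inv_into V \<psi> x)"]) auto
  qed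
qed

lemma smooth_fun_atE:
  assumes "(U, \<phi>) \<in> A" "p \<in> U" "smooth_fun_at A UNIV f p"
  obtains W where "open W" "p \<in> W" "W \<subseteq> U" "smooth_on (\<phi> ` W) (\<lambda>x. f (inv_into U \<phi> x))"
  using assms(3) unfolding smooth_fun_at_chart_iff[OF assms(1,2)] by blast

lemma smooth_fun_atI:
  assumes "(U, \<phi>) \<in> A" "open W" "p \<in> W" "W \<subseteq> U" "smooth_on (\<phi> ` W) (\<lambda>x. f (inv_into U \<phi> x))"
  shows "smooth_fun_at A UNIV f p"
  using assms(2-) smooth_fun_at_chart_iff[OF assms(1)] by blast

lemma smooth_fun_at_iff_C_inf_on:
  "smooth_fun_at A UNIV f p \<longleftrightarrow> (\<exists>W. open W \<and> p \<in> W \<and> C_inf_on A W f)"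
proof
  assume "smooth_fun_at A UNIV f p"
  moreover obtain U \<phi> where U: "(U, \<phi>) \<in> A" "p \<in> U" using chart_exists .
  ultimately obtain W where W: "open W" "p \<in> W" "W \<subseteq> U" "smooth_on (\<phi> ` W) (\<lambda>x. f (inv_into U \<phi> x))"
    using smooth_fun_atE by blast
  then have "C_inf_on A W f"
    unfolding C_inf_on_def using smooth_fun_atI[OF U(1) W(1) _ W(3,4)] by blast
  then show "\<exists>W. open W \<and> p \<in> W \<and> C_inf_on A W f" using W by blast
qed (auto simp: C_inf_on_def)

lemma C_inf_on_chart_iff:
  assumes "(U, \<phi>) \<in> A" "open V" "V \<subseteq> U"
  shows "C_inf_on A V f \<longleftrightarrow> smooth_on (\<phi> ` V) (\<lambda>x. f (inv_into U \<phi> x))"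
proof
  assume L: "C_inf_on A V f"
  show "smooth_on (\<phi> ` V) (\<lambda>x. f (inv_into U \<phi> x))"
  proof (rule smooth_on_local)
    fix x assume "x \<in> \<phi> ` V"
    then obtain p where "p \<in> V" "x = \<phi> p" by blast
    then have "p \<in> U" "smooth_fun_at A UNIV f p" using L assms(3) unfolding C_inf_on_def by blast+
    then obtain W where "open W" "p \<in> W" "W \<subseteq> U" "smooth_on (\<phi> ` W) (\<lambda>x. f (inv_into U \<phi> x))"
      by (rule smooth_fun_atE[OF assms(1)])
    then show "\<exists>T. x \<in> T \<and> open T \<and> smooth_on T (\<lambda>x. f (inv_into U \<phi> x))"
      using \<open>x = \<phi> p\<close> open_chart_image_subset[OF assms(1)] by blast
  qed
next
  assume "smooth_on (\<phi> ` V) (\<lambda>x. f (inv_into U \<phi> x))"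
  then show "C_inf_on A V f"
    using smooth_fun_atI[OF assms(1,2) _ assms(3)] unfolding C_inf_on_def by blast
qed

lemma C_inf_on_subset: "C_inf_on A V f \<Longrightarrow> W \<subseteq> V \<Longrightarrow> C_inf_on A W f"
  unfolding C_inf_on_def by blast

lemma smooth_fun_at_transform:
  assumes "smooth_fun_at A UNIV f p" "open V" "p \<in> V" "\<And>q. q \<in> V \<Longrightarrow> g q = f q"
  shows "smooth_fun_at A UNIV g p"
proof -
  obtain U \<phi> where U: "(U, \<phi>) \<in> A" "p \<in> U" using chart_exists .
  obtain W where W: "open W" "p \<in> W" "W \<subseteq> U" "smooth_on (\<phi> ` W) (\<lambda>x. f (inv_into U \<phi> x))"
    using smooth_fun_atE[OF U assms(1)] .
  have op: "open (\<phi> ` (W \<inter> V))" using W U assms by (intro open_chart_image_subset[OF U(1)]) auto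
  have "smooth_on (\<phi> ` (W \<inter> V)) (\<lambda>x. g (inv_into U \<phi> x))"
  proof (rule smooth_on_transform[OF smooth_on_subset[OF W(4)] op])
    fix x assume "x \<in> \<phi> ` (W \<inter> V)"
    then obtain q where "q \<in> W \<inter> V" "x = \<phi> q" by blast
    then show "g (inv_into U \<phi> x) = f (inv_into U \<phi> x)"
      using assms(4) inv_chart[OF U(1)] W by auto
  qed auto
  then show ?thesis 
    using W assms(2,3) by (intro smooth_fun_atI[OF U(1), of "W \<inter> V"]) auto
qed

lemma smooth_fun_at_binop:
  assumes "smooth_fun_at A UNIV f p" "smooth_fun_at A UNIV g p"
    and "\<And>S (h :: real^'d \<Rightarrow> real) k. open S \<Longrightarrow> smooth_on S h \<Longrightarrow> smooth_on S k \<Longrightarrow> smooth_on S (\<lambda>x. B (h x) (k x))"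
  shows "smooth_fun_at A UNIV (\<lambda>q. B (f q) (g q)) p"
proof -
  obtain U \<phi> where U: "(U, \<phi>) \<in> A" "p \<in> U" using chart_exists .
  obtain W where W: "open W" "p \<in> W" "W \<subseteq> U" "smooth_on (\<phi> ` W) (\<lambda>x. f (inv_into U \<phi> x))"
    using smooth_fun_atE[OF U assms(1)] .
  obtain W' where W': "open W'" "p \<in> W'" "W' \<subseteq> U" "smooth_on (\<phi> ` W') (\<lambda>x. g (inv_into U \<phi> x))"
    using smooth_fun_atE[OF U assms(2)] .
  have op: "open (\<phi> ` (W \<inter> W'))" using W U W' assms by (intro open_chart_image_subset[OF U(1)]) auto
  have "smooth_on (\<phi> ` (W \<inter> W')) (\<lambda>x. B (f (inv_into U \<phi> x)) (g (inv_into U \<phi> x)))"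
    by (intro assms(3) op smooth_on_subset[OF W(4)] smooth_on_subset[OF W'(4)]) auto
  then show ?thesis 
    using W W' by (intro smooth_fun_atI[OF U(1), of "W \<inter> W'"]) auto
qed

lemma smooth_fun_at_add:
  "smooth_fun_at A UNIV f p \<Longrightarrow> smooth_fun_at A UNIV g p \<Longrightarrow> smooth_fun_at A UNIV (\<lambda>q. f q + g q) p"
  by (rule smooth_fun_at_binop) (auto intro: smooth_on_add)

lemma smooth_fun_at_mult:
  "smooth_fun_at A UNIV f p \<Longrightarrow> smooth_fun_at A UNIV g p \<Longrightarrow> smooth_fun_at A UNIV (\<lambda>q. f q * g q) p"
  by (rule smooth_fun_at_binop) (auto intro: smooth_on_mult)

lemma smooth_fun_at_const: "smooth_fun_at A UNIV (\<lambda>q. c) p"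
  unfolding smooth_fun_at_def by (auto intro: exI[of _ UNIV] exI[of _ "\<lambda>x. c"] smooth_on_const)

lemma smooth_fun_at_sum:
  "(\<And>i. i \<in> I \<Longrightarrow> smooth_fun_at A UNIV (f i) p) \<Longrightarrow> smooth_fun_at A UNIV (\<lambda>q. \<Sum>i\<in>I. f i q) p"
  by (induction I rule: infinite_finite_induct) (auto intro: smooth_fun_at_const smooth_fun_at_add)

lemma C_inf_on_coord:
  assumes "(U, \<phi>) \<in> A"
  shows "C_inf_on A U (\<lambda>q. \<phi> q $ i)"
proof -
  have "smooth_on (\<phi> ` U) (\<lambda>x. x $ i)"
    using open_chart_image[OF assms] 
    by (intro smooth_on_bounded_linear[OF _ bounded_linear_vec_nth] smooth_on_ident)
  then have "smooth_on (\<phi> ` U) (\<lambda>x. \<phi> (inv_into U \<phi> x) $ i)"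
    by (rule smooth_on_transform) (use open_chart_image assms in auto)
  then show ?thesis using C_inf_on_chart_iff[OF assms open_chart_domain[OF assms]] by auto
qed

lemma smooth_fun_at_coord: "(U, \<phi>) \<in> A \<Longrightarrow> p \<in> U \<Longrightarrow> smooth_fun_at A UNIV (\<lambda>q. \<phi> q $ i) p"
  using C_inf_on_coord unfolding C_inf_on_def by blast


subsection \<open>Tangent vectors in coordinates\<close>

lemma smooth_fun_at_has_derivative:
  assumes "(U, \<phi>) \<in> A" "p \<in> U" "smooth_fun_at A UNIV f p"
  shows "((\<lambda>x. f (inv_into U \<phi> x)) has_derivative
      frechet_derivative (\<lambda>x. f (inv_into U \<phi> x)) (at (\<phi> p))) (at (\<phi> p))"
proof -
  obtain W where W: "p \<in> W" "smooth_on (\<phi> ` W) (\<lambda>x. f (inv_into U \<phi> x))"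
    using smooth_fun_atE[OF assms] by metis
  then show ?thesis by (intro smooth_on_has_derivative) auto
qed

text \<open>Chain rule through the chart: a velocity is a directional derivative of the coordinate
  expression of \<open>f\<close>, so the curve matters only through its point and its coordinate
  velocity \<open>v\<close>.\<close>

lemma velocity_apply:
  assumes "(U, \<phi>) \<in> A" "open J" "t \<in> J" "c ` J \<subseteq> U" "((\<lambda>s. \<phi> (c s)) has_vector_derivative v) (at t)"
    and "smooth_fun_at A UNIV f (c t)"
  shows "((\<lambda>s. f (c s)) has_real_derivative velocity A UNIV c t f) (at t)"
    and "velocity A UNIV c t f = frechet_derivative (\<lambda>x. f (inv_into U \<phi> x)) (at (\<phi> (c t))) v"
proof -
  let ?D = "frechet_derivative (\<lambda>x. f (inv_into U \<phi> x)) (at (\<phi> (c t)))"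
  have D: "((\<lambda>x. f (inv_into U \<phi> x)) has_derivative ?D) (at (\<phi> (c t)))"
    using assms by (intro smooth_fun_at_has_derivative) auto
  have "((\<lambda>s. f (inv_into U \<phi> (\<phi> (c s)))) has_vector_derivative ?D v) (at t)"
    using vector_derivative_diff_chain_within[OF assms(5) has_derivative_at_withinI[OF D]]
    by (simp add: o_def)
  then have "((\<lambda>s. f (c s)) has_vector_derivative ?D v) (at t)"
    by (rule has_vector_derivative_transform_within_open[OF _ assms(2,3)]) (use assms in auto)
  then have *: "((\<lambda>s. f (c s)) has_real_derivative ?D v) (at t)"
    by (simp add: has_real_derivative_iff_has_vector_derivative)
  then show "velocity A UNIV c t f = ?D v"
    using assms(6) by (simp add: velocity_def DERIV_imp_deriv)
  with * show "((\<lambda>s. f (c s)) has_real_derivative velocity A UNIV c t f) (at t)" by simp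
qed

lemma coord_line:
  assumes "(U, \<phi>) \<in> A" "p \<in> U"
  obtains \<epsilon> where "\<epsilon> > 0" "\<And>s. s \<in> {-\<epsilon><..<\<epsilon>} \<Longrightarrow> \<phi> p + s *\<^sub>R v \<in> \<phi> ` U"
proof -
  have "open ((\<lambda>s. \<phi> p + s *\<^sub>R v) -` (\<phi> ` U))"
    using open_chart_image[OF assms(1)] by (intro open_vimage continuous_intros)
  moreover have "0 \<in> (\<lambda>s. \<phi> p + s *\<^sub>R v) -` (\<phi> ` U)" using assms by simp
  ultimately obtain \<epsilon> where "\<epsilon> > 0" "ball 0 \<epsilon> \<subseteq> (\<lambda>s. \<phi> p + s *\<^sub>R v) -` (\<phi> ` U)"
    using open_contains_ball by blast
  then show ?thesis by (intro that[of \<epsilon>]) (auto simp: subset_iff ball_def dist_real_def)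
qed

lemma coord_field_apply:
  assumes "(U, \<phi>) \<in> A" "p \<in> U"
  shows "smooth_fun_at A UNIV f p \<Longrightarrow> 
      coord_field A (U, \<phi>) v p f = frechet_derivative (\<lambda>x. f (inv_into U \<phi> x)) (at (\<phi> p)) v"
    and "\<not> smooth_fun_at A UNIV f p \<Longrightarrow> coord_field A (U, \<phi>) v p f = 0"
proof -
  let ?c = "\<lambda>s. inv_into U \<phi> (\<phi> p + s *\<^sub>R v)"
  have c0: "?c 0 = p" using assms by simp
  obtain \<epsilon> where e: "\<epsilon> > 0" "\<And>s. s \<in> {-\<epsilon><..<\<epsilon>} \<Longrightarrow> \<phi> p + s *\<^sub>R v \<in> \<phi> ` U"
    using coord_line[OF assms, where v = v] by blast
  have "((\<lambda>s. \<phi> p + s *\<^sub>R v) has_vector_derivative v) (at 0)"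
    using has_vector_derivative_line[of "\<phi> p" 0 v 0] by simp
  then have "((\<lambda>s. \<phi> (?c s)) has_vector_derivative v) (at 0)"
    by (rule has_vector_derivative_transform_within_open[of _ _ _ "{-\<epsilon><..<\<epsilon>}"]) (use e assms in auto)
  then show "smooth_fun_at A UNIV f p \<Longrightarrow> 
      coord_field A (U, \<phi>) v p f = frechet_derivative (\<lambda>x. f (inv_into U \<phi> x)) (at (\<phi> p)) v"
    using velocity_apply(2)[OF assms(1), of "{-\<epsilon><..<\<epsilon>}" 0 ?c v f] e assms c0
    by (simp add: coord_field_def image_subset_iff)
  show "\<not> smooth_fun_at A UNIV f p \<Longrightarrow> coord_field A (U, \<phi>) v p f = 0"
    using c0 by (simp add: coord_field_def velocity_def)
qed

lemma coord_field_eqI: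
  assumes "(U, \<phi>) \<in> A" "p \<in> U" "smooth_fun_at A UNIV f p"
    and "((\<lambda>x. f (inv_into U \<phi> x)) has_derivative D) (at (\<phi> p))"
  shows "coord_field A (U, \<phi>) v p f = D v"
  using coord_field_apply(1)[OF assms(1-3)] frechet_derivative_at[OF assms(4)] by simp

text \<open>The equality is one of functionals on all functions: on those smooth near the point both
  sides are the derivative in direction \<open>v\<close>, on the others both are 0.\<close>

lemma velocity_eq_coord_field:
  assumes "(U, \<phi>) \<in> A" "open J" "t \<in> J" "c ` J \<subseteq> U" "((\<lambda>s. \<phi> (c s)) has_vector_derivative v) (at t)"
  shows "velocity A UNIV c t = coord_field A (U, \<phi>) v (c t)"
proof
  fix f
  have "c t \<in> U" using assms by blast
  then show "velocity A UNIV c t f = coord_field A (U, \<phi>) v (c t) f"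
    using velocity_apply(2)[OF assms, of f] coord_field_apply[OF assms(1), of "c t" f v]
    by (cases "smooth_fun_at A UNIV f (c t)") (auto simp: velocity_def)
qed

text \<open>A smooth curve comes with some chart at each time; a transition map carries its
  smoothness to any other chart around the point.\<close>

lemma smooth_curve_chart:
  assumes "smooth_curve A UNIV I c" "t \<in> I" "(U, \<phi>) \<in> A" "c t \<in> U"
  obtains J where "open J" "t \<in> J" "J \<subseteq> I" "c ` J \<subseteq> U" "smooth_on J (\<lambda>s. \<phi> (c s))"
proof -
  obtain V \<psi> J where V: "(V, \<psi>) \<in> A" "open J" "t \<in> J" "J \<subseteq> I" "c ` J \<subseteq> V" "smooth_on J (\<lambda>s. \<psi> (c s))"
    using assms(1,2) unfolding smooth_curve_def o_def by fast
  have oUV: "open (V \<inter> U)" using V(1) assms(3) open_chart_domain by blast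
  then have op: "open (\<psi> ` (V \<inter> U))" by (intro open_chart_image_subset[OF V(1)]) auto
  let ?J = "{s \<in> J. \<psi> (c s) \<in> \<psi> ` (V \<inter> U)}"
  have oJ: "open ?J" by (rule open_preimage_smooth_on[OF V(2,6) op])
  have cJ: "c s \<in> U" if "s \<in> ?J" for s
  proof -
    have "c s \<in> V" using V(5) that by blast
    then show ?thesis using chart_mem_image[OF V(1), of "V \<inter> U" "c s"] that by blast
  qed
  have inv: "inv_into V \<psi> (\<psi> (c s)) = c s" if "s \<in> J" for s
    using V that by (intro inv_chart) auto
  have "smooth_on ?J (\<lambda>s. \<phi> (inv_into V \<psi> (\<psi> (c s))))"
    by (rule smooth_on_compose[OF oJ smooth_on_transition[OF V(1) assms(3)] smooth_on_subset[OF V(6)]]) auto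
  then have "smooth_on ?J (\<lambda>s. \<phi> (c s))"
    by (rule smooth_on_transform) (use oJ inv in auto)
  moreover have "t \<in> ?J" using V(3,5) assms(4) by blast
  moreover have "?J \<subseteq> I" "c ` ?J \<subseteq> U" using V(4) cJ by blast+
  ultimately show ?thesis using oJ by (intro that)
qed

lemma smooth_curve_velocity:
  assumes "smooth_curve A UNIV I c" "t \<in> I" "(U, \<phi>) \<in> A" "c t \<in> U"
  obtains v where "velocity A UNIV c t = coord_field A (U, \<phi>) v (c t)"
    "((\<lambda>s. \<phi> (c s)) has_vector_derivative v) (at t)"
proof -
  obtain J where J: "open J" "t \<in> J" "c ` J \<subseteq> U" "smooth_on J (\<lambda>s. \<phi> (c s))"
    using smooth_curve_chart[OF assms] .
  note D = smooth_on_has_vector_derivative[OF J(4,2)]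
  show ?thesis by (rule that[OF velocity_eq_coord_field[OF assms(3) J(1-3) D] D])
qed

lemma smooth_curve_coord_line:
  assumes "(U, \<phi>) \<in> A" "\<And>s. s \<in> {a<..<b} \<Longrightarrow> x + s *\<^sub>R v \<in> \<phi> ` U"
  shows "smooth_curve A UNIV {a<..<b} (\<lambda>s. inv_into U \<phi> (x + s *\<^sub>R v))"
proof -
  let ?c = "\<lambda>s. inv_into U \<phi> (x + s *\<^sub>R v)" and ?I = "{a<..<b}"
  have "smooth_on ?I (\<lambda>s. x + s *\<^sub>R v)"
    by (intro smooth_on_add smooth_on_const smooth_on_scaleR smooth_on_ident) auto
  then have "smooth_on ?I (\<lambda>s. \<phi> (?c s))"
    by (rule smooth_on_transform) (use assms in auto)
  then show ?thesis
    unfolding smooth_curve_def o_def using assms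
    by (auto intro!: bexI[of _ "(U, \<phi>)"] exI[of _ ?I])
qed

lemma coord_field_in_tangent:
  assumes "(U, \<phi>) \<in> A" "p \<in> U"
  shows "coord_field A (U, \<phi>) v p \<in> tangent A p"
proof -
  obtain \<epsilon> where e: "\<epsilon> > 0" "\<And>s. s \<in> {-\<epsilon><..<\<epsilon>} \<Longrightarrow> \<phi> p + s *\<^sub>R v \<in> \<phi> ` U"
    using coord_line[OF assms, where v = v] by blast
  let ?c = "\<lambda>s. inv_into U \<phi> (\<phi> p + s *\<^sub>R v)" and ?I = "{-\<epsilon><..<\<epsilon>}"
  have "smooth_curve A UNIV ?I ?c" using smooth_curve_coord_line[OF assms(1)] e by blast
  moreover have "0 \<in> ?I" "?c 0 = p" "coord_field A (U, \<phi>) v p = velocity A UNIV ?c 0"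
    using e assms by (simp_all add: coord_field_def)
  ultimately show ?thesis
    unfolding tangent_space_def by blast
qed

text \<open>Coordinate lines realise every velocity. This is what shows that tangent spaces, defined
  through curves, are closed under addition and scaling.\<close>

lemma tangent_eq_range:
  assumes "(U, \<phi>) \<in> A" "p \<in> U"
  shows "tangent A p = range (\<lambda>v. coord_field A (U, \<phi>) v p)"
proof (intro equalityI subsetI)
  fix X assume "X \<in> tangent A p"
  then obtain c I t where "smooth_curve A UNIV I c" "t \<in> I" "c t = p" "X = velocity A UNIV c t"
    unfolding tangent_space_def by blast
  then show "X \<in> range (\<lambda>v. coord_field A (U, \<phi>) v p)"
    using smooth_curve_velocity[of I c t U \<phi>] assms by blast
qed (use coord_field_in_tangent[OF assms] in auto)

lemma linear_coord_field_apply: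
  assumes "(U, \<phi>) \<in> A" "p \<in> U"
  shows "linear (\<lambda>v. coord_field A (U, \<phi>) v p f)"
proof (cases "smooth_fun_at A UNIV f p")
  case True
  then show ?thesis
    using has_derivative_linear[OF smooth_fun_at_has_derivative[OF assms True]]
    by (simp add: coord_field_apply(1)[OF assms True])
qed (simp add: coord_field_apply[OF assms] linear_zero)

lemma components_coord_field:
  assumes "(U, \<phi>) \<in> A" "p \<in> U"
  shows "components (U, \<phi>) (coord_field A (U, \<phi>) v p) = v"
proof -
  have "coord_field A (U, \<phi>) v p (\<lambda>q. \<phi> q $ i) = v $ i" for i
  proof -
    have "((\<lambda>x. x $ i) has_derivative (\<lambda>x. x $ i)) (at (\<phi> p))"
      by (intro bounded_linear_imp_has_derivative bounded_linear_vec_nth)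
    then have "((\<lambda>x. \<phi> (inv_into U \<phi> x) $ i) has_derivative (\<lambda>x. x $ i)) (at (\<phi> p))"
      by (rule has_derivative_transform_within_open[OF _ open_chart_image[OF assms(1)]]) 
        (use assms in auto)
    then show ?thesis
      by (rule coord_field_eqI[OF assms smooth_fun_at_coord[OF assms]])
  qed
  then show ?thesis by (simp add: components_def vec_eq_iff)
qed

lemma coord_field_components:
  assumes "(U, \<phi>) \<in> A" "p \<in> U" "X \<in> tangent A p"
  shows "coord_field A (U, \<phi>) (components (U, \<phi>) X) p = X"
  using assms tangent_eq_range[OF assms(1,2)] components_coord_field[OF assms(1,2)] by auto

lemma coord_field_expand:
  assumes "(U, \<phi>) \<in> A" "p \<in> U"
  shows "coord_field A (U, \<phi>) v p f = (\<Sum>i\<in>UNIV. v $ i * coord_field A (U, \<phi>) (axis i 1) p f)"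
proof -
  have "coord_field A (U, \<phi>) v p f = coord_field A (U, \<phi>) (\<Sum>i\<in>UNIV. v $ i *\<^sub>R axis i 1) p f"
    by (simp add: basis_expansion[of v, unfolded scalar_mult_eq_scaleR])
  also have "\<dots> = (\<Sum>i\<in>UNIV. v $ i * coord_field A (U, \<phi>) (axis i 1) p f)"
    by (simp add: linear_sum[OF linear_coord_field_apply[OF assms]] 
        linear_cmul[OF linear_coord_field_apply[OF assms]])
  finally show ?thesis .
qed

lemma coord_field_add:
  assumes "(U, \<phi>) \<in> A" "p \<in> U"
  shows "coord_field A (U, \<phi>) (v + w) p = (\<lambda>f. coord_field A (U, \<phi>) v p f + coord_field A (U, \<phi>) w p f)"
  using linear_add[OF linear_coord_field_apply[OF assms]] by auto

lemma coord_field_scaleR: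
  assumes "(U, \<phi>) \<in> A" "p \<in> U"
  shows "coord_field A (U, \<phi>) (a *\<^sub>R v) p = (\<lambda>f. a * coord_field A (U, \<phi>) v p f)"
  using linear_cmul[OF linear_coord_field_apply[OF assms]] by auto

lemma
  assumes "X \<in> tangent A p"
  shows tangent_add: "Y \<in> tangent A p \<Longrightarrow> (\<lambda>f. X f + Y f) \<in> tangent A p"
    and tangent_scale: "(\<lambda>f. a * X f) \<in> tangent A p"
proof -
  obtain U \<phi> where U: "(U, \<phi>) \<in> A" "p \<in> U" using chart_exists .
  show "Y \<in> tangent A p \<Longrightarrow> (\<lambda>f. X f + Y f) \<in> tangent A p" "(\<lambda>f. a * X f) \<in> tangent A p"
    using assms coord_field_add[OF U, symmetric] coord_field_scaleR[OF U, symmetric]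
    by (auto simp: tangent_eq_range[OF U])
qed

lemma tangent_zero: "(\<lambda>f. 0) \<in> tangent A p"
proof -
  obtain U \<phi> where U: "(U, \<phi>) \<in> A" "p \<in> U" using chart_exists .
  have "coord_field A (U, \<phi>) 0 p = (\<lambda>f. 0)" using coord_field_expand[OF U, of 0] by auto
  then show ?thesis using coord_field_in_tangent[OF U] by metis
qed

lemma tangent_sum:
  "(\<And>i. i \<in> I \<Longrightarrow> X i \<in> tangent A p) \<Longrightarrow> (\<lambda>f. \<Sum>i\<in>I. X i f) \<in> tangent A p"
  by (induction I rule: infinite_finite_induct) (auto intro: tangent_add tangent_zero)

text \<open>Vector fields are total functions with arbitrary values outside their open set, so a
  tangent vector must be known to see only the germ of its argument. Smoothness near
  \<open>p\<close> is a property of the germ as well, hence the default 0 agrees too.\<close>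

lemma tangent_cong:
  assumes "X \<in> tangent A p" "open V" "p \<in> V" "\<And>q. q \<in> V \<Longrightarrow> f q = g q"
  shows "X f = X g"
proof -
  obtain U \<phi> where U: "(U, \<phi>) \<in> A" "p \<in> U" using chart_exists .
  then obtain v where v: "X = coord_field A (U, \<phi>) v p"
    using assms(1) unfolding tangent_eq_range[OF U] by blast
  show ?thesis
  proof (cases "smooth_fun_at A UNIV f p")
    case True
    then have True': "smooth_fun_at A UNIV g p" 
      by (rule smooth_fun_at_transform[OF _ assms(2,3)]) (simp add: assms(4))
    have "open (\<phi> ` (V \<inter> U))" using assms open_chart_domain[OF U(1)] 
      by (intro open_chart_image_subset[OF U(1)]) auto
    then have "frechet_derivative (\<lambda>x. f (inv_into U \<phi> x)) (at (\<phi> p)) =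
        frechet_derivative (\<lambda>x. g (inv_into U \<phi> x)) (at (\<phi> p))"
      using smooth_fun_at_has_derivative[OF U True] assms U
      by (intro frechet_derivative_transform_within_open[of _ _ "\<phi> ` (V \<inter> U)"]) 
        (auto simp: differentiable_def)
    then show ?thesis using coord_field_apply(1)[OF U] True True' v by simp
  next
    case False
    moreover have "\<not> smooth_fun_at A UNIV g p"
      using False smooth_fun_at_transform[OF _ assms(2,3), of g f] assms(4) by auto
    ultimately show ?thesis using coord_field_apply(2)[OF U] v by simp
  qed
qed

subsection \<open>Smooth vector fields\<close>

text \<open>In the chart, \<open>X f\<close> is the derivative of the coordinate expression of
  \<open>f\<close> at a varying point in the varying direction \<open>a\<close>, so it is smooth
  with \<open>a\<close> and \<open>f\<close>.\<close>

lemma smooth_vector_fieldI: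
  assumes "(U, \<phi>) \<in> A" "open V" "V \<subseteq> U" "\<And>i. C_inf_on A V (\<lambda>q. a q $ i)"
    and "\<And>q. q \<in> V \<Longrightarrow> X q = coord_field A (U, \<phi>) (a q) q"
  shows "smooth_vector_field A V X"
  unfolding smooth_vector_field_def
proof (intro conjI ballI allI impI)
  show "X p \<in> tangent A p" if "p \<in> V" for p
    using assms that coord_field_in_tangent by auto
  fix W f assume W: "open W" "W \<subseteq> V" "C_inf_on A W f"
  have op: "open (\<phi> ` W)" using W assms by (intro open_chart_image_subset[OF assms(1)]) auto
  have f: "smooth_on (\<phi> ` W) (\<lambda>x. f (inv_into U \<phi> x))"
    using W assms by (subst C_inf_on_chart_iff[OF assms(1), symmetric]) auto
  have a: "smooth_on (\<phi> ` W) (\<lambda>x. a (inv_into U \<phi> x))"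
  proof (rule smooth_on_componentwise[OF op])
    fix b :: "real ^ 'd" assume "b \<in> Basis"
    then obtain i where "b = axis i 1" by (auto simp: Basis_vec_def)
    moreover have "C_inf_on A W (\<lambda>q. a q $ i)" using assms(4) W(2) C_inf_on_subset by blast
    ultimately show "smooth_on (\<phi> ` W) (\<lambda>x. a (inv_into U \<phi> x) \<bullet> b)"
      using C_inf_on_chart_iff[OF assms(1) W(1), of "\<lambda>q. a q $ i"] W assms by (simp add: inner_axis)
  qed
  have "smooth_on (\<phi> ` W) (\<lambda>x. frechet_derivative (\<lambda>x. f (inv_into U \<phi> x)) (at x) (a (inv_into U \<phi> x)))"
    by (intro smooth_on_frechet_derivative_pair[OF op op f] smooth_on_ident op a) auto
  then have "smooth_on (\<phi> ` W) (\<lambda>x. X (inv_into U \<phi> x) f)"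
  proof (rule smooth_on_transform[OF _ op])
    fix x assume "x \<in> \<phi> ` W"
    then obtain q where q: "q \<in> W" "x = \<phi> q" by blast
    then have "q \<in> V" "q \<in> U" "smooth_fun_at A UNIV f q" using W assms by (auto simp: C_inf_on_def)
    then show "X (inv_into U \<phi> x) f = 
        frechet_derivative (\<lambda>x. f (inv_into U \<phi> x)) (at x) (a (inv_into U \<phi> x))"
      using assms q by (simp add: coord_field_apply)
  qed
  then show "C_inf_on A W (\<lambda>p. X p f)"
    using W assms by (subst C_inf_on_chart_iff[OF assms(1)]) auto
qed

lemma smooth_vector_field_subset:
  "smooth_vector_field A U X \<Longrightarrow> V \<subseteq> U \<Longrightarrow> smooth_vector_field A V X"
  unfolding smooth_vector_field_def by (meson in_mono subset_trans)

lemma smooth_vector_field_tangent: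
  "smooth_vector_field A U X \<Longrightarrow> p \<in> U \<Longrightarrow> X p \<in> tangent A p"
  unfolding smooth_vector_field_def by blast

lemma smooth_vector_field_apply:
  assumes "smooth_vector_field A U X" "open U" "p \<in> U" "smooth_fun_at A UNIV f p"
  shows "smooth_fun_at A UNIV (\<lambda>q. X q f) p"
proof -
  obtain W where "open W" "p \<in> W" "C_inf_on A W f" 
    using assms(4) unfolding smooth_fun_at_iff_C_inf_on by blast
  then have "open (W \<inter> U)" "W \<inter> U \<subseteq> U" "C_inf_on A (W \<inter> U) f"
    using assms(2) C_inf_on_subset[of W f "W \<inter> U"] by auto
  then have "C_inf_on A (W \<inter> U) (\<lambda>q. X q f)"
    using assms(1) unfolding smooth_vector_field_def by blast
  then show ?thesis using \<open>p \<in> W\<close> assms(3) unfolding C_inf_on_def by blast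
qed

lemma smooth_vector_field_components:
  assumes "(U, \<phi>) \<in> A" "open V" "V \<subseteq> U" "smooth_vector_field A V X"
  shows "C_inf_on A V (\<lambda>q. components (U, \<phi>) (X q) $ i)"
  using assms smooth_vector_field_apply[OF assms(4,2)] smooth_fun_at_coord[OF assms(1)]
  by (auto simp: C_inf_on_def components_def)

lemma smooth_vector_field_coord_field:
  assumes "(U, \<phi>) \<in> A"
  shows "smooth_vector_field A U (coord_field A (U, \<phi>) v)"
  using smooth_vector_fieldI[OF assms open_chart_domain[OF assms] order_refl, of "\<lambda>q. v"]
  by (simp add: C_inf_on_def smooth_fun_at_const)

lemma smooth_vector_field_add:
  assumes "smooth_vector_field A U X" "smooth_vector_field A U Y"
  shows "smooth_vector_field A U (\<lambda>q \<psi>. X q \<psi> + Y q \<psi>)"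
  using assms tangent_add smooth_fun_at_add unfolding smooth_vector_field_def C_inf_on_def by simp

lemma smooth_vector_field_scale:
  assumes "C_inf_on A U f" "smooth_vector_field A U X"
  shows "smooth_vector_field A U (\<lambda>q \<psi>. f q * X q \<psi>)"
  using assms tangent_scale smooth_fun_at_mult unfolding smooth_vector_field_def C_inf_on_def
  by (simp add: subset_iff)

lemma smooth_vector_field_zero: "smooth_vector_field A U (\<lambda>q \<psi>. 0)"
  using tangent_zero smooth_fun_at_const unfolding smooth_vector_field_def C_inf_on_def by simp

lemma smooth_vector_field_sum:
  assumes "\<And>i. i \<in> I \<Longrightarrow> C_inf_on A U (f i)" "\<And>i. i \<in> I \<Longrightarrow> smooth_vector_field A U (X i)"
  shows "smooth_vector_field A U (\<lambda>q \<psi>. \<Sum>i\<in>I. f i q * X i q \<psi>)"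
  using assms
proof (induction I rule: infinite_finite_induct)
  case (insert i I)
  have "smooth_vector_field A U (\<lambda>q \<psi>. f i q * X i q \<psi> + (\<Sum>i\<in>I. f i q * X i q \<psi>))"
    using insert by (intro smooth_vector_field_add[OF smooth_vector_field_scale]) auto
  then show ?case using insert by simp
qed (simp_all add: smooth_vector_field_zero)

lemma tangent_expand:
  assumes "(U, \<phi>) \<in> A" "p \<in> U" "X \<in> tangent A p"
  shows "X = (\<lambda>\<psi>. \<Sum>i\<in>UNIV. components (U, \<phi>) X $ i * coord_field A (U, \<phi>) (axis i 1) p \<psi>)"
proof
  fix \<psi>
  show "X \<psi> = (\<Sum>i\<in>UNIV. components (U, \<phi>) X $ i * coord_field A (U, \<phi>) (axis i 1) p \<psi>)"
    using coord_field_components[OF assms] coord_field_expand[OF assms(1,2), of "components (U, \<phi>) X" \<psi>]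
    by simp
qed

section \<open>Linear frames of a tangent space\<close>

lemma linear_frame_inverse:
  assumes "linear_frame A p b"
  shows "X \<in> tangent A p \<Longrightarrow> b (inv_into UNIV b X) = X" "inv_into UNIV b (b x) = x"
    "b x \<in> tangent A p"
  using assms unfolding linear_frame_def bij_betw_def
  by (auto simp: f_inv_into_f)

text \<open>Two frames turn \<open>L\<close> into a map of the coordinate space. The trace
  computation uses this for the endomorphism itself and, with \<open>L\<close> the identity, for
  changes of basis.\<close>

lemma linear_between_frames:
  assumes "linear_frame A p b" "linear_frame A p c"
    and "\<And>X. X \<in> tangent A p \<Longrightarrow> L X \<in> tangent A p"
    and "\<And>X Y a b. X \<in> tangent A p \<Longrightarrow> Y \<in> tangent A p \<Longrightarrow> 
      L (\<lambda>f. a * X f + b * Y f) = (\<lambda>f. a * L X f + b * L Y f)"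
  shows "linear (\<lambda>x. inv_into UNIV c (L (b x)))"
proof -
  note b = linear_frame_inverse[OF assms(1)] and c = linear_frame_inverse[OF assms(2)]
  have "inv_into UNIV c (L (b (r *\<^sub>R x + s *\<^sub>R y))) = 
      r *\<^sub>R inv_into UNIV c (L (b x)) + s *\<^sub>R inv_into UNIV c (L (b y))" for r s x y
  proof -
    have "c (r *\<^sub>R inv_into UNIV c (L (b x)) + s *\<^sub>R inv_into UNIV c (L (b y))) = 
        (\<lambda>f. r * L (b x) f + s * L (b y) f)"
      using assms(2) b(3) c(1) assms(3) unfolding linear_frame_def by simp
    also have "\<dots> = L (b (r *\<^sub>R x + s *\<^sub>R y))"
      using assms(1,4) b(3) unfolding linear_frame_def by simp
    finally show ?thesis using c(2) by metis
  qed
  note * = this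
  show ?thesis
    by (rule linearI) (use *[of 1 _ 1] *[of _ _ 0] in auto)
qed


subsection \<open>The frame bundle\<close>

lemma frame_components_matrix:
  assumes "linear_frame A p u"
  shows "matrix (\<lambda>x. components \<kappa> (u x)) *v e = components \<kappa> (u e)"
proof -
  have "linear (\<lambda>x. components \<kappa> (u x))"
    using assms unfolding linear_frame_def
    by (intro linearI) (auto simp: components_def vec_eq_iff split: prod.splits)
  then show ?thesis by (intro matrix_works) (simp add: linear_matrix_vector_mul_eq)
qed

lemma frame_atlasI:
  assumes "(U, \<phi>) \<in> A"
  shows "({(p, u). p \<in> U \<and> linear_frame A p u}, 
      \<lambda>(p, u). (\<phi> p, matrix (\<lambda>x. components (U, \<phi>) (u x)))) \<in> frame_atlas A"
  unfolding frame_atlas_def using assms by force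

lemma frame_atlasE:
  assumes "(D, \<Phi>) \<in> frame_atlas A"
  obtains U \<phi> where "(U, \<phi>) \<in> A" "D = {(p, u). p \<in> U \<and> linear_frame A p u}" 
    "\<Phi> = (\<lambda>(p, u). (\<phi> p, matrix (\<lambda>x. components (U, \<phi>) (u x))))"
  using assms unfolding frame_atlas_def by auto

text \<open>In frame coordinates \<open>(x, B)\<close> the function is the derivative of the
  coordinate expression of \<open>\<psi>\<close> at \<open>x\<close> in direction
  \<open>B e\<close>, jointly smooth in \<open>x\<close> near the base point and in all matrices
  \<open>B\<close>. For a coordinate \<open>\<psi>\<close> it yields entries of the frame matrix,
  for \<open>\<psi> = f\<close> the function that \<open>H_i\<close> differentiates the second
  time.\<close>

lemma smooth_fun_at_frame_eval:
  assumes "smooth_fun_at A UNIV \<psi> (fst w)"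
  shows "smooth_fun_at (frame_atlas A) S (\<lambda>w. snd w e \<psi>) w"
  unfolding smooth_fun_at_def
proof (safe)
  fix D \<Phi> assume "w \<in> D" and D0: "(D, \<Phi>) \<in> frame_atlas A"
  obtain U \<phi> where U: "(U, \<phi>) \<in> A" and D: "D = {(p, u). p \<in> U \<and> linear_frame A p u}" 
    and \<Phi>: "\<Phi> = (\<lambda>(p, u). (\<phi> p, matrix (\<lambda>x. components (U, \<phi>) (u x))))"
    by (rule frame_atlasE[OF D0])
  have w: "fst w \<in> U" using \<open>w \<in> D\<close> D by auto
  obtain W0 where W0: "open W0" "fst w \<in> W0" "W0 \<subseteq> U" "smooth_on (\<phi> ` W0) (\<lambda>x. \<psi> (inv_into U \<phi> x))"
    by (rule smooth_fun_atE[OF U w assms])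
  let ?W = "\<phi> ` W0 \<times> (UNIV :: (real ^ 'd ^ 'd) set)"
  let ?h = "\<lambda>z. frechet_derivative (\<lambda>x. \<psi> (inv_into U \<phi> x)) (at (fst z)) (snd z *v e)"
  have o: "open (\<phi> ` W0)" by (rule open_chart_image_subset[OF U W0(1,3)])
  have oW: "open ?W" by (intro open_Times o open_UNIV)
  have fst: "smooth_on ?W fst"
    by (rule smooth_on_bounded_linear[OF oW bounded_linear_fst smooth_on_ident[OF oW]])
  have "bounded_linear (\<lambda>z. snd z *v e)"
    by (rule bounded_linear_compose[OF bounded_linear_matrix_vector_left bounded_linear_snd])
  then have snd: "smooth_on ?W (\<lambda>z. snd z *v e)"
    by (rule smooth_on_bounded_linear[OF oW _ smooth_on_ident[OF oW]])
  have h: "smooth_on ?W ?h"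
    by (rule smooth_on_frechet_derivative_pair[OF o oW W0(4) fst snd]) auto
  have eq: "snd q e \<psi> = ?h (\<Phi> q)" if "q \<in> D" "\<Phi> q \<in> ?W" for q
  proof -
    obtain p u where q: "q = (p, u)" "p \<in> U" "linear_frame A p u" using \<open>q \<in> D\<close> D by auto
    then have p: "p \<in> W0" using that(2) chart_mem_image[OF U W0(3)] by (auto simp: \<Phi>)
    have "u e = coord_field A (U, \<phi>) (components (U, \<phi>) (u e)) p"
      using coord_field_components[OF U q(2) linear_frame_inverse(3)[OF q(3)]] by simp
    then have "u e \<psi> = coord_field A (U, \<phi>) (components (U, \<phi>) (u e)) p \<psi>" by (rule fun_cong)
    also have "\<dots> = ?h (\<Phi> q)"
      using coord_field_apply(1)[OF U q(2) smooth_fun_atI[OF U W0(1) p W0(3,4)]]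
      by (simp add: \<Phi> q(1) frame_components_matrix[OF q(3)])
    finally show ?thesis by (simp add: q(1))
  qed
  have w_in: "\<Phi> w \<in> ?W" using W0(2) by (auto simp: \<Phi> split: prod.split)
  show "\<exists>W h. open W \<and> \<Phi> w \<in> W \<and> smooth_on W h \<and> (\<forall>q\<in>D \<inter> S. \<Phi> q \<in> W \<longrightarrow> snd q e \<psi> = h (\<Phi> q))"
    by (intro exI[of _ ?W] exI[of _ ?h] conjI ballI impI oW h w_in) (rule eq; blast)
qed

lemma smooth_fun_at_frame_proj:
  assumes "smooth_fun_at A UNIV \<psi> (fst w)"
  shows "smooth_fun_at (frame_atlas A) S (\<psi> \<circ> frame_proj) w"
  unfolding smooth_fun_at_def
proof (safe)
  fix D \<Phi> assume "w \<in> D" and D0: "(D, \<Phi>) \<in> frame_atlas A"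
  obtain U \<phi> where U: "(U, \<phi>) \<in> A" and D: "D = {(p, u). p \<in> U \<and> linear_frame A p u}" 
    and \<Phi>: "\<Phi> = (\<lambda>(p, u). (\<phi> p, matrix (\<lambda>x. components (U, \<phi>) (u x))))"
    by (rule frame_atlasE[OF D0])
  have w: "fst w \<in> U" using \<open>w \<in> D\<close> D by auto
  obtain W0 where W0: "open W0" "fst w \<in> W0" "W0 \<subseteq> U" "smooth_on (\<phi> ` W0) (\<lambda>x. \<psi> (inv_into U \<phi> x))"
    by (rule smooth_fun_atE[OF U w assms])
  let ?W = "\<phi> ` W0 \<times> (UNIV :: (real ^ 'd ^ 'd) set)"
  let ?h = "\<lambda>z. \<psi> (inv_into U \<phi> (fst z))"
  have o: "open (\<phi> ` W0)" by (rule open_chart_image_subset[OF U W0(1,3)])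
  have oW: "open ?W" by (intro open_Times o open_UNIV)
  have h: "smooth_on ?W ?h"
    by (rule smooth_on_compose[OF oW W0(4) smooth_on_bounded_linear[OF oW bounded_linear_fst smooth_on_ident[OF oW]]]) auto
  have eq: "(\<psi> \<circ> frame_proj) q = ?h (\<Phi> q)" if "q \<in> D" for q
    using that D U by (auto simp: \<Phi> frame_proj_def)
  have w_in: "\<Phi> w \<in> ?W" using W0(2) by (auto simp: \<Phi> split: prod.split)
  show "\<exists>W h. open W \<and> \<Phi> w \<in> W \<and> smooth_on W h \<and> 
      (\<forall>q\<in>D \<inter> S. \<Phi> q \<in> W \<longrightarrow> (\<psi> \<circ> frame_proj) q = h (\<Phi> q))"
    by (intro exI[of _ ?W] exI[of _ ?h] conjI ballI impI oW h w_in) (rule eq; blast)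
qed

lemma smooth_curve_frame_proj:
  assumes "smooth_curve (frame_atlas A) S I c"
  shows "smooth_curve A UNIV I (\<lambda>s. fst (c s))"
proof (rule smooth_curveI)
  fix t assume "t \<in> I"
  then obtain D \<Phi> J where D0: "(D, \<Phi>) \<in> frame_atlas A" "open J" "t \<in> J" "J \<subseteq> I" "c ` J \<subseteq> D" "smooth_on J (\<lambda>s. \<Phi> (c s))"
    by (rule smooth_curveE[OF assms])
  obtain U \<phi> where U: "(U, \<phi>) \<in> A" and D: "D = {(p, u). p \<in> U \<and> linear_frame A p u}" 
    and \<Phi>: "\<Phi> = (\<lambda>(p, u). (\<phi> p, matrix (\<lambda>x. components (U, \<phi>) (u x))))"
    by (rule frame_atlasE[OF D0(1)])
  have "smooth_on J (\<lambda>s. fst (\<Phi> (c s)))"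
    by (rule smooth_on_bounded_linear[OF D0(2) bounded_linear_fst D0(6)])
  then have "smooth_on J (\<lambda>s. \<phi> (fst (c s)))"
    by (rule smooth_on_transform[OF _ D0(2)]) (simp add: \<Phi> split: prod.split)
  moreover have "(\<lambda>s. fst (c s)) ` J \<subseteq> U" using D0(5) unfolding D by auto
  ultimately show "\<exists>U \<phi> J. (U, \<phi>) \<in> A \<and> open J \<and> t \<in> J \<and> J \<subseteq> I \<and> (\<lambda>s. fst (c s)) ` J \<subseteq> U \<and> 
      smooth_on J (\<lambda>s. \<phi> (fst (c s)))"
    using D0(2,3,4) U by blast
qed (use assms in \<open>auto simp: smooth_curve_def\<close>)

text \<open>The entries of the frame matrix in the given chart arise by applying
  \<open>u e_i\<close> to the coordinate functions. These are smooth functions of the frame, so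
  their smoothness along the curve follows without computing transition maps of the frame
  bundle.\<close>

lemma frame_curve_chart:
  assumes "smooth_curve (frame_atlas A) S I c" "t \<in> I" "(U, \<phi>) \<in> A" "fst (c t) \<in> U"
  obtains J where "open J" "t \<in> J" "J \<subseteq> I" "(\<lambda>s. fst (c s)) ` J \<subseteq> U" "smooth_on J (\<lambda>s. \<phi> (fst (c s)))"
    "smooth_on J (\<lambda>s. matrix (\<lambda>x. components (U, \<phi>) (snd (c s) x)))"
proof -
  obtain J0 where J0: "open J0" "t \<in> J0" "J0 \<subseteq> I" "(\<lambda>s. fst (c s)) ` J0 \<subseteq> U" "smooth_on J0 (\<lambda>s. \<phi> (fst (c s)))"
    by (rule smooth_curve_chart[OF smooth_curve_frame_proj[OF assms(1)] assms(2,3,4)])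
  have "\<exists>J. open J \<and> t \<in> J \<and> smooth_on J (\<lambda>s. snd (c s) (axis i 1) (\<lambda>q. \<phi> q $ k))" for k i
    using smooth_curve_compose[OF assms(1,2) smooth_fun_at_frame_eval[OF smooth_fun_at_coord[OF assms(3,4)]]] by metis
  then have "\<forall>k i. \<exists>J. open J \<and> t \<in> J \<and> smooth_on J (\<lambda>s. snd (c s) (axis i 1) (\<lambda>q. \<phi> q $ k))"
    by blast
  from this[unfolded choice_iff] obtain J1 where
    J: "\<And>k i. open (J1 k i) \<and> t \<in> J1 k i \<and> smooth_on (J1 k i) (\<lambda>s. snd (c s) (axis i 1) (\<lambda>q. \<phi> q $ k))"
    by blast
  have J1: "open (J1 k i)" "t \<in> J1 k i" "smooth_on (J1 k i) (\<lambda>s. snd (c s) (axis i 1) (\<lambda>q. \<phi> q $ k))" for k i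
    using J[of k i] by simp_all
  \<comment> \<open>There are finitely many entries, so the common set of times is still
    open.\<close>
  let ?J = "J0 \<inter> (\<Inter>k. \<Inter>i. J1 k i)"
  have oJ: "open ?J" using J0(1) J1(1) by (intro open_Int open_INT) auto
  have "smooth_on ?J (\<lambda>s. matrix (\<lambda>x. components (U, \<phi>) (snd (c s) x)) $ k $ i)" for k i
    using smooth_on_subset[OF J1(3)[of k i], of ?J] by (auto simp: matrix_def components_def)
  then have "smooth_on ?J (\<lambda>s. matrix (\<lambda>x. components (U, \<phi>) (snd (c s) x)))"
    by (rule smooth_on_matrix_entries[OF oJ])
  moreover have "smooth_on ?J (\<lambda>s. \<phi> (fst (c s)))" by (rule smooth_on_subset[OF J0(5)]) auto
  moreover have "t \<in> ?J" "?J \<subseteq> I" "(\<lambda>s. fst (c s)) ` ?J \<subseteq> U" using J0 J1(2) by auto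
  ultimately show ?thesis using oJ by (intro that)
qed

text \<open>The default values match: if \<open>f\<close> is not smooth near the base point, both
  sides are 0; if it is, then so is \<open>f \<circ> frame_proj\<close>, and both sides
  differentiate \<open>f\<close> along the base curve.\<close>

lemma differential_frame_velocity:
  "differential A frame_proj (c t) (velocity (frame_atlas A) S c t) = velocity A UNIV (\<lambda>s. fst (c s)) t"
proof
  fix f
  show "differential A frame_proj (c t) (velocity (frame_atlas A) S c t) f = velocity A UNIV (\<lambda>s. fst (c s)) t f"
    using smooth_fun_at_frame_proj[of f "c t" S]
    by (simp add: differential_def velocity_def frame_proj_def)
qed

end


section \<open>The Levi-Civita connection\<close>

locale levi_civita = smooth_manifold A for A :: "('m::topological_space, real ^ 'd) chart set" +
  fixes g :: "'m metric" and nabla :: "'m connection"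
  assumes metric: "riemannian_metric A g"
    and levi_civita: "levi_civita_connection A g nabla"
begin

section \<open>Rules of the connection\<close>

lemma affine: "affine_connection A nabla"
  using levi_civita unfolding levi_civita_connection_def by blast

context
  fixes U X Y
  assumes U: "open U" and X: "smooth_vector_field A U X" and Y: "smooth_vector_field A U Y"
begin

lemma
  shows smooth_vector_field_nabla: "smooth_vector_field A U (nabla X Y)"
    and nabla_cong: "p \<in> U \<Longrightarrow> (\<And>q. q \<in> U \<Longrightarrow> X' q = X q) \<Longrightarrow> (\<And>q. q \<in> U \<Longrightarrow> Y' q = Y q) \<Longrightarrow>
      nabla X' Y' p = nabla X Y p"
    and nabla_add: "smooth_vector_field A U Z \<Longrightarrow> p \<in> U \<Longrightarrow> 
      nabla (\<lambda>q \<psi>. X q \<psi> + Z q \<psi>) Y p = (\<lambda>\<psi>. nabla X Y p \<psi> + nabla Z Y p \<psi>)"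
      "smooth_vector_field A U Z \<Longrightarrow> p \<in> U \<Longrightarrow> 
      nabla X (\<lambda>q \<psi>. Y q \<psi> + Z q \<psi>) p = (\<lambda>\<psi>. nabla X Y p \<psi> + nabla X Z p \<psi>)"
    and nabla_scale: "C_inf_on A U f \<Longrightarrow> p \<in> U \<Longrightarrow> 
      nabla (\<lambda>q \<psi>. f q * X q \<psi>) Y p = (\<lambda>\<psi>. f p * nabla X Y p \<psi>)"
      "C_inf_on A U f \<Longrightarrow> p \<in> U \<Longrightarrow> 
      nabla X (\<lambda>q \<psi>. f q * Y q \<psi>) p = (\<lambda>\<psi>. X p f * Y p \<psi> + f p * nabla X Y p \<psi>)"
proof -
  note r = affine[unfolded affine_connection_def, THEN spec[of _ U], THEN spec[of _ X], THEN spec[of _ Y],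
      THEN mp, OF conjI[OF U conjI[OF X Y]]]
  show "smooth_vector_field A U (nabla X Y)" by (rule r[THEN conjunct1])
  show "p \<in> U \<Longrightarrow> (\<And>q. q \<in> U \<Longrightarrow> X' q = X q) \<Longrightarrow> (\<And>q. q \<in> U \<Longrightarrow> Y' q = Y q) \<Longrightarrow>
      nabla X' Y' p = nabla X Y p"
    using r[THEN conjunct2, THEN conjunct1, THEN spec[of _ X'], THEN spec[of _ Y']] by simp
  note add = r[THEN conjunct2, THEN conjunct2, THEN conjunct1, THEN spec[of _ Z], THEN mp, THEN bspec[of _ _ p]]
  show "smooth_vector_field A U Z \<Longrightarrow> p \<in> U \<Longrightarrow> 
      nabla (\<lambda>q \<psi>. X q \<psi> + Z q \<psi>) Y p = (\<lambda>\<psi>. nabla X Y p \<psi> + nabla Z Y p \<psi>)"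
    by (rule add[THEN conjunct1])
  show "smooth_vector_field A U Z \<Longrightarrow> p \<in> U \<Longrightarrow> 
      nabla X (\<lambda>q \<psi>. Y q \<psi> + Z q \<psi>) p = (\<lambda>\<psi>. nabla X Y p \<psi> + nabla X Z p \<psi>)"
    by (rule add[THEN conjunct2])
  note scale = r[THEN conjunct2, THEN conjunct2, THEN conjunct2, THEN spec[of _ f], THEN mp, THEN bspec[of _ _ p]]
  show "C_inf_on A U f \<Longrightarrow> p \<in> U \<Longrightarrow> 
      nabla (\<lambda>q \<psi>. f q * X q \<psi>) Y p = (\<lambda>\<psi>. f p * nabla X Y p \<psi>)"
    by (rule scale[THEN conjunct1])
  show "C_inf_on A U f \<Longrightarrow> p \<in> U \<Longrightarrow> 
      nabla X (\<lambda>q \<psi>. f q * Y q \<psi>) p = (\<lambda>\<psi>. X p f * Y p \<psi> + f p * nabla X Y p \<psi>)"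
    by (rule scale[THEN conjunct2])
qed

lemma metric_compatible:
  assumes "smooth_vector_field A U Z" "p \<in> U"
  shows "X p (\<lambda>q. g q (Y q) (Z q)) = g p (nabla X Y p) (Z p) + g p (Y p) (nabla X Z p)"
  by (rule levi_civita[unfolded levi_civita_connection_def, THEN conjunct2, THEN conjunct2, rule_format, 
      OF conjI[OF U conjI[OF X conjI[OF Y assms(1)]]] assms(2)])

end

lemma nabla_sum_left:
  assumes "open U" "smooth_vector_field A U Y" "p \<in> U"
    and "\<And>i. i \<in> I \<Longrightarrow> C_inf_on A U (f i)" "\<And>i. i \<in> I \<Longrightarrow> smooth_vector_field A U (X i)"
  shows "nabla (\<lambda>q \<psi>. \<Sum>i\<in>I. f i q * X i q \<psi>) Y p = (\<lambda>\<psi>. \<Sum>i\<in>I. f i p * nabla (X i) Y p \<psi>)"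
proof -
  have zero: "nabla (\<lambda>q \<psi>. 0) Y p = (\<lambda>\<psi>. 0)"
    using nabla_scale(1)[OF assms(1) smooth_vector_field_zero assms(2), of "\<lambda>q. 0" p] assms(3)
    by (simp add: C_inf_on_def smooth_fun_at_const)
  show ?thesis
    using assms(4,5)
  proof (induction I rule: infinite_finite_induct)
    case (insert i I)
    have sum: "smooth_vector_field A U (\<lambda>q \<psi>. \<Sum>i\<in>I. f i q * X i q \<psi>)"
      and scale: "smooth_vector_field A U (\<lambda>q \<psi>. f i q * X i q \<psi>)"
      using insert.prems by (auto intro!: smooth_vector_field_sum smooth_vector_field_scale)
    have "nabla (\<lambda>q \<psi>. f i q * X i q \<psi> + (\<Sum>i\<in>I. f i q * X i q \<psi>)) Y p =
        (\<lambda>\<psi>. nabla (\<lambda>q \<psi>. f i q * X i q \<psi>) Y p \<psi> + nabla (\<lambda>q \<psi>. \<Sum>i\<in>I. f i q * X i q \<psi>) Y p \<psi>)"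
      by (rule nabla_add(1)[OF assms(1) scale assms(2) sum assms(3)])
    moreover have "nabla (\<lambda>q \<psi>. f i q * X i q \<psi>) Y p = (\<lambda>\<psi>. f i p * nabla (X i) Y p \<psi>)"
      using insert.prems assms(3) by (intro nabla_scale(1)[OF assms(1) _ assms(2)]) auto
    ultimately show ?case using insert by simp
  qed (simp_all add: zero)
qed

lemma nabla_sum_right:
  assumes "open U" "smooth_vector_field A U X" "p \<in> U"
    and "\<And>i. i \<in> I \<Longrightarrow> C_inf_on A U (f i)" "\<And>i. i \<in> I \<Longrightarrow> smooth_vector_field A U (Y i)"
  shows "nabla X (\<lambda>q \<psi>. \<Sum>i\<in>I. f i q * Y i q \<psi>) p = 
    (\<lambda>\<psi>. \<Sum>i\<in>I. X p (f i) * Y i p \<psi> + f i p * nabla X (Y i) p \<psi>)"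
proof -
  have zero: "nabla X (\<lambda>q \<psi>. 0) p = (\<lambda>\<psi>. 0)"
    using nabla_scale(2)[OF assms(1,2) smooth_vector_field_zero, of "\<lambda>q. 0" p] assms(3)
    by (simp add: C_inf_on_def smooth_fun_at_const)
  show ?thesis
    using assms(4,5)
  proof (induction I rule: infinite_finite_induct)
    case (insert i I)
    have sum: "smooth_vector_field A U (\<lambda>q \<psi>. \<Sum>i\<in>I. f i q * Y i q \<psi>)"
      and scale: "smooth_vector_field A U (\<lambda>q \<psi>. f i q * Y i q \<psi>)"
      using insert.prems by (auto intro!: smooth_vector_field_sum smooth_vector_field_scale)
    have "nabla X (\<lambda>q \<psi>. f i q * Y i q \<psi> + (\<Sum>i\<in>I. f i q * Y i q \<psi>)) p =
        (\<lambda>\<psi>. nabla X (\<lambda>q \<psi>. f i q * Y i q \<psi>) p \<psi> + nabla X (\<lambda>q \<psi>. \<Sum>i\<in>I. f i q * Y i q \<psi>) p \<psi>)"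
      by (rule nabla_add(2)[OF assms(1,2) scale sum assms(3)])
    moreover have "nabla X (\<lambda>q \<psi>. f i q * Y i q \<psi>) p = (\<lambda>\<psi>. X p (f i) * Y i p \<psi> + f i p * nabla X (Y i) p \<psi>)"
      using insert.prems assms(3) by (intro nabla_scale(2)[OF assms(1,2)]) auto
    ultimately show ?case using insert by simp
  qed (simp_all add: zero)
qed

section \<open>Tensoriality in the differentiating field\<close>

lemma nabla_expand_left:
  assumes "(U, \<phi>) \<in> A" "open V" "V \<subseteq> U" "p \<in> V" "smooth_vector_field A V X" "smooth_vector_field A V Y"
  shows "nabla X Y p = (\<lambda>\<psi>. \<Sum>i\<in>UNIV. components (U, \<phi>) (X p) $ i * 
    nabla (coord_field A (U, \<phi>) (axis i 1)) Y p \<psi>)"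
proof -
  have "smooth_vector_field A V (coord_field A (U, \<phi>) v)" for v
    using smooth_vector_field_subset[OF smooth_vector_field_coord_field] assms by blast
  note * = smooth_vector_field_components[OF assms(1,2,3,5)] this
  have "nabla X Y p = nabla (\<lambda>q \<psi>. \<Sum>i\<in>UNIV. components (U, \<phi>) (X q) $ i * 
      coord_field A (U, \<phi>) (axis i 1) q \<psi>) Y p"
  proof (rule nabla_cong[OF assms(2)])
    fix q assume "q \<in> V"
    then show "X q = (\<lambda>\<psi>. \<Sum>i\<in>UNIV. components (U, \<phi>) (X q) $ i * coord_field A (U, \<phi>) (axis i 1) q \<psi>)"
      using assms smooth_vector_field_tangent by (intro tangent_expand) auto
  next
    show "smooth_vector_field A V (\<lambda>q \<psi>. \<Sum>i\<in>UNIV. components (U, \<phi>) (X q) $ i * 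
        coord_field A (U, \<phi>) (axis i 1) q \<psi>)"
      by (intro smooth_vector_field_sum *)
  qed (use assms in auto)
  also have "\<dots> = (\<lambda>\<psi>. \<Sum>i\<in>UNIV. components (U, \<phi>) (X p) $ i * 
      nabla (coord_field A (U, \<phi>) (axis i 1)) Y p \<psi>)"
    by (rule nabla_sum_left[OF assms(2,6,4) *])
  finally show ?thesis .
qed

text \<open>In a chart \<open>X\<close> is a combination of coordinate fields, and
  \<open>nabla\<close> is linear over functions in this slot, so only the components of
  \<open>X\<close> at \<open>p\<close> enter. The chart is first cut down to an open set on which
  all fields are smooth.\<close>

lemma nabla_tensorial:
  assumes "open U" "p \<in> U" "smooth_vector_field A U X" "smooth_vector_field A U Y"
    and "open U'" "p \<in> U'" "smooth_vector_field A U' X'" "X' p = X p"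
  shows "nabla X' Y p = nabla X Y p"
proof -
  obtain W \<phi> where W: "(W, \<phi>) \<in> A" "p \<in> W" using chart_exists .
  let ?V = "U \<inter> U' \<inter> W"
  have V: "open ?V" "?V \<subseteq> W" "p \<in> ?V" using assms W open_chart_domain[OF W(1)] by auto
  have "smooth_vector_field A ?V X" "smooth_vector_field A ?V X'" "smooth_vector_field A ?V Y"
    using assms smooth_vector_field_subset by (meson inf_le1 inf_le2 le_infI1)+
  then show ?thesis using nabla_expand_left[OF W(1) V] assms(8) by simp
qed

text \<open>Tensoriality makes the definite description in \<open>nabla_at\<close> denote: all
  smooth extensions of \<open>v\<close> give the same value.\<close>

lemma nabla_at_eq:
  assumes "open U" "p \<in> U" "smooth_vector_field A U X" "smooth_vector_field A U Y" "X p = v"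
  shows "nabla_at A nabla p v Y = nabla X Y p"
  unfolding nabla_at_def
proof (rule the_equality)
  show "\<forall>U X'. open U \<and> p \<in> U \<and> smooth_vector_field A U X' \<and> X' p = v \<longrightarrow> nabla X Y p = nabla X' Y p"
    using nabla_tensorial[OF assms(1-4)] assms(5) by metis
qed (use assms in blast)

lemma nabla_at_coord_field:
  assumes "(U, \<phi>) \<in> A" "open V" "p \<in> V" "p \<in> U" "smooth_vector_field A V Y"
  shows "nabla_at A nabla p (coord_field A (U, \<phi>) v p) Y = nabla (coord_field A (U, \<phi>) v) Y p"
  using assms open_chart_domain[OF assms(1)] 
  by (intro nabla_at_eq[of "U \<inter> V"] smooth_vector_field_subset[OF smooth_vector_field_coord_field[OF assms(1)]]
      smooth_vector_field_subset[OF assms(5)]) auto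

lemma nabla_at_in_tangent:
  assumes "open V" "p \<in> V" "smooth_vector_field A V Y" "v \<in> tangent A p"
  shows "nabla_at A nabla p v Y \<in> tangent A p"
proof -
  obtain U \<phi> where U: "(U, \<phi>) \<in> A" "p \<in> U" using chart_exists .
  then obtain x where x: "v = coord_field A (U, \<phi>) x p"
    using assms(4) unfolding tangent_eq_range[OF U] by blast
  have "smooth_vector_field A (U \<inter> V) (nabla (coord_field A (U, \<phi>) x) Y)"
    using assms(1) open_chart_domain[OF U(1)]
    by (intro smooth_vector_field_nabla smooth_vector_field_subset[OF smooth_vector_field_coord_field[OF U(1)]]
      smooth_vector_field_subset[OF assms(3)]) auto
  then show ?thesis
    using nabla_at_coord_field[OF U(1) assms(1,2) U(2) assms(3)] assms(2) U smooth_vector_field_tangent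
    unfolding x by fastforce
qed

lemma nabla_at_linear:
  assumes "open V" "p \<in> V" "smooth_vector_field A V Y" "v \<in> tangent A p" "w \<in> tangent A p"
  shows "nabla_at A nabla p (\<lambda>f. a * v f + b * w f) Y = 
    (\<lambda>f. a * nabla_at A nabla p v Y f + b * nabla_at A nabla p w Y f)"
proof -
  obtain U \<phi> where U: "(U, \<phi>) \<in> A" "p \<in> U" using chart_exists .
  then obtain x y where x: "v = coord_field A (U, \<phi>) x p" and y: "w = coord_field A (U, \<phi>) y p"
    using assms(4,5) unfolding tangent_eq_range[OF U] by blast
  have V: "open (U \<inter> V)" "U \<inter> V \<subseteq> U" "p \<in> U \<inter> V"
    using assms(1,2) U open_chart_domain[OF U(1)] by auto
  have eq: "(\<lambda>f. a * v f + b * w f) = coord_field A (U, \<phi>) (a *\<^sub>R x + b *\<^sub>R y) p"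
    unfolding x y by (simp add: coord_field_add[OF U] coord_field_scaleR[OF U])
  have "nabla_at A nabla p (coord_field A (U, \<phi>) z p) Y = (\<lambda>\<psi>. \<Sum>i\<in>UNIV. z $ i * 
      nabla (coord_field A (U, \<phi>) (axis i 1)) Y p \<psi>)" for z
    unfolding nabla_at_coord_field[OF U(1) assms(1,2) U(2) assms(3)]
    using nabla_expand_left[OF U(1) V smooth_vector_field_subset[OF smooth_vector_field_coord_field[OF U(1)]] 
        smooth_vector_field_subset[OF assms(3)], of z]
    by (simp add: components_coord_field[OF U])
  then show ?thesis
    unfolding eq by (simp add: x y sum.distrib sum_distrib_left algebra_simps)
qed


subsection \<open>The metric and the gradient\<close>

context
  fixes p X Y
  assumes X: "X \<in> tangent A p" and Y: "Y \<in> tangent A p"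
begin

lemma metric_sym: "g p X Y = g p Y X"
  and metric_add_left: "Z \<in> tangent A p \<Longrightarrow> g p (\<lambda>f. X f + Y f) Z = g p X Z + g p Y Z"
  and metric_scale_left: "g p (\<lambda>f. a * X f) Y = a * g p X Y"
  and metric_pos: "X \<noteq> (\<lambda>f. 0) \<Longrightarrow> g p X X > 0"
  using metric X Y unfolding riemannian_metric_def by blast+

end

lemma metric_sum_left:
  assumes "Y \<in> tangent A p" "\<And>i. i \<in> I \<Longrightarrow> X i \<in> tangent A p"
  shows "g p (\<lambda>f. \<Sum>i\<in>I. a i * X i f) Y = (\<Sum>i\<in>I. a i * g p (X i) Y)"
proof -
  have "g p (\<lambda>f. 0) Y = 0"
    using metric_scale_left[OF assms(1,1), of 0] metric_scale_left[OF tangent_zero assms(1), of 0] by simp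
  then show ?thesis using assms(2)
    by (induction I rule: infinite_finite_induct)
      (auto simp: metric_add_left metric_scale_left assms(1) tangent_sum tangent_scale)
qed

lemma metric_coord_field:
  assumes "(U, \<phi>) \<in> A" "p \<in> U"
  shows "g p (coord_field A (U, \<phi>) v p) (coord_field A (U, \<phi>) w p) = (\<Sum>i\<in>UNIV. \<Sum>j\<in>UNIV. v $ i * w $ j *
    g p (coord_field A (U, \<phi>) (axis i 1) p) (coord_field A (U, \<phi>) (axis j 1) p))"
proof -
  note ct = coord_field_in_tangent[OF assms]
  have e: "coord_field A (U, \<phi>) v p = (\<lambda>f. \<Sum>i\<in>UNIV. v $ i * coord_field A (U, \<phi>) (axis i 1) p f)" for v
    by (intro ext coord_field_expand[OF assms])
  have *: "g p (coord_field A (U, \<phi>) v p) Y = (\<Sum>i\<in>UNIV. v $ i * g p (coord_field A (U, \<phi>) (axis i 1) p) Y)"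
    if "Y \<in> tangent A p" for v Y
    by (subst e) (intro metric_sum_left that ct)
  have "g p (coord_field A (U, \<phi>) v p) (coord_field A (U, \<phi>) w p) = (\<Sum>i\<in>UNIV. v $ i * 
      g p (coord_field A (U, \<phi>) w p) (coord_field A (U, \<phi>) (axis i 1) p))"
    by (subst *) (auto simp: ct metric_sym[OF ct ct, of w])
  also have "\<dots> = (\<Sum>i\<in>UNIV. \<Sum>j\<in>UNIV. v $ i * w $ j *
      g p (coord_field A (U, \<phi>) (axis i 1) p) (coord_field A (U, \<phi>) (axis j 1) p))"
    by (subst *) (auto simp: ct sum_distrib_left mult.assoc metric_sym[OF ct ct])
  finally show ?thesis .
qed

section \<open>The Gram matrix in a chart\<close>

lemma metric_coord_smooth:
  assumes "(U, \<phi>) \<in> A"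
  shows "C_inf_on A U (\<lambda>q. g q (coord_field A (U, \<phi>) v q) (coord_field A (U, \<phi>) w q))"
  using metric assms unfolding riemannian_metric_def by fastforce

definition metric_matrix :: "('m, real ^ 'd) chart \<Rightarrow> 'm \<Rightarrow> real ^ 'd ^ 'd" where
  "metric_matrix \<kappa> p = (\<chi> i j. g p (coord_field A \<kappa> (axis i 1) p) (coord_field A \<kappa> (axis j 1) p))"

lemma metric_matrix_vector:
  assumes "(U, \<phi>) \<in> A" "p \<in> U"
  shows "(metric_matrix (U, \<phi>) p *v y) \<bullet> x = g p (coord_field A (U, \<phi>) x p) (coord_field A (U, \<phi>) y p)"
  by (subst metric_coord_field[OF assms])
    (simp add: metric_matrix_def matrix_vector_mult_def inner_vec_def sum_distrib_left mult_ac)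

text \<open>A nonzero kernel vector would be the components of a nonzero tangent vector of length 0,
  against positive definiteness.\<close>

lemma det_metric_matrix:
  assumes "(U, \<phi>) \<in> A" "p \<in> U"
  shows "det (metric_matrix (U, \<phi>) p) \<noteq> 0"
proof -
  have "x = 0" if "metric_matrix (U, \<phi>) p *v x = 0" for x
  proof (rule ccontr)
    assume "x \<noteq> 0"
    then have "coord_field A (U, \<phi>) x p \<noteq> (\<lambda>f. 0)"
      using components_coord_field[OF assms, of x] by (auto simp: components_def vec_eq_iff)
    then have "g p (coord_field A (U, \<phi>) x p) (coord_field A (U, \<phi>) x p) > 0"
      using coord_field_in_tangent[OF assms] metric_pos by blast
    then show False using metric_matrix_vector[OF assms, of x x] that by simp
  qed
  then have "invertible (metric_matrix (U, \<phi>) p)"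
    using invertible_left_inverse matrix_left_invertible_ker by blast
  then show ?thesis using invertible_det_nz by blast
qed

text \<open>Existence: the components solve the linear system with the Gram matrix on the left and
  the partial derivatives of \<open>f\<close> on the right. Uniqueness: the difference of two
  solutions is orthogonal to every vector, itself included. Together these justify the definite
  description.\<close>

lemma gradient:
  shows gradient_in_tangent: "gradient A g f p \<in> tangent A p"
    and metric_gradient: "Y \<in> tangent A p \<Longrightarrow> g p (gradient A g f p) Y = Y f"
proof -
  obtain U \<phi> where U: "(U, \<phi>) \<in> A" "p \<in> U" using chart_exists .
  let ?b = "\<chi> i. coord_field A (U, \<phi>) (axis i 1) p f"
  obtain y where y: "metric_matrix (U, \<phi>) p *v y = ?b"
    using cramer[OF det_metric_matrix[OF U]] by blast
  let ?X = "coord_field A (U, \<phi>) y p"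
  have P: "?X \<in> tangent A p \<and> (\<forall>Y\<in>tangent A p. g p ?X Y = Y f)"
  proof (intro conjI ballI)
    fix Y assume "Y \<in> tangent A p"
    then obtain x where x: "Y = coord_field A (U, \<phi>) x p" unfolding tangent_eq_range[OF U] by blast
    have "g p ?X Y = ?b \<bullet> x"
      using metric_matrix_vector[OF U, of y x] metric_sym[of ?X p Y] coord_field_in_tangent[OF U] x y by simp
    also have "\<dots> = Y f" using coord_field_expand[OF U, of x f] x by (simp add: inner_vec_def mult.commute)
    finally show "g p ?X Y = Y f" .
  qed (rule coord_field_in_tangent[OF U])
  moreover have "X = ?X" if X: "X \<in> tangent A p \<and> (\<forall>Y\<in>tangent A p. g p X Y = Y f)" for X
  proof (rule ccontr)
    assume "X \<noteq> ?X"
    let ?D = "\<lambda>f. X f + (-1) * ?X f"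
    have D: "?D \<in> tangent A p" using X P by (intro tangent_add tangent_scale) auto
    have "?D \<noteq> (\<lambda>f. 0)" using \<open>X \<noteq> ?X\<close> by (auto simp: fun_eq_iff)
    then have "g p ?D ?D > 0" using metric_pos[OF D D] by blast
    moreover have "g p ?D ?D = g p X ?D + g p (\<lambda>f. (-1) * ?X f) ?D"
      using X P D by (intro metric_add_left tangent_scale) auto
    moreover have "g p (\<lambda>f. (-1) * ?X f) ?D = - g p ?X ?D"
      using P D metric_scale_left[of ?X p ?D "-1"] by simp
    ultimately show False using X P D by simp
  qed
  ultimately have "gradient A g f p = ?X" unfolding gradient_def by (rule the_equality)
  with P show "gradient A g f p \<in> tangent A p" "Y \<in> tangent A p \<Longrightarrow> g p (gradient A g f p) Y = Y f" by auto
qed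

text \<open>The components solve a linear system with smooth matrix, smooth right-hand side and
  nonvanishing determinant.\<close>

lemma smooth_vector_field_gradient:
  assumes "(U, \<phi>) \<in> A" "C_inf_on A U f"
  shows "smooth_vector_field A U (gradient A g f)"
proof (rule smooth_vector_fieldI[OF assms(1)])
  let ?y = "\<lambda>q. components (U, \<phi>) (gradient A g f q)"
  let ?b = "\<lambda>q. \<chi> i. coord_field A (U, \<phi>) (axis i 1) q f"
  let ?i = "inv_into U \<phi>"
  note oU = open_chart_domain[OF assms(1)]
  show "open U" by (rule oU)
  show grad: "gradient A g f q = coord_field A (U, \<phi>) (?y q) q" if "q \<in> U" for q
    using coord_field_components[OF assms(1) that gradient_in_tangent] by simp
  fix k
  have "smooth_on (\<phi> ` U) (\<lambda>x. ?y (?i x) $ k)"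
  proof (rule smooth_on_linear_system)
    show "open (\<phi> ` U)" by (rule open_chart_image[OF assms(1)])
    show "smooth_on (\<phi> ` U) (\<lambda>x. metric_matrix (U, \<phi>) (?i x) $ i $ j)" for i j
      using metric_coord_smooth[OF assms(1)] C_inf_on_chart_iff[OF assms(1) oU order_refl]
      by (simp add: metric_matrix_def)
    have "C_inf_on A U (\<lambda>q. coord_field A (U, \<phi>) (axis i 1) q f)" for i
      using smooth_vector_field_coord_field[OF assms(1)] assms(2) oU unfolding smooth_vector_field_def by blast
    then show "smooth_on (\<phi> ` U) (\<lambda>x. ?b (?i x) $ i)" for i
      using C_inf_on_chart_iff[OF assms(1) oU order_refl] by simp
    fix x assume "x \<in> \<phi> ` U"
    then have q: "?i x \<in> U" using assms by simp
    then show "det (metric_matrix (U, \<phi>) (?i x)) \<noteq> 0" using det_metric_matrix assms by blast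
    have "(metric_matrix (U, \<phi>) (?i x) *v ?y (?i x)) \<bullet> axis i 1 = ?b (?i x) \<bullet> axis i 1" for i
      unfolding metric_matrix_vector[OF assms(1) q] grad[OF q, symmetric]
      using metric_gradient[of "coord_field A (U, \<phi>) (axis i 1) (?i x)" "?i x" f]
        metric_sym[OF coord_field_in_tangent[OF assms(1) q] gradient_in_tangent]
        coord_field_in_tangent[OF assms(1) q]
      by (simp add: inner_axis)
    then show "metric_matrix (U, \<phi>) (?i x) *v ?y (?i x) = ?b (?i x)"
      by (simp add: vec_eq_iff inner_axis)
  qed
  then show "C_inf_on A U (\<lambda>q. ?y q $ k)" 
    using C_inf_on_chart_iff[OF assms(1) oU order_refl] by blast
qed simp


section \<open>The Laplace--Beltrami operator in an orthonormal frame\<close>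

text \<open>The trace is invariant under the change of basis from the frame picked in the definition
  to \<open>u\<close>. For an orthonormal \<open>u\<close> the diagonal entries of the matrix of
  \<open>L\<close> are inner products with the frame vectors.\<close>

lemma tangent_trace_orthonormal:
  assumes "(p, u) \<in> orthonormal_frames A g"
    and L: "\<And>X. X \<in> tangent A p \<Longrightarrow> L X \<in> tangent A p"
    and lin: "\<And>X Y a b. X \<in> tangent A p \<Longrightarrow> Y \<in> tangent A p \<Longrightarrow> 
      L (\<lambda>f. a * X f + b * Y f) = (\<lambda>f. a * L X f + b * L Y f)"
  shows "tangent_trace A p L = (\<Sum>i\<in>UNIV. g p (L (u (axis i 1))) (u (axis i 1)))"
proof -
  have u: "linear_frame A p u" and ortho: "g p (u x) (u y) = x \<bullet> y" for x y
    using assms(1) unfolding orthonormal_frames_def by auto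
  define b where "b = (SOME b. linear_frame A p b)"
  \<comment> \<open>The choice succeeds because \<open>u\<close> itself is a linear frame.\<close>
  have b: "linear_frame A p b" unfolding b_def by (rule someI[of "linear_frame A p", OF u])
  let ?bi = "inv_into UNIV b" and ?ui = "inv_into UNIV u"
  note bi = linear_frame_inverse[OF b] and ui = linear_frame_inverse[OF u]
  define P where "P x = ?bi (u x)" for x
  define Q where "Q x = ?ui (b x)" for x
  define M where "M x = ?ui (L (u x))" for x
  have "linear P" unfolding P_def using linear_between_frames[OF u b, of "\<lambda>X. X"] by simp
  have "linear Q" unfolding Q_def using linear_between_frames[OF b u, of "\<lambda>X. X"] by simp
  have "linear M" unfolding M_def by (rule linear_between_frames[OF u u, where L = L]) (simp_all add: L lin)
  have "Q \<circ> P = id" by (auto simp: P_def Q_def bi ui)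
  then have QP: "matrix Q ** matrix P = mat 1"
    using matrix_compose[OF \<open>linear P\<close> \<open>linear Q\<close>] by (simp add: matrix_id_mat_1)
  have "?bi \<circ> L \<circ> b = P \<circ> (M \<circ> Q)" by (auto simp: P_def Q_def M_def bi ui L)
  then have "matrix (?bi \<circ> L \<circ> b) = matrix P ** (matrix M ** matrix Q)"
    using matrix_compose[OF \<open>linear Q\<close> \<open>linear M\<close>] 
      matrix_compose[OF linear_compose[OF \<open>linear Q\<close> \<open>linear M\<close>] \<open>linear P\<close>] by simp
  then have "tangent_trace A p L = trace (matrix P ** (matrix M ** matrix Q))"
    unfolding tangent_trace_def b_def[symmetric] Let_def by simp
  \<comment> \<open>Cyclicity of the trace brings \<open>matrix P\<close> next to
    \<open>matrix Q\<close>, and their product is the identity.\<close>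
  also have "\<dots> = trace (matrix M ** (matrix Q ** matrix P))"
    by (subst trace_mul_sym) (simp add: matrix_mul_assoc)
  also have "\<dots> = (\<Sum>i\<in>UNIV. M (axis i 1) \<bullet> axis i 1)"
    unfolding QP matrix_mul_rid by (simp add: trace_def matrix_def inner_axis)
  also have "\<dots> = (\<Sum>i\<in>UNIV. g p (L (u (axis i 1))) (u (axis i 1)))"
    by (simp add: ortho[symmetric] M_def ui L)
  finally show ?thesis .
qed

text \<open>A field is needed, not just the vector \<open>u e_i\<close>, because metric
  compatibility differentiates \<open>g (grad f) V\<close>, which equals \<open>V f\<close> on the
  whole chart. The remaining term \<open>g (grad f) (\<nabla>_V V)\<close> is again a derivative of
  \<open>f\<close>, by the defining property of the gradient.\<close>

lemma laplace_beltrami_orthonormal: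
  assumes "(p, u) \<in> orthonormal_frames A g" "(U, \<phi>) \<in> A" "p \<in> U" "C_inf_on A U f"
    and V: "\<And>i. V i = coord_field A (U, \<phi>) (components (U, \<phi>) (u (axis i 1)))"
  shows "laplace_beltrami A g nabla f p = 
    (\<Sum>i\<in>UNIV. V i p (\<lambda>q. V i q f) - nabla (V i) (V i) p f)"
proof -
  let ?G = "gradient A g f"
  note oU = open_chart_domain[OF assms(2)]
  note G = smooth_vector_field_gradient[OF assms(2,4)]
  have u: "u x \<in> tangent A p" for x
    using assms(1) linear_frame_inverse(3) unfolding orthonormal_frames_def by blast
  have Vp: "V i p = u (axis i 1)" for i
    unfolding V by (rule coord_field_components[OF assms(2,3) u])
  have svf: "smooth_vector_field A U (V i)" for i
    unfolding V by (rule smooth_vector_field_coord_field[OF assms(2)])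
  have "laplace_beltrami A g nabla f p = 
      (\<Sum>i\<in>UNIV. g p (nabla_at A nabla p (u (axis i 1)) ?G) (u (axis i 1)))"
    unfolding laplace_beltrami_def divergence_def
    by (intro tangent_trace_orthonormal[OF assms(1)] nabla_at_in_tangent[OF oU assms(3) G] 
        nabla_at_linear[OF oU assms(3) G])
  also have "\<dots> = (\<Sum>i\<in>UNIV. V i p (\<lambda>q. V i q f) - nabla (V i) (V i) p f)"
  proof (rule sum.cong[OF refl])
    fix i
    have "nabla_at A nabla p (u (axis i 1)) ?G = nabla (V i) ?G p"
      by (rule nabla_at_eq[OF oU assms(3) svf G Vp])
    moreover have "V i p (\<lambda>q. g q (?G q) (V i q)) = V i p (\<lambda>q. V i q f)"
      by (rule tangent_cong[OF smooth_vector_field_tangent[OF svf assms(3)] oU assms(3)])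
        (rule metric_gradient[OF smooth_vector_field_tangent[OF svf]])
    moreover have "V i p (\<lambda>q. g q (?G q) (V i q)) = 
        g p (nabla (V i) ?G p) (V i p) + g p (?G p) (nabla (V i) (V i) p)"
      by (rule metric_compatible[OF oU svf G svf assms(3)])
    moreover have "g p (?G p) (nabla (V i) (V i) p) = nabla (V i) (V i) p f"
      by (rule metric_gradient[OF smooth_vector_field_tangent[OF smooth_vector_field_nabla[OF oU svf svf] assms(3)]])
    ultimately show "g p (nabla_at A nabla p (u (axis i 1)) ?G) (u (axis i 1)) = 
        V i p (\<lambda>q. V i q f) - nabla (V i) (V i) p f"
      by (simp add: Vp)
  qed
  finally show ?thesis .
qed


section \<open>The covariant derivative along a curve\<close>

lemma coord_field_change_chart:
  assumes "(U, \<phi>) \<in> A" "(U', \<phi>') \<in> A" "p \<in> U" "p \<in> U'"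
  shows "coord_field A (U, \<phi>) v p = (\<lambda>\<psi>. \<Sum>k\<in>UNIV. coord_field A (U, \<phi>) v p (\<lambda>q. \<phi>' q $ k) * 
    coord_field A (U', \<phi>') (axis k 1) p \<psi>)"
  using tangent_expand[OF assms(2,4) coord_field_in_tangent[OF assms(1,3)], of v]
  by (simp add: components_def)

text \<open>The coordinate field of one chart is expanded in those of the other, and the Leibniz
  rule is applied. The coefficients vary, which produces the inhomogeneous term known from the
  transformation of Christoffel symbols.\<close>

lemma nabla_at_coord_change_chart:
  assumes "(U, \<phi>) \<in> A" "(U', \<phi>') \<in> A" "p \<in> U" "p \<in> U'" "X \<in> tangent A p"
  shows "nabla_at A nabla p X (coord_field A (U, \<phi>) v) \<psi> = 
    (\<Sum>k\<in>UNIV. X (\<lambda>q. coord_field A (U, \<phi>) v q (\<lambda>r. \<phi>' r $ k)) * coord_field A (U', \<phi>') (axis k 1) p \<psi> +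
      coord_field A (U, \<phi>) v p (\<lambda>r. \<phi>' r $ k) * nabla_at A nabla p X (coord_field A (U', \<phi>') (axis k 1)) \<psi>)"
proof -
  obtain x where x: "X = coord_field A (U, \<phi>) x p" 
    using assms(5) unfolding tangent_eq_range[OF assms(1,3)] by blast
  let ?X = "coord_field A (U, \<phi>) x" and ?V = "coord_field A (U, \<phi>) v"
  let ?D = "\<lambda>k. coord_field A (U', \<phi>') (axis k 1)" and ?h = "\<lambda>k q. coord_field A (U, \<phi>) v q (\<lambda>r. \<phi>' r $ k)"
  let ?W = "U \<inter> U'"
  note oU = open_chart_domain[OF assms(1)] open_chart_domain[OF assms(2)]
  have W: "open ?W" "p \<in> ?W" using assms oU by auto
  have svf: "smooth_vector_field A ?W (coord_field A (U, \<phi>) w)" for w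
    by (rule smooth_vector_field_subset[OF smooth_vector_field_coord_field[OF assms(1)]]) auto
  have svf': "smooth_vector_field A ?W (?D k)" for k
    by (rule smooth_vector_field_subset[OF smooth_vector_field_coord_field[OF assms(2)]]) auto
  have h: "C_inf_on A ?W (?h k)" for k
    unfolding C_inf_on_def
    using smooth_vector_field_apply[OF svf W(1)] smooth_fun_at_coord[OF assms(2)] by blast
  have "nabla ?X ?V p = nabla ?X (\<lambda>q \<psi>. \<Sum>k\<in>UNIV. ?h k q * ?D k q \<psi>) p"
  proof (rule nabla_cong[OF W(1) svf _ W(2)])
    show "?V q = (\<lambda>\<psi>. \<Sum>k\<in>UNIV. ?h k q * ?D k q \<psi>)" if "q \<in> ?W" for q
      using that by (intro coord_field_change_chart assms) auto
  qed (intro smooth_vector_field_sum h svf' refl)+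
  also have "\<dots> = (\<lambda>\<psi>. \<Sum>k\<in>UNIV. ?X p (?h k) * ?D k p \<psi> + ?h k p * nabla ?X (?D k) p \<psi>)"
    by (rule nabla_sum_right[OF W(1) svf W(2) h svf'])
  finally show ?thesis
    using nabla_at_eq[OF W svf svf, of x X v] nabla_at_eq[OF W svf svf', of x X] x by simp
qed

text \<open>Components of \<open>W\<close> transform by the coefficients \<open>?h j k\<close>.
  Differentiating these along the curve produces the terms \<open>?X (?h j k)\<close>, exactly the
  inhomogeneous terms that the connection acquires under the change of chart.\<close>

lemma covariant_derivative_change_chart:
  assumes "(U, \<phi>) \<in> A" "(U', \<phi>') \<in> A" "open J" "t \<in> J" "c ` J \<subseteq> U \<inter> U'"
    and "\<And>s. s \<in> J \<Longrightarrow> W s \<in> tangent A (c s)" "((\<lambda>s. \<phi> (c s)) has_vector_derivative x) (at t)"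
    and "\<And>j. ((\<lambda>s. components (U, \<phi>) (W s) $ j) has_real_derivative w j) (at t)"
  shows "covariant_derivative A nabla (U', \<phi>') c W t = covariant_derivative A nabla (U, \<phi>) c W t"
proof
  fix \<psi>
  let ?p = "c t" and ?X = "velocity A UNIV c t"
  let ?D = "\<lambda>j. coord_field A (U, \<phi>) (axis j 1)" and ?D' = "\<lambda>k. coord_field A (U', \<phi>') (axis k 1)"
  let ?h = "\<lambda>j k q. ?D j q (\<lambda>r. \<phi>' r $ k)"
  let ?W = "\<lambda>s j. components (U, \<phi>) (W s) $ j" and ?W' = "\<lambda>s k. components (U', \<phi>') (W s) $ k"
  have p: "?p \<in> U" "?p \<in> U'" using assms(4,5) by auto
  have cU: "c ` J \<subseteq> U" using assms(5) by blast
  have X: "?X \<in> tangent A ?p"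
    unfolding velocity_eq_coord_field[OF assms(1,3,4) cU assms(7)] by (rule coord_field_in_tangent[OF assms(1) p(1)])
  have W': "?W' s k = (\<Sum>j\<in>UNIV. ?W s j * ?h j k (c s))" if "s \<in> J" for s k
    using fun_cong[OF tangent_expand[OF assms(1) _ assms(6)[OF that]], of "\<lambda>r. \<phi>' r $ k"] cU that
    by (auto simp: components_def)
  have h: "smooth_fun_at A UNIV (?h j k) ?p" for j k
    by (rule smooth_vector_field_apply[OF smooth_vector_field_coord_field[OF assms(1)] 
        open_chart_domain[OF assms(1)] p(1) smooth_fun_at_coord[OF assms(2) p(2)]])
  have "((\<lambda>s. \<Sum>j\<in>UNIV. ?W s j * ?h j k (c s)) has_real_derivative 
      (\<Sum>j\<in>UNIV. w j * ?h j k ?p + ?X (?h j k) * ?W t j)) (at t)" for k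
    by (intro DERIV_sum DERIV_mult assms(8) velocity_apply(1)[OF assms(1,3,4) cU assms(7)] h)
  then have "((\<lambda>s. ?W' s k) has_real_derivative 
      (\<Sum>j\<in>UNIV. w j * ?h j k ?p + ?X (?h j k) * ?W t j)) (at t)" for k
    by (rule DERIV_cong_ev[THEN iffD1, rotated 3])
      (auto simp: eventually_nhds W' intro!: exI[of _ J] assms(3,4))
  then have dW': "deriv (\<lambda>s. ?W' s k) t = (\<Sum>j\<in>UNIV. w j * ?h j k ?p + ?X (?h j k) * ?W t j)" for k
    by (rule DERIV_imp_deriv)
  let ?N = "\<lambda>j. nabla_at A nabla ?p ?X (?D j) \<psi>" and ?N' = "\<lambda>k. nabla_at A nabla ?p ?X (?D' k) \<psi>"
  have "covariant_derivative A nabla (U, \<phi>) c W t \<psi> = 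
      (\<Sum>j\<in>UNIV. w j * ?D j ?p \<psi> + ?W t j * ?N j)"
    unfolding covariant_derivative_def using DERIV_imp_deriv[OF assms(8)] by simp
  also have "\<dots> = (\<Sum>j\<in>UNIV. \<Sum>k\<in>UNIV. 
      (w j * ?h j k ?p + ?X (?h j k) * ?W t j) * ?D' k ?p \<psi> + ?W t j * ?h j k ?p * ?N' k)"
  proof (rule sum.cong[OF refl])
    fix j
    have D: "?D j ?p \<psi> = (\<Sum>k\<in>UNIV. ?h j k ?p * ?D' k ?p \<psi>)"
      using fun_cong[OF coord_field_change_chart[OF assms(1,2) p, of "axis j 1"]] .
    have N: "?N j = (\<Sum>k\<in>UNIV. ?X (?h j k) * ?D' k ?p \<psi> + ?h j k ?p * ?N' k)"
      by (rule nabla_at_coord_change_chart[OF assms(1,2) p X])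
    show "w j * ?D j ?p \<psi> + ?W t j * ?N j = (\<Sum>k\<in>UNIV. 
        (w j * ?h j k ?p + ?X (?h j k) * ?W t j) * ?D' k ?p \<psi> + ?W t j * ?h j k ?p * ?N' k)"
      unfolding D N by (simp add: sum_distrib_left sum.distrib algebra_simps)
  qed
  also have "\<dots> = (\<Sum>k\<in>UNIV. \<Sum>j\<in>UNIV. 
      (w j * ?h j k ?p + ?X (?h j k) * ?W t j) * ?D' k ?p \<psi> + ?W t j * ?h j k ?p * ?N' k)"
    by (rule sum.swap)
  also have "\<dots> = (\<Sum>k\<in>UNIV. deriv (\<lambda>s. ?W' s k) t * ?D' k ?p \<psi> + ?W' t k * ?N' k)"
    by (simp only: dW' W'[OF assms(4)] sum.distrib sum_distrib_right distrib_right)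
  also have "\<dots> = covariant_derivative A nabla (U', \<phi>') c W t \<psi>"
    unfolding covariant_derivative_def by simp
  finally show "covariant_derivative A nabla (U', \<phi>') c W t \<psi> = 
      covariant_derivative A nabla (U, \<phi>) c W t \<psi>" by simp
qed


section \<open>Horizontal curves\<close>

text \<open>\<open>(u(s) e) \<psi>\<close> is the sum of the components of \<open>u(s) e\<close>
  times the partial derivatives of \<open>\<psi>\<close>. After the product rule, the parallel
  equation eliminates the derivatives of the components, so that only the frame at time
  \<open>t\<close> and the base velocity \<open>X\<close> remain.\<close>

lemma horizontal_curve_derivative:
  assumes "horizontal_curve A g nabla I c" "t \<in> I" "(U, \<phi>) \<in> A" "fst (c t) \<in> U" 
    and "smooth_fun_at A UNIV \<psi> (fst (c t))" and X: "X = velocity A UNIV (\<lambda>s. fst (c s)) t"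
  shows "((\<lambda>s. snd (c s) e \<psi>) has_real_derivative 
    (\<Sum>j\<in>UNIV. components (U, \<phi>) (snd (c t) e) $ j * 
      (X (\<lambda>q. coord_field A (U, \<phi>) (axis j 1) q \<psi>) - 
       nabla_at A nabla (fst (c t)) X (coord_field A (U, \<phi>) (axis j 1)) \<psi>))) (at t)"
proof -
  let ?D = "\<lambda>j. coord_field A (U, \<phi>) (axis j 1)" and ?p = "fst (c t)"
  let ?W = "\<lambda>s j. components (U, \<phi>) (snd (c s) e) $ j"
  let ?M = "\<lambda>s. matrix (\<lambda>x. components (U, \<phi>) (snd (c s) x))"
  have sc: "smooth_curve (frame_atlas A) (orthonormal_frames A g) I c"
    and par: "parallel_along A nabla I (frame_proj \<circ> c) (\<lambda>s. snd (c s) e)"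
    using assms(1) unfolding horizontal_curve_def by blast+
  obtain J where J: "open J" "t \<in> J" "J \<subseteq> I" "(\<lambda>s. fst (c s)) ` J \<subseteq> U" "smooth_on J (\<lambda>s. \<phi> (fst (c s)))"
      "smooth_on J ?M"
    by (rule frame_curve_chart[OF sc assms(2-4)])
  have frame: "linear_frame A (fst (c s)) (snd (c s))" if "s \<in> J" for s
  proof -
    have "c s \<in> orthonormal_frames A g" using sc that J(3) unfolding smooth_curve_def by blast
    then show ?thesis unfolding orthonormal_frames_def by auto
  qed
  have U: "fst (c s) \<in> U" if "s \<in> J" for s using J(4) that by blast
  obtain w where w: "(?M has_vector_derivative w) (at t)"
    using smooth_on_has_vector_derivative[OF J(6,2)] by blast
  have "((\<lambda>s. ?M s *v e) has_vector_derivative w *v e) (at t)"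
    by (rule bounded_linear.has_vector_derivative[OF bounded_linear_matrix_vector_left w])
  then have "((\<lambda>s. components (U, \<phi>) (snd (c s) e)) has_vector_derivative w *v e) (at t)"
    by (rule has_vector_derivative_transform_within_open[OF _ J(1,2)]) (rule frame_components_matrix[OF frame])
  then have dW: "((\<lambda>s. ?W s j) has_real_derivative (w *v e) $ j) (at t)" for j
    by (rule has_real_derivative_nth)
  have "smooth_fun_at A UNIV (\<lambda>q. ?D j q \<psi>) ?p" for j
    by (rule smooth_vector_field_apply[OF smooth_vector_field_coord_field[OF assms(3)] 
        open_chart_domain[OF assms(3)] assms(4,5)])
  then have dD: "((\<lambda>s. ?D j (fst (c s)) \<psi>) has_real_derivative X (\<lambda>q. ?D j q \<psi>)) (at t)" for j
    unfolding X
    by (rule velocity_apply(1)[OF assms(3) J(1,2,4) smooth_on_has_vector_derivative[OF J(5,2)]])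
  have "((\<lambda>s. \<Sum>j\<in>UNIV. ?W s j * ?D j (fst (c s)) \<psi>) has_real_derivative 
      (\<Sum>j\<in>UNIV. (w *v e) $ j * ?D j ?p \<psi> + X (\<lambda>q. ?D j q \<psi>) * ?W t j)) (at t)"
    by (intro DERIV_sum DERIV_mult dW dD)
  \<comment> \<open>This is the parallel equation in the given chart, evaluated at
    \<open>\<psi>\<close>.\<close>
  moreover have "(\<Sum>j\<in>UNIV. (w *v e) $ j * ?D j ?p \<psi> + ?W t j * nabla_at A nabla ?p X (?D j) \<psi>) = 0"
  proof -
    have "covariant_derivative A nabla (U, \<phi>) (frame_proj \<circ> c) (\<lambda>s. snd (c s) e) t \<psi> = 0"
      using par assms(2-4) unfolding parallel_along_def frame_proj_def by fastforce
    then show ?thesis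
      unfolding covariant_derivative_def X using DERIV_imp_deriv[OF dW]
      by (simp add: frame_proj_def o_def)
  qed
  ultimately have "((\<lambda>s. \<Sum>j\<in>UNIV. ?W s j * ?D j (fst (c s)) \<psi>) has_real_derivative 
      (\<Sum>j\<in>UNIV. ?W t j * (X (\<lambda>q. ?D j q \<psi>) - nabla_at A nabla ?p X (?D j) \<psi>))) (at t)"
    by (elim DERIV_cong) (simp add: sum.distrib sum_subtractf algebra_simps)
  then show ?thesis
  proof (rule has_field_derivative_transform_within_open[OF _ J(1,2)])
    fix s assume "s \<in> J"
    show "(\<Sum>j\<in>UNIV. ?W s j * ?D j (fst (c s)) \<psi>) = snd (c s) e \<psi>"
      by (rule fun_cong[OF tangent_expand[OF assms(3) U linear_frame_inverse(3)[OF frame]], symmetric]) fact+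
  qed
qed

text \<open>The right-hand side mentions the curve only through \<open>c t\<close> and
  \<open>X\<close>; this is the source of uniqueness.\<close>

lemma horizontal_curve_chart_derivative:
  assumes "horizontal_curve A g nabla I c" "t \<in> I" "(U, \<phi>) \<in> A" "fst (c t) \<in> U"
    and X: "X = velocity A UNIV (\<lambda>s. fst (c s)) t"
  shows "((\<lambda>s. (\<phi> (fst (c s)), matrix (\<lambda>x. components (U, \<phi>) (snd (c s) x)))) has_vector_derivative 
    (components (U, \<phi>) X, 
     \<chi> k i. \<Sum>j\<in>UNIV. components (U, \<phi>) (snd (c t) (axis i 1)) $ j *
      (X (\<lambda>q. coord_field A (U, \<phi>) (axis j 1) q (\<lambda>r. \<phi> r $ k)) - 
       nabla_at A nabla (fst (c t)) X (coord_field A (U, \<phi>) (axis j 1)) (\<lambda>r. \<phi> r $ k)))) (at t)"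
proof (intro has_vector_derivative_Pair has_vector_derivative_matrix_entries)
  have sc: "smooth_curve (frame_atlas A) (orthonormal_frames A g) I c"
    using assms(1) unfolding horizontal_curve_def by blast
  note base = smooth_curve_frame_proj[OF sc]
  obtain v where v: "velocity A UNIV (\<lambda>s. fst (c s)) t = coord_field A (U, \<phi>) v (fst (c t))"
    "((\<lambda>s. \<phi> (fst (c s))) has_vector_derivative v) (at t)"
    by (rule smooth_curve_velocity[OF base assms(2-4)])
  then show "((\<lambda>s. \<phi> (fst (c s))) has_vector_derivative components (U, \<phi>) X) (at t)"
    using components_coord_field[OF assms(3,4)] X by simp
  fix k i
  show "((\<lambda>s. matrix (\<lambda>x. components (U, \<phi>) (snd (c s) x)) $ k $ i) has_real_derivative
      (\<chi> k i. \<Sum>j\<in>UNIV. components (U, \<phi>) (snd (c t) (axis i 1)) $ j *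
      (X (\<lambda>q. coord_field A (U, \<phi>) (axis j 1) q (\<lambda>r. \<phi> r $ k)) - 
       nabla_at A nabla (fst (c t)) X (coord_field A (U, \<phi>) (axis j 1)) (\<lambda>r. \<phi> r $ k))) $ k $ i) (at t)"
    using horizontal_curve_derivative[OF assms(1-4) smooth_fun_at_coord[OF assms(3,4)] X, of "axis i 1" k]
    by (simp add: matrix_def components_def)
qed

text \<open>A smooth \<open>F\<close> on \<open>O(M)\<close> equals a smooth function
  \<open>h\<close> of the frame coordinates only at orthonormal frames, but horizontal curves stay
  among these. By the chain rule its derivative is that of \<open>h\<close> in the direction of the
  coordinate velocity, which both curves share. Any other \<open>F\<close> is sent to 0 by both
  velocities.\<close>

lemma horizontal_velocity_unique:
  assumes "horizontal_curve A g nabla I c" "t \<in> I" "horizontal_curve A g nabla I' c'" "t' \<in> I'" "c' t' = c t"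
    and eq: "velocity A UNIV (\<lambda>s. fst (c' s)) t' = velocity A UNIV (\<lambda>s. fst (c s)) t"
  shows "velocity (frame_atlas A) (orthonormal_frames A g) c' t' = velocity (frame_atlas A) (orthonormal_frames A g) c t"
proof
  fix F
  let ?S = "orthonormal_frames A g"
  obtain U \<phi> where U: "(U, \<phi>) \<in> A" "fst (c t) \<in> U" using chart_exists .
  let ?\<Phi> = "\<lambda>(p, u). (\<phi> p, matrix (\<lambda>x. components (U, \<phi>) (u x)))"
  let ?X = "velocity A UNIV (\<lambda>s. fst (c s)) t"
  let ?Y = "(components (U, \<phi>) ?X, 
     \<chi> k i. \<Sum>j\<in>UNIV. components (U, \<phi>) (snd (c t) (axis i 1)) $ j *
      (?X (\<lambda>q. coord_field A (U, \<phi>) (axis j 1) q (\<lambda>r. \<phi> r $ k)) - 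
       nabla_at A nabla (fst (c t)) ?X (coord_field A (U, \<phi>) (axis j 1)) (\<lambda>r. \<phi> r $ k)))"
  show "velocity (frame_atlas A) ?S c' t' F = velocity (frame_atlas A) ?S c t F"
  proof (cases "smooth_fun_at (frame_atlas A) ?S F (c t)")
    case True
    have ON: "c t \<in> ?S" using assms(1,2) unfolding horizontal_curve_def smooth_curve_def by blast
    then have D: "c t \<in> {(p, u). p \<in> U \<and> linear_frame A p u}" 
      using U unfolding orthonormal_frames_def by (auto simp: split_beta)
    obtain W h where W: "open W" "?\<Phi> (c t) \<in> W" "smooth_on W h"
        and h: "\<forall>q\<in>{(p, u). p \<in> U \<and> linear_frame A p u} \<inter> ?S. ?\<Phi> q \<in> W \<longrightarrow> F q = h (?\<Phi> q)"
      by (rule smooth_fun_at_extensionE[OF True frame_atlasI[OF U(1)] D])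
    have "deriv (\<lambda>s. F (b s)) r = frechet_derivative h (at (?\<Phi> (c t))) ?Y" 
      if b: "horizontal_curve A g nabla K b" "r \<in> K" "b r = c t" "?X = velocity A UNIV (\<lambda>s. fst (b s)) r" for b r K
    proof -
      have sc: "smooth_curve (frame_atlas A) ?S K b" using b(1) unfolding horizontal_curve_def by blast
      have U': "fst (b r) \<in> U" using U(2) b(3) by simp
      obtain J where J: "open J" "r \<in> J" "J \<subseteq> K" "(\<lambda>s. fst (b s)) ` J \<subseteq> U" "smooth_on J (\<lambda>s. \<phi> (fst (b s)))"
          "smooth_on J (\<lambda>s. matrix (\<lambda>x. components (U, \<phi>) (snd (b s) x)))"
        by (rule frame_curve_chart[OF sc b(2) U(1) U'])
      have sm: "smooth_on J (\<lambda>s. ?\<Phi> (b s))" 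
        using smooth_on_Pair[OF J(1,5,6)] by (simp add: split_beta)
      let ?J = "{s \<in> J. ?\<Phi> (b s) \<in> W}"
      have oJ: "open ?J" by (rule open_preimage_smooth_on[OF J(1) sm W(1)])
      have rJ: "r \<in> ?J" using J(2) W(2) b(3) by simp
      have "((\<lambda>s. ?\<Phi> (b s)) has_vector_derivative ?Y) (at r)"
        using horizontal_curve_chart_derivative[OF b(1,2) U(1) U' b(4)] b(3) by (simp add: split_beta)
      moreover have "(h has_derivative frechet_derivative h (at (?\<Phi> (c t)))) (at (?\<Phi> (b r)) within range (\<lambda>s. ?\<Phi> (b s)))"
        using smooth_on_has_derivative[OF W(3,2)] b(3) has_derivative_at_withinI by metis
      ultimately have "((\<lambda>s. h (?\<Phi> (b s))) has_vector_derivative frechet_derivative h (at (?\<Phi> (c t))) ?Y) (at r)"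
        using vector_derivative_diff_chain_within[of "\<lambda>s. ?\<Phi> (b s)" ?Y r UNIV h] by (simp add: o_def)
      then have "((\<lambda>s. F (b s)) has_vector_derivative frechet_derivative h (at (?\<Phi> (c t))) ?Y) (at r)"
      proof (rule has_vector_derivative_transform_within_open[OF _ oJ rJ])
        fix s assume s: "s \<in> ?J"
        then have "b s \<in> ?S" using sc J(3) unfolding smooth_curve_def by blast
        then have "linear_frame A (fst (b s)) (snd (b s))" unfolding orthonormal_frames_def by auto
        then have "b s \<in> {(p, u). p \<in> U \<and> linear_frame A p u}" 
          using s J(4) by (auto simp: split_beta)
        then show "h (?\<Phi> (b s)) = F (b s)" using bspec[OF h IntI] s \<open>b s \<in> ?S\<close> by simp
      qed
      then show ?thesis
        by (simp add: DERIV_imp_deriv has_real_derivative_iff_has_vector_derivative)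
    qed
    from this[OF assms(1,2) refl refl] this[OF assms(3-5) eq[symmetric]] show ?thesis
      by (simp add: velocity_def assms(5))
  qed (simp add: velocity_def assms(5))
qed


section \<open>Existence of horizontal lifts\<close>

text \<open>The Christoffel symbols contracted with \<open>v\<close>. Column \<open>j\<close> holds
  the components of the derivative of the \<open>j\<close>-th coordinate field, so the matrix acts
  from the left on component vectors and on frame matrices.\<close>

definition connection_matrix :: "('m, real ^ 'd) chart \<Rightarrow> real ^ 'd \<Rightarrow> 'm \<Rightarrow> real ^ 'd ^ 'd" where
  "connection_matrix \<kappa> v q =
     (\<chi> k j. components \<kappa> (nabla (coord_field A \<kappa> v) (coord_field A \<kappa> (axis j 1)) q) $ k)"

context
  fixes U :: "'m set" and \<phi> :: "'m \<Rightarrow> real ^ 'd" and v :: "real ^ 'd"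
  assumes U: "(U, \<phi>) \<in> A"
begin

lemma smooth_vector_field_nabla_coord:
  "smooth_vector_field A U (nabla (coord_field A (U, \<phi>) v) (coord_field A (U, \<phi>) w))"
  by (rule smooth_vector_field_nabla[OF open_chart_domain[OF U] smooth_vector_field_coord_field[OF U] 
        smooth_vector_field_coord_field[OF U]])

lemma connection_matrix_smooth: "C_inf_on A U (\<lambda>q. connection_matrix (U, \<phi>) v q $ k $ j)"
  using smooth_vector_field_components[OF U open_chart_domain[OF U] order_refl smooth_vector_field_nabla_coord]
  by (simp add: connection_matrix_def)

lemma nabla_coord_field:
  assumes "q \<in> U"
  shows "nabla (coord_field A (U, \<phi>) v) (coord_field A (U, \<phi>) (axis j 1)) q =
    (\<lambda>\<psi>. \<Sum>k\<in>UNIV. connection_matrix (U, \<phi>) v q $ k $ j * coord_field A (U, \<phi>) (axis k 1) q \<psi>)"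
  using tangent_expand[OF U assms smooth_vector_field_tangent[OF smooth_vector_field_nabla_coord assms]]
  by (simp add: connection_matrix_def)

text \<open>Metric compatibility for two coordinate fields. Expanding the derivative of the first by
  the connection matrix gives the transposed product; doing so for the second, with symmetry of
  \<open>g\<close>, gives the other.\<close>

lemma metric_matrix_derivative:
  assumes "p \<in> U"
  shows "coord_field A (U, \<phi>) v p (\<lambda>q. metric_matrix (U, \<phi>) q $ i $ j) = 
    (transpose (connection_matrix (U, \<phi>) v p) ** metric_matrix (U, \<phi>) p + 
     metric_matrix (U, \<phi>) p ** connection_matrix (U, \<phi>) v p) $ i $ j"
proof -
  let ?D = "\<lambda>j. coord_field A (U, \<phi>) (axis j 1)" and ?V = "coord_field A (U, \<phi>) v"
  note svf = smooth_vector_field_coord_field[OF U]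
  note ct = coord_field_in_tangent[OF U assms]
  have *: "g p (nabla ?V (?D i) p) (?D j p) = 
      (\<Sum>k\<in>UNIV. connection_matrix (U, \<phi>) v p $ k $ i * metric_matrix (U, \<phi>) p $ k $ j)" for i j
    unfolding nabla_coord_field[OF assms] by (simp add: metric_sum_left ct metric_matrix_def)
  have sym: "metric_matrix (U, \<phi>) p $ k $ i = metric_matrix (U, \<phi>) p $ i $ k" for i k
    using metric_sym[OF ct ct] by (simp add: metric_matrix_def)
  have "?V p (\<lambda>q. metric_matrix (U, \<phi>) q $ i $ j) = 
      g p (nabla ?V (?D i) p) (?D j p) + g p (?D i p) (nabla ?V (?D j) p)"
    using metric_compatible[OF open_chart_domain[OF U] svf svf svf assms, of v "axis i 1" "axis j 1"]
    by (simp add: metric_matrix_def)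
  also have "g p (?D i p) (nabla ?V (?D j) p) = g p (nabla ?V (?D j) p) (?D i p)"
    by (rule metric_sym[OF ct smooth_vector_field_tangent[OF smooth_vector_field_nabla_coord assms]])
  finally show ?thesis
    unfolding * by (simp add: matrix_matrix_mult_def transpose_def sym[of _ i] mult.commute)
qed

end

text \<open>Along a coordinate line the parallel transport equation is the linear equation
  \<open>B' = - \<Gamma> B\<close>; metric compatibility says that \<open>B\<^sup>T G B\<close> is constant along its solutions.\<close>

lemma horizontal_lift_exists:
  assumes "w \<in> orthonormal_frames A g" "(U, \<phi>) \<in> A" "fst w \<in> U"
  obtains c I where "horizontal_curve A g nabla I c" "0 \<in> I" "c 0 = w"
    "velocity A UNIV (\<lambda>s. fst (c s)) 0 = coord_field A (U, \<phi>) v (fst w)"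
proof -
  obtain p u where w: "w = (p, u)" by fastforce
  note U = assms(2)
  have pU: "p \<in> U" using assms(3) w by simp
  have u: "linear_frame A p u" and ortho: "\<And>x y. g p (u x) (u y) = x \<bullet> y"
    using assms(1) w unfolding orthonormal_frames_def by auto
  let ?C = "coord_field A (U, \<phi>)" and ?cmp = "components (U, \<phi>)"
  let ?D = "\<lambda>j. ?C (axis j 1)" and ?G = "metric_matrix (U, \<phi>)"
  obtain a0 where a0: "a0 > 0" and line: "\<And>s. s \<in> {-a0<..<a0} \<Longrightarrow> \<phi> p + s *\<^sub>R v \<in> \<phi> ` U"
    using coord_line[OF U pU, where v = v] by blast
  define \<gamma> where "\<gamma> s = inv_into U \<phi> (\<phi> p + s *\<^sub>R v)" for s
  have \<gamma>U: "\<gamma> s \<in> U" and \<phi>\<gamma>: "\<phi> (\<gamma> s) = \<phi> p + s *\<^sub>R v" if "s \<in> {-a0<..<a0}" for s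
    using line[OF that] U by (simp_all add: \<gamma>_def)
  have \<gamma>0: "\<gamma> 0 = p" using U pU by (simp add: \<gamma>_def)
  define N where "N s = - connection_matrix (U, \<phi>) v (\<gamma> s)" for s
  have o: "open {-a0<..<a0}" by simp
  have line_smooth: "smooth_on {-a0<..<a0} (\<lambda>s. \<phi> p + s *\<^sub>R v)"
    by (intro smooth_on_add smooth_on_const smooth_on_scaleR smooth_on_ident o)
  have N_smooth: "smooth_on {-a0<..<a0} N"
  proof (rule smooth_on_matrix_entries[OF o])
    fix k j
    have "smooth_on (\<phi> ` U) (\<lambda>x. connection_matrix (U, \<phi>) v (inv_into U \<phi> x) $ k $ j)"
      by (rule C_inf_on_chart_iff[OF U open_chart_domain[OF U] order_refl, THEN iffD1, OF connection_matrix_smooth[OF U]])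
    then have "smooth_on {-a0<..<a0} (\<lambda>s. connection_matrix (U, \<phi>) v (inv_into U \<phi> (\<phi> p + s *\<^sub>R v)) $ k $ j)"
      by (rule smooth_on_compose[OF o _ line_smooth]) (use line in auto)
    then show "smooth_on {-a0<..<a0} (\<lambda>s. N s $ k $ j)"
      using smooth_on_bounded_linear[OF o bounded_linear_minus[OF bounded_linear_ident]]
      by (simp add: N_def \<gamma>_def)
  qed
  \<comment> \<open>The existence result asks for continuity on a closed interval, hence half of the
    open one.\<close>
  have "continuous_on {-(a0/2)..a0/2} N"
    by (rule continuous_on_subset[OF smooth_on_imp_continuous_on[OF N_smooth]]) (use a0 in auto)
  then obtain \<delta> B where \<delta>: "0 < \<delta>" "\<delta> \<le> a0/2" and B0: "B 0 = matrix (\<lambda>x. ?cmp (u x))"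
      and B: "\<And>t. t \<in> {-\<delta><..<\<delta>} \<Longrightarrow> (B has_vector_derivative N t ** B t) (at t)"
    using linear_ode_exists[OF bounded_bilinear_matrix_mult, of "a0/2" N "matrix (\<lambda>x. ?cmp (u x))"] a0 by auto
  define J where "J = {-\<delta><..<\<delta>}"
  have J: "open J" "0 \<in> J" "J \<subseteq> {-a0<..<a0}" "is_interval J" "convex J"
    using \<delta> a0 by (auto simp: J_def is_interval_oo)
  have \<gamma>J: "\<gamma> s \<in> U" if "s \<in> J" for s using \<gamma>U J(3) that by blast
  have \<gamma>J': "\<gamma> ` J \<subseteq> U" using \<gamma>J by blast
  have BJ: "(B has_vector_derivative N t ** B t) (at t)" if "t \<in> J" for t
    using B that by (simp add: J_def)
  have N_J: "smooth_on J N" by (rule smooth_on_subset[OF N_smooth J(3)])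
  have B_smooth: "smooth_on J B"
    by (rule linear_ode_smooth[OF bounded_bilinear_matrix_mult J(1) N_J BJ])
  have d\<gamma>: "((\<lambda>s. \<phi> (\<gamma> s)) has_vector_derivative v) (at t)" if "t \<in> J" for t
    by (rule has_vector_derivative_transform_within_open[OF _ J(1) that, of "\<lambda>s. \<phi> p + s *\<^sub>R v"])
      (use has_vector_derivative_line[of "\<phi> p" 0 v t] \<phi>\<gamma> J(3) in auto)
  have vel: "velocity A UNIV \<gamma> t = ?C v (\<gamma> t)" if "t \<in> J" for t
    by (rule velocity_eq_coord_field[OF U J(1) that \<gamma>J' d\<gamma>[OF that]])
  \<comment> \<open>Up to transport in time this is the matrix of inner products of the frame
    vectors, so its constancy preserves orthonormality.\<close>
  define M where "M s = transpose (B s) ** (?G (\<gamma> s) ** B s)" for s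
  have M_const: "M s = M 0" if "s \<in> J" for s
  proof -
    have "(M has_vector_derivative 0) (at t)" if t: "t \<in> J" for t
    proof -
      let ?\<Gamma> = "connection_matrix (U, \<phi>) v (\<gamma> t)"
      let ?G' = "transpose ?\<Gamma> ** ?G (\<gamma> t) + ?G (\<gamma> t) ** ?\<Gamma>"
      have dG: "((\<lambda>s. ?G (\<gamma> s)) has_vector_derivative ?G') (at t)"
      proof (rule has_vector_derivative_matrix_entries)
        fix i j
        have "smooth_fun_at A UNIV (\<lambda>q. ?G q $ i $ j) (\<gamma> t)"
          using metric_coord_smooth[OF U] \<gamma>J[OF t] unfolding C_inf_on_def by (simp add: metric_matrix_def)
        then show "((\<lambda>s. ?G (\<gamma> s) $ i $ j) has_real_derivative ?G' $ i $ j) (at t)"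
          using velocity_apply(1)[OF U J(1) t \<gamma>J' d\<gamma>[OF t]]
          unfolding vel[OF t] metric_matrix_derivative[OF U \<gamma>J[OF t], symmetric] by blast
      qed
      have bt: "bounded_linear (transpose :: real ^ 'd ^ 'd \<Rightarrow> real ^ 'd ^ 'd)"
        unfolding linear_conv_bounded_linear[symmetric] by (rule linearI) (simp_all add: transpose_def vec_eq_iff)
      have dBT: "((\<lambda>s. transpose (B s)) has_vector_derivative transpose (N t ** B t)) (at t)"
        by (rule bounded_linear.has_vector_derivative[OF bt BJ[OF t]])
      interpret mm: bounded_bilinear "(**) :: real ^ 'd ^ 'd \<Rightarrow> real ^ 'd ^ 'd \<Rightarrow> real ^ 'd ^ 'd"
        by (rule bounded_bilinear_matrix_mult)
      have "(M has_vector_derivative transpose (B t) ** (?G (\<gamma> t) ** (N t ** B t) + ?G' ** B t) + 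
          transpose (N t ** B t) ** (?G (\<gamma> t) ** B t)) (at t)"
        unfolding M_def by (intro mm.has_vector_derivative dBT dG BJ t)
      \<comment> \<open>Since \<open>N t\<close> is minus the connection matrix \<Gamma>, the two
        terms with \<open>G \<Gamma>\<close> cancel, and so do the two with
        \<open>\<Gamma>^T G\<close>.\<close>
      moreover have "transpose (B t) ** (?G (\<gamma> t) ** (N t ** B t) + ?G' ** B t) + 
          transpose (N t ** B t) ** (?G (\<gamma> t) ** B t) = 0"
      proof -
        have "transpose (N t) = - transpose ?\<Gamma>" by (simp add: N_def transpose_def vec_eq_iff)
        then have NB: "transpose (N t ** B t) = - (transpose (B t) ** transpose ?\<Gamma>)"
          by (simp add: matrix_transpose_mul mm.minus_right)
        show ?thesis
          unfolding NB by (simp add: N_def mm.add_left mm.add_right mm.minus_left mm.minus_right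
              matrix_mul_assoc)
      qed
      ultimately show ?thesis by simp
    qed
    then obtain k where "\<And>t. t \<in> J \<Longrightarrow> M t = k"
      using has_vector_derivative_zero_constant[OF J(5) has_vector_derivative_at_within] by blast
    then show ?thesis using J(2) that by simp
  qed
  have M: "g (\<gamma> s) (?C (B s *v x) (\<gamma> s)) (?C (B s *v y) (\<gamma> s)) = (M s *v y) \<bullet> x" if "s \<in> J" for s x y
  proof -
    have "(transpose (B s) *v z) \<bullet> x = z \<bullet> (B s *v x)" for z
      by (simp add: transpose_matrix_vector dot_lmul_matrix)
    then show ?thesis
      using metric_matrix_vector[OF U \<gamma>J[OF that], of "B s *v y" "B s *v x"]
      by (simp add: M_def matrix_vector_mul_assoc[symmetric])
  qed
  define F where "F s x = ?C (B s *v x) (\<gamma> s)" for s x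
  have F0: "F 0 = u"
  proof
    fix x
    show "F 0 x = u x"
      using coord_field_components[OF U pU linear_frame_inverse(3)[OF u]]
      by (simp add: F_def B0 \<gamma>0 frame_components_matrix[OF u])
  qed
  have F_ortho: "g (\<gamma> s) (F s x) (F s y) = x \<bullet> y" if "s \<in> J" for s x y
  proof -
    have "g (\<gamma> s) (F s x) (F s y) = (M s *v y) \<bullet> x" unfolding F_def by (rule M[OF that])
    also have "\<dots> = (M 0 *v y) \<bullet> x" by (simp only: M_const[OF that])
    also have "\<dots> = g p (u x) (u y)" using M[OF J(2), of x y] unfolding F0[symmetric] by (simp add: F_def \<gamma>0)
    finally show ?thesis using ortho by simp
  qed
  have F_frame: "linear_frame A (\<gamma> s) (F s)" if s: "s \<in> J" for s
  proof -
    note q = \<gamma>J[OF s]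
    \<comment> \<open>Orthonormality gives injectivity: if \<open>B s\<close> kills
      \<open>x\<close>, then \<open>x \<bullet> x\<close>, the squared length of
      \<open>F s x\<close>, is 0. Hence the transported frame is still a basis.\<close>
    have "x = 0" if "B s *v x = 0" for x
      using F_ortho[OF s, of x x] metric_matrix_vector[OF U q, of "B s *v x" "B s *v x"] that by (simp add: F_def)
    then have "invertible (B s)" using invertible_left_inverse matrix_left_invertible_ker by blast
    then have "bij ((*v) (B s))" by (simp add: invertible_eq_bij)
    moreover have "bij_betw (\<lambda>y. ?C y (\<gamma> s)) UNIV (tangent A (\<gamma> s))"
      unfolding bij_betw_def tangent_eq_range[OF U q]
      by (auto intro: inj_on_inverseI[of _ ?cmp] simp: components_coord_field[OF U q])
    ultimately have "bij_betw (F s) UNIV (tangent A (\<gamma> s))"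
      using bij_betw_trans unfolding F_def[abs_def] by (fastforce simp: o_def)
    then show ?thesis
      unfolding linear_frame_def F_def
      by (simp add: matrix_vector_right_distrib coord_field_add[OF U q] coord_field_scaleR[OF U q] 
          matrix_vector_mult_scaleR)
  qed
  define c where "c s = (\<gamma> s, F s)" for s
  have c0: "c 0 = w" by (simp add: c_def \<gamma>0 F0 w)
  have cmpF: "?cmp (F s x) = B s *v x" if "s \<in> J" for s x
    unfolding F_def by (rule components_coord_field[OF U \<gamma>J[OF that]])
  have \<phi>\<gamma>_smooth: "smooth_on J (\<lambda>s. \<phi> (\<gamma> s))"
    by (rule smooth_on_transform[OF smooth_on_subset[OF line_smooth J(3)] J(1)]) (use \<phi>\<gamma> J(3) in auto)
  have c_smooth: "smooth_curve (frame_atlas A) (orthonormal_frames A g) J c"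
  proof (rule smooth_curveI[OF J(1,4)])
    show "c ` J \<subseteq> orthonormal_frames A g"
      using F_frame F_ortho by (auto simp: c_def orthonormal_frames_def)
    let ?\<Phi> = "\<lambda>(p, u). (\<phi> p, matrix (\<lambda>x. ?cmp (u x)))"
    have "smooth_on J (\<lambda>s. (\<phi> (\<gamma> s), B s))" by (rule smooth_on_Pair[OF J(1) \<phi>\<gamma>_smooth B_smooth])
    then have "smooth_on J (\<lambda>s. ?\<Phi> (c s))"
      by (rule smooth_on_transform[OF _ J(1)]) (simp add: c_def cmpF)
    moreover have "c ` J \<subseteq> {(p, u). p \<in> U \<and> linear_frame A p u}"
      using F_frame \<gamma>J by (auto simp: c_def)
    ultimately show "\<exists>D \<Phi> K. (D, \<Phi>) \<in> frame_atlas A \<and> open K \<and> t \<in> K \<and> K \<subseteq> J \<and> c ` K \<subseteq> D \<and> 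
        smooth_on K (\<lambda>s. \<Phi> (c s))" if "t \<in> J" for t
      using frame_atlasI[OF U] J(1) that order_refl by blast
  qed
  have par: "parallel_along A nabla J \<gamma> (\<lambda>s. F s e)" for e
    unfolding parallel_along_def
  proof (intro conjI ballI impI)
    have Ft: "F s e \<in> tangent A (\<gamma> s)" if "s \<in> J" for s
      using F_frame[OF that] by (rule linear_frame_inverse(3))
    have dF: "((\<lambda>s. ?cmp (F s e) $ j) has_real_derivative ((N t ** B t) *v e) $ j) (at t)" if "t \<in> J" for t j
    proof -
      have "((\<lambda>s. B s *v e) has_vector_derivative (N t ** B t) *v e) (at t)"
        by (rule bounded_linear.has_vector_derivative[OF bounded_linear_matrix_vector_left BJ[OF that]])
      then have "((\<lambda>s. ?cmp (F s e)) has_vector_derivative (N t ** B t) *v e) (at t)"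
        by (rule has_vector_derivative_transform_within_open[OF _ J(1) that]) (simp add: cmpF)
      then show ?thesis by (rule has_real_derivative_nth)
    qed
    show "smooth_curve (tangent_bundle_atlas A) (tangent_bundle A) J (\<lambda>t. (\<gamma> t, F t e))"
    proof (rule smooth_curveI[OF J(1,4)])
      show "(\<lambda>t. (\<gamma> t, F t e)) ` J \<subseteq> tangent_bundle A" using Ft by (auto simp: tangent_bundle_def)
      let ?\<Phi> = "\<lambda>(p, X). (\<phi> p, ?cmp X)"
      have "smooth_on J (\<lambda>s. (\<phi> (\<gamma> s), B s *v e))"
        by (rule smooth_on_Pair[OF J(1) \<phi>\<gamma>_smooth smooth_on_bounded_linear[OF J(1) bounded_linear_matrix_vector_left B_smooth]])
      then have "smooth_on J (\<lambda>s. ?\<Phi> (\<gamma> s, F s e))"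
        by (rule smooth_on_transform[OF _ J(1)]) (simp add: cmpF)
      moreover have "(\<lambda>t. (\<gamma> t, F t e)) ` J \<subseteq> {(p, X). p \<in> U \<and> X \<in> tangent A p}"
        using Ft \<gamma>J by auto
      moreover have "({(p, X). p \<in> U \<and> X \<in> tangent A p}, ?\<Phi>) \<in> tangent_bundle_atlas A"
        using U unfolding tangent_bundle_atlas_def by force
      ultimately show "\<exists>D \<Phi> K. (D, \<Phi>) \<in> tangent_bundle_atlas A \<and> open K \<and> t \<in> K \<and> K \<subseteq> J \<and> 
          (\<lambda>t. (\<gamma> t, F t e)) ` K \<subseteq> D \<and> smooth_on K (\<lambda>s. \<Phi> (\<gamma> s, F s e))" if "t \<in> J" for t
        using J(1) that order_refl by blast
    qed
    fix t \<kappa> assume t: "t \<in> J" and \<kappa>: "\<kappa> \<in> A" "\<gamma> t \<in> fst \<kappa>"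
    obtain U' \<phi>' where U': "\<kappa> = (U', \<phi>')" by fastforce
    let ?\<Gamma> = "connection_matrix (U, \<phi>) v (\<gamma> t)"
    \<comment> \<open>In the chart of the construction this is the differential equation for
      \<open>B\<close>, applied to \<open>e\<close>.\<close>
    have "covariant_derivative A nabla (U, \<phi>) \<gamma> (\<lambda>s. F s e) t \<psi> = 0" for \<psi>
    proof -
      have N: "nabla_at A nabla (\<gamma> t) (velocity A UNIV \<gamma> t) (?D j) \<psi> = 
          (\<Sum>k\<in>UNIV. ?\<Gamma> $ k $ j * ?D k (\<gamma> t) \<psi>)" for j
        unfolding vel[OF t]
        using nabla_at_coord_field[OF U open_chart_domain[OF U] \<gamma>J[OF t] \<gamma>J[OF t] smooth_vector_field_coord_field[OF U]]
          nabla_coord_field[OF U \<gamma>J[OF t]] by simp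
      have "(\<Sum>j\<in>UNIV. (B t *v e) $ j * (\<Sum>k\<in>UNIV. ?\<Gamma> $ k $ j * ?D k (\<gamma> t) \<psi>)) = 
          (\<Sum>j\<in>UNIV. \<Sum>k\<in>UNIV. ?\<Gamma> $ k $ j * (B t *v e) $ j * ?D k (\<gamma> t) \<psi>)"
        by (simp add: sum_distrib_left mult_ac)
      also have "\<dots> = (\<Sum>k\<in>UNIV. \<Sum>j\<in>UNIV. ?\<Gamma> $ k $ j * (B t *v e) $ j * ?D k (\<gamma> t) \<psi>)"
        by (rule sum.swap)
      also have "\<dots> = (\<Sum>k\<in>UNIV. (?\<Gamma> *v (B t *v e)) $ k * ?D k (\<gamma> t) \<psi>)"
        by (simp add: matrix_vector_mult_def[of ?\<Gamma>] sum_distrib_right)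
      also have "?\<Gamma> *v (B t *v e) = - ((N t ** B t) *v e)"
        by (simp add: N_def matrix_vector_mul_assoc[symmetric] matrix_vector_mult_def[of "- ?\<Gamma>"] 
            matrix_vector_mult_def[of ?\<Gamma>] vec_eq_iff sum_negf)
      finally show ?thesis
        unfolding covariant_derivative_def N DERIV_imp_deriv[OF dF[OF t]] cmpF[OF t]
        by (simp add: sum.distrib sum_negf)
    qed
    then have zero: "covariant_derivative A nabla (U, \<phi>) \<gamma> (\<lambda>s. F s e) t = (\<lambda>f. 0)" by blast
    \<comment> \<open>The times at which the curve lies in both charts form an open neighbourhood of
      \<open>t\<close>.\<close>
    let ?K = "{s \<in> J. \<phi> (\<gamma> s) \<in> \<phi> ` (U \<inter> U')}"
    have oUU: "open (U \<inter> U')" using open_chart_domain U \<kappa>(1) U' by blast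
    have oK: "open ?K"
      by (rule open_preimage_smooth_on[OF J(1) \<phi>\<gamma>_smooth open_chart_image_subset[OF U oUU]]) auto
    have tK: "t \<in> ?K" using t \<gamma>J[OF t] \<kappa>(2) U' by auto
    have KU: "\<gamma> ` ?K \<subseteq> U \<inter> U'"
    proof (rule image_subsetI)
      fix s assume s: "s \<in> ?K"
      then have "\<gamma> s \<in> U" using \<gamma>J by blast
      then show "\<gamma> s \<in> U \<inter> U'" using chart_mem_image[OF U, of "U \<inter> U'" "\<gamma> s"] s by blast
    qed
    have "covariant_derivative A nabla (U', \<phi>') \<gamma> (\<lambda>s. F s e) t = 
        covariant_derivative A nabla (U, \<phi>) \<gamma> (\<lambda>s. F s e) t"
      by (rule covariant_derivative_change_chart[OF U \<kappa>(1)[unfolded U'] oK tK KU Ft d\<gamma>[OF t] dF[OF t]]) blast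
    then show "covariant_derivative A nabla \<kappa> \<gamma> (\<lambda>s. F s e) t = (\<lambda>f. 0)"
      by (simp add: U' zero)
  qed
  have "horizontal_curve A g nabla J c"
    unfolding horizontal_curve_def using c_smooth par by (simp add: c_def frame_proj_def o_def)
  moreover have "velocity A UNIV (\<lambda>s. fst (c s)) 0 = ?C v (fst w)"
    using vel[OF J(2)] by (simp add: c_def \<gamma>0 w)
  ultimately show ?thesis using that[of J c] J(2) c0 by blast
qed


section \<open>The horizontal Laplacian of a lifted function\<close>

text \<open>Existence of lifts and uniqueness of horizontal velocities make the definite description
  of \<open>H_i\<close> denote. From here on \<open>H_i\<close> is handled only as the velocity of
  some horizontal curve.\<close>

lemma canonical_horizontal_eq:
  assumes "w \<in> orthonormal_frames A g"
  obtains c I t where "horizontal_curve A g nabla I c" "t \<in> I" "c t = w"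
    "velocity A UNIV (\<lambda>s. fst (c s)) t = snd w (axis i 1)"
    "canonical_horizontal A g nabla i w = velocity (frame_atlas A) (orthonormal_frames A g) c t"
proof -
  let ?S = "orthonormal_frames A g"
  obtain U \<phi> where U: "(U, \<phi>) \<in> A" "fst w \<in> U" using chart_exists .
  have "linear_frame A (fst w) (snd w)" using assms unfolding orthonormal_frames_def by auto
  then have "snd w (axis i 1) \<in> tangent A (fst w)" by (rule linear_frame_inverse(3))
  then obtain v where v: "snd w (axis i 1) = coord_field A (U, \<phi>) v (fst w)"
    unfolding tangent_eq_range[OF U] by blast
  obtain c I where c: "horizontal_curve A g nabla I c" "0 \<in> I" "c 0 = w"
      "velocity A UNIV (\<lambda>s. fst (c s)) 0 = snd w (axis i 1)"
    by (rule horizontal_lift_exists[OF assms U, where v = v, folded v])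
  let ?X = "velocity (frame_atlas A) ?S c 0"
  have "canonical_horizontal A g nabla i w = ?X"
    unfolding canonical_horizontal_def
  proof (rule the_equality)
    have "?X \<in> horizontal_space A g nabla w" using c(1-3) unfolding horizontal_space_def by blast
    then show "?X \<in> horizontal_space A g nabla w \<and> differential A frame_proj w ?X = snd w (axis i 1)"
      using c(3,4) differential_frame_velocity[of c 0 ?S] by simp
    fix Y assume Y: "Y \<in> horizontal_space A g nabla w \<and> differential A frame_proj w Y = snd w (axis i 1)"
    then obtain b K r where b: "horizontal_curve A g nabla K b" "r \<in> K" "b r = w"
        and Yb: "Y = velocity (frame_atlas A) ?S b r"
      unfolding horizontal_space_def by blast
    have "velocity A UNIV (\<lambda>s. fst (b s)) r = snd w (axis i 1)"
      using Y b(3) differential_frame_velocity[of b r ?S] Yb by simp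
    then show "Y = ?X"
      unfolding Yb using horizontal_velocity_unique[OF c(1,2) b(1,2)] b(3) c(3,4) by simp
  qed
  then show ?thesis using that c by blast
qed

text \<open>The defining property of the projection of \<open>H_i\<close>, evaluated at
  \<open>f\<close>; smoothness of \<open>f\<close> selects the nontrivial branch of
  \<open>differential\<close>.\<close>

lemma canonical_horizontal_lift:
  assumes "w \<in> orthonormal_frames A g" "smooth_fun_at A UNIV f (fst w)"
  shows "canonical_horizontal A g nabla i w (f \<circ> frame_proj) = snd w (axis i 1) f"
proof -
  obtain c I t where c: "horizontal_curve A g nabla I c" "t \<in> I" "c t = w"
    "velocity A UNIV (\<lambda>s. fst (c s)) t = snd w (axis i 1)"
    "canonical_horizontal A g nabla i w = velocity (frame_atlas A) (orthonormal_frames A g) c t"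
    by (rule canonical_horizontal_eq[OF assms(1)])
  have "differential A frame_proj w (canonical_horizontal A g nabla i w) f = snd w (axis i 1) f"
    using differential_frame_velocity[of c t "orthonormal_frames A g"] c by simp
  then show ?thesis using assms(2) by (simp add: differential_def frame_proj_def)
qed

text \<open>The inner function is known only at orthonormal frames, where it is
  \<open>(u e_i) f\<close>. This is enough: smoothness relative to \<open>O(M)\<close> and the
  derivative along a horizontal curve look at no other frames. Constancy of the coefficients of
  \<open>V\<close> then collects the sums over \<open>j\<close> into derivatives along
  \<open>V\<close>.\<close>

lemma canonical_horizontal_twice:
  assumes "(p, u) \<in> orthonormal_frames A g" "C_inf_on A UNIV f" "(U, \<phi>) \<in> A" "p \<in> U"
    and V: "V = coord_field A (U, \<phi>) (components (U, \<phi>) (u (axis i 1)))"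
  shows "canonical_horizontal A g nabla i (p, u) (\<lambda>w. canonical_horizontal A g nabla i w (f \<circ> frame_proj)) = 
    V p (\<lambda>q. V q f) - nabla V V p f"
proof -
  let ?S = "orthonormal_frames A g" and ?x = "components (U, \<phi>) (u (axis i 1))"
  let ?D = "\<lambda>j. coord_field A (U, \<phi>) (axis j 1)"
  let ?H = "\<lambda>w. canonical_horizontal A g nabla i w (f \<circ> frame_proj)"
  have f: "smooth_fun_at A UNIV f q" for q using assms(2) unfolding C_inf_on_def by blast
  have H: "?H w = snd w (axis i 1) f" if "w \<in> ?S" for w
    by (rule canonical_horizontal_lift[OF that f])
  note svf = smooth_vector_field_coord_field[OF assms(3)] and oU = open_chart_domain[OF assms(3)]
  obtain c I t where c: "horizontal_curve A g nabla I c" "t \<in> I" "c t = (p, u)"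
    "velocity A UNIV (\<lambda>s. fst (c s)) t = snd (p, u) (axis i 1)"
    "canonical_horizontal A g nabla i (p, u) = velocity (frame_atlas A) ?S c t"
    by (rule canonical_horizontal_eq[OF assms(1)])
  have "linear_frame A p u" using assms(1) unfolding orthonormal_frames_def by auto
  then have Vp: "V p = u (axis i 1)"
    unfolding V by (intro coord_field_components[OF assms(3,4)] linear_frame_inverse(3))
  have "smooth_fun_at (frame_atlas A) ?S (\<lambda>w. snd w (axis i 1) f) (p, u)"
    by (rule smooth_fun_at_frame_eval) (simp add: f)
  then have "smooth_fun_at (frame_atlas A) ?S ?H (p, u)"
    unfolding smooth_fun_at_def using H by simp
  then have "canonical_horizontal A g nabla i (p, u) ?H = deriv (\<lambda>s. ?H (c s)) t"
    unfolding c(5) velocity_def by (simp add: c(3))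
  also have "\<dots> = (\<Sum>j\<in>UNIV. ?x $ j * (V p (\<lambda>q. ?D j q f) - nabla_at A nabla p (V p) (?D j) f))"
  proof (rule DERIV_imp_deriv)
    have I: "open I" "c ` I \<subseteq> ?S" using c(1) unfolding horizontal_curve_def smooth_curve_def by blast+
    have "((\<lambda>s. snd (c s) (axis i 1) f) has_real_derivative
        (\<Sum>j\<in>UNIV. ?x $ j * (V p (\<lambda>q. ?D j q f) - nabla_at A nabla p (V p) (?D j) f))) (at t)"
      using horizontal_curve_derivative[OF c(1,2) assms(3) _ f refl, where e = "axis i 1"] c(3,4) assms(4) Vp by simp
    then show "((\<lambda>s. ?H (c s)) has_real_derivative
        (\<Sum>j\<in>UNIV. ?x $ j * (V p (\<lambda>q. ?D j q f) - nabla_at A nabla p (V p) (?D j) f))) (at t)"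
      by (rule has_field_derivative_transform_within_open[OF _ I(1) c(2)]) (rule H[symmetric], use I(2) in blast)
  qed
  also have "\<dots> = (\<Sum>j\<in>UNIV. ?x $ j * V p (\<lambda>q. ?D j q f)) - (\<Sum>j\<in>UNIV. ?x $ j * nabla V (?D j) p f)"
    using nabla_at_coord_field[OF assms(3) oU assms(4,4) svf, of ?x] 
    by (simp add: V right_diff_distrib sum_subtractf)
  also have "(\<Sum>j\<in>UNIV. ?x $ j * V p (\<lambda>q. ?D j q f)) = V p (\<lambda>q. V q f)"
  proof -
    have sm: "smooth_fun_at A UNIV (\<lambda>q. ?D j q f) p" for j
      by (rule smooth_vector_field_apply[OF svf oU assms(4) f])
    have "V p (\<lambda>q. V q f) = V p (\<lambda>q. \<Sum>j\<in>UNIV. ?x $ j * ?D j q f)"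
      unfolding V
      by (rule tangent_cong[OF coord_field_in_tangent[OF assms(3,4)] oU assms(4)])
        (rule coord_field_expand[OF assms(3)])
    \<comment> \<open>Tangent vectors are additive in their argument only on smooth functions, so
      the coordinate expressions, known to be differentiable, are differentiated term by
      term.\<close>
    also have "\<dots> = (\<Sum>j\<in>UNIV. ?x $ j * V p (\<lambda>q. ?D j q f))"
    proof (unfold V, rule coord_field_eqI[OF assms(3,4), where
          D = "\<lambda>h. \<Sum>j\<in>UNIV. ?x $ j * coord_field A (U, \<phi>) h p (\<lambda>q. ?D j q f)"])
      show "smooth_fun_at A UNIV (\<lambda>q. \<Sum>j\<in>UNIV. ?x $ j * ?D j q f) p"
        by (rule smooth_fun_at_sum) (rule smooth_fun_at_mult[OF smooth_fun_at_const sm])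
      show "((\<lambda>y. \<Sum>j\<in>UNIV. ?x $ j * ?D j (inv_into U \<phi> y) f) has_derivative 
          (\<lambda>h. \<Sum>j\<in>UNIV. ?x $ j * coord_field A (U, \<phi>) h p (\<lambda>q. ?D j q f))) (at (\<phi> p))"
        using smooth_fun_at_has_derivative[OF assms(3,4) sm]
        unfolding coord_field_apply(1)[OF assms(3,4) sm]
        by (rule has_derivative_sum[OF has_derivative_mult_right])
    qed
    finally show ?thesis by simp
  qed
  also have "(\<Sum>j\<in>UNIV. ?x $ j * nabla V (?D j) p f) = nabla V V p f"
  proof -
    \<comment> \<open>The coefficients of \<open>V\<close> are constant, so this removes the
      derivative terms of the Leibniz rule.\<close>
    have const: "V p (\<lambda>q. a) = 0" for a
      unfolding V by (rule coord_field_eqI[OF assms(3,4) smooth_fun_at_const]) auto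
    have "nabla V V p = nabla V (\<lambda>q \<psi>. \<Sum>j\<in>UNIV. ?x $ j * ?D j q \<psi>) p"
    proof (rule nabla_cong[OF oU])
      show "smooth_vector_field A U (\<lambda>q \<psi>. \<Sum>j\<in>UNIV. ?x $ j * ?D j q \<psi>)"
        by (intro smooth_vector_field_sum svf) (simp add: C_inf_on_def smooth_fun_at_const)
      show "V q = (\<lambda>\<psi>. \<Sum>j\<in>UNIV. ?x $ j * ?D j q \<psi>)" if "q \<in> U" for q
        unfolding V by (intro ext coord_field_expand[OF assms(3) that])
    qed (simp_all add: V svf assms(4))
    also have "\<dots> = (\<lambda>\<psi>. \<Sum>j\<in>UNIV. V p (\<lambda>q. ?x $ j) * ?D j p \<psi> + ?x $ j * nabla V (?D j) p \<psi>)"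
      by (rule nabla_sum_right[OF oU]) (simp_all add: V svf assms(4) C_inf_on_def smooth_fun_at_const)
    finally show ?thesis by (simp add: const)
  qed
  finally show ?thesis .
qed

text \<open>One chart around the base point serves all \<open>i\<close>, each with its own extension
  of \<open>u e_i\<close>; the two sums then agree term by term.\<close>

lemma horizontal_laplacian_lift:
  assumes "w \<in> orthonormal_frames A g" "C_inf_on A UNIV f"
  shows "horizontal_laplacian A g nabla (f \<circ> frame_proj) w = laplace_beltrami A g nabla f (frame_proj w)"
proof -
  obtain p u where w: "w = (p, u)" by fastforce
  obtain U \<phi> where U: "(U, \<phi>) \<in> A" "p \<in> U" using chart_exists .
  have "C_inf_on A U f" using assms(2) C_inf_on_subset by blast
  from laplace_beltrami_orthonormal[OF assms(1)[unfolded w] U this refl] show ?thesis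
    unfolding horizontal_laplacian_def w frame_proj_def fst_conv
    using canonical_horizontal_twice[OF assms(1)[unfolded w] assms(2) U refl]
    by (simp add: frame_proj_def)
qed

end

theorem proposition3p6:
  fixes A :: "('m::{t2_space, second_countable_topology}, real ^ 'd) chart set"
    and g :: "'m metric"
    and nabla :: "'m connection"
    and f :: "'m \<Rightarrow> real"
  assumes "smooth_atlas A"
    and "riemannian_metric A g"
    and "levi_civita_connection A g nabla"
    and "geodesically_complete A nabla"
    and "C_inf_on A UNIV f"
  shows "\<forall>w\<in>orthonormal_frames A g.
    horizontal_laplacian A g nabla (f \<circ> frame_proj) w =
      (laplace_beltrami A g nabla f \<circ> frame_proj) w"
proof -
  interpret levi_civita A g nabla
    by unfold_locales (fact assms)+
  show ?thesis using horizontal_laplacian_lift[OF _ assms(5)] by simp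
qed

end
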